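(* Suppose $\mathscr{L}_q=\{\forall,\exists\}$ and $\mathcal{L}$ is the extension of $\mathcal{L}^m$ by possibly some of the rules $=$-Adj, $\exists$-Adj, $\forall$-Adj, and by any number of structural and propositional-connective sequent rules. Let $\mathcal{K}=\{(\mathcal{C}_T,P_T): T \text{ is an } \mathcal{L}\text{-theory}\}$. Then $\vdash_{\mathcal{L}}\ =\ \models_{\mathcal{K}}$, i.e. for every signature and all theories $T,T'$, $T\vdash_{\mathcal{L}}T'$ iff $T\models_{\mathcal{K}}T'$.
   Context: Syntax, logics, $\mathcal{L}^m$. A first-order language $\mathscr{L}$: quantifier symbols $\mathscr{L}_q$ and connectives $\mathscr{L}_\omega$ with arities, with designated $e\in\mathscr{L}_0$, $\otimes\in\mathscr{L}_2$. Signatures have sorts, function symbols $f:\sigma_1..\sigma_n\to\tau$, relation symbols $R\subseteq\sigma_1..\sigma_n$. Contexts $\Gamma=x_1:\sigma_1..x_n:\sigma_n$; terms-in-context; formulas-in-context from $R(\vec M)$, $M_1=_\sigma M_2$, connectives, and $\Omega_{x:\sigma}(\phi)\ [\Gamma]$ from $\phi\ [\Gamma,x:\sigma]$, up to $\alpha$-equivalence. Assertions: equations $M_1=M_2:\tau\ [\Gamma]$ and sequents $\phi_1..\phi_n\vdash\phi\ [\Gamma]$. A theory is a set of assertions over a signature. A logic assigns to each signature a closure operator $T\mapsto T_{\mathcal{L}}$ whose closed theories satisfy typed equational logic; $T\vdash_{\mathcal{L}}T'$ iff $A(T')\subseteq A(T_{\mathcal{L}})$; $\mathcal{L}$-theory: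 $T=T_{\mathcal{L}}$. The extension of a logic by sequent rules is the logic whose closed theories are those closed under all its rules. $\mathcal{L}^m$ is given by the rules: Ax $\phi\vdash\phi$; Cut; Cwk (weaken the context); Sub (from $M=M':\sigma\ [\Delta]$ and $\Phi\vdash\psi\ [\Gamma,x:\sigma,\Gamma']$ infer $\Phi[M/x]\vdash\psi[M'/x]\ [\Gamma,\Gamma']$); $\Omega$-Con (from $\phi\dashv\vdash\psi\ [\Gamma,x:\sigma]$ infer $\Omega_{x:\sigma}\phi\vdash\Omega_{x:\sigma}\psi\ [\Gamma]$); $\Diamond$-Cong; $\otimes$-Ref ($\Phi,\alpha,\beta,\Psi\vdash\theta$ iff $\Phi,\alpha\otimes\beta,\Psi\vdash\theta$); $e$-Ref ($\Phi,e,\Psi\vdash\phi$ iff $\Phi,\Psi\vdash\phi$). Adjoint rules (two-directional): $=$-Adj: $\phi_1,..,\phi_n\vdash\psi[x/x']\ [\Gamma,x:\sigma]$ iff $\phi_1,..,\phi_n,x=_\sigma x'\vdash\psi\ [\Gamma,x:\sigma,x':\sigma]$; $\forall$-Adj: $\Phi\vdash\psi\ [\Gamma,x:\sigma]$ iff $\Phi\vdash\forall_{x:\sigma}(\psi)\ [\Gamma]$; $\exists$-Adj: $\Phi,\psi\vdash\theta\ [\Gamma,x:\sigma]$ iff $\Phi,\exists_{x:\sigma}(\psi)\vdash\theta\ [\Gamma]$. A propositional-connective rule is a sequent rule whose meta-formulas involve neither equality nor quantifiers; a structural rule additionally involves no propositional connectives. $\mathbf{FA}$, structures, $\models$. $\mathrm{Ob}(\mathbf{FA})$: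 prop-categories $(\mathcal{C},P)$ ($\mathcal{C}$ with designated finite products, $P:\mathcal{C}^{op}\to\mathbf{Pos}$) with $\mathscr{L}_\omega$-algebra structures on each $P(c)$ preserved by each $P(f)$, elements $Eq_c\in P(c\times c)$, maps $\Omega_{b,c}:P(b\times c)\to P(b)$ natural in $b$, such that $(P(c),\otimes,e_c)$ is a monoid, $\Omega_{b,1}\circ P(\pi_1^{b,1})=\mathrm{id}$, $\Omega_{b,c\times d}\circ P(a_{b,c,d})=\Omega_{b,c}\circ\Omega_{b\times c,d}$, $Eq_1=e_{1\times1}$, $Eq_{c_1\times c_2}=P(\langle\pi_1^{c_1,c_2}\pi_1,\pi_1^{c_1,c_2}\pi_2\rangle)(Eq_{c_1})\otimes P(\langle\pi_2^{c_1,c_2}\pi_1,\pi_2^{c_1,c_2}\pi_2\rangle)(Eq_{c_2})$. An $Sg$-structure $S$ in $(\mathcal{C},P)$ interprets sorts as objects, function symbols as morphisms between products, relation symbols as elements of $P$ of products; terms are interpreted as morphisms $[\![\Gamma]\!]\to[\![\tau]\!]$ (variables as projections), and formulas via $[\![R(\vec M)]\!]=P(\langle[\![M_i]\!]\rangle)([\![R]\!])$, $[\![M_1=_\tau M_2]\!]=P(\langle[\![M_1]\!],[\![M_2]\!]\rangle)(Eq_{[\![\tau]\!]})$, connectives pointwise in $P([\![\Gamma]\!])$, $[\![\Omega_{x:\sigma}\phi[\Gamma]]\!]=\Omega_{[\![\Gamma]\!],[\![\sigma]\!]}(P(a)[\![\phi[\Gamma,x:\sigma]]\!])$ ($a$ canonical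 iso). $S$ satisfies an equation if the two morphisms agree, and a sequent $\phi_1..\phi_n\vdash\phi\ [\Gamma]$ if $[\![\phi_1]\!]\otimes\dots\otimes[\![\phi_n]\!]\le[\![\phi]\!]$ ($e$ if $n=0$). $T\models_{\mathcal{X}}T'$ iff every $T$-model in a member of $\mathcal{X}$ satisfies all of $T'$. Classifying prop-category $(\mathcal{C}_T,P_T)$: objects contexts; morphisms lists of terms modulo $T$-provable equality, composition by substitution, products by concatenation; $P_T(\Gamma)$ = formulas in $[\Gamma]$ modulo mutual derivability in $T$, ordered by derivability in $T$; action by substitution; connectives on representatives; $\Omega_{\Gamma,\Gamma'}[\phi]=[\Omega_{y_1:\tau_1}\cdots\Omega_{y_m:\tau_m}\phi]$; $Eq_\Gamma=[x_1=_{\sigma_1}x_1'\otimes\dots\otimes x_n=_{\sigma_n}x_n']$, $Eq_{[\,]}=[e]$. *)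

theory Defs
  imports Main
begin

section \<open>Languages, signatures, terms and formulas\<close>

datatype quant = Forall | Exists

record 'k lang =
  arity :: "'k \<Rightarrow> nat"
  unit_c :: 'k
  tensor_c :: 'k

definition wf_lang :: "'k lang \<Rightarrow> bool" where
  "wf_lang L \<longleftrightarrow> arity L (unit_c L) = 0 \<and> arity L (tensor_c L) = 2"

text \<open>The three type parameters are universes of possible symbols; which of their elements
  are symbols of the signature is part of the record. So any of the three sets of symbols
  may be empty.\<close>

record ('s, 'f, 'r) signat =
  sorts :: "'s set"
  funs :: "'f \<Rightarrow> ('s list \<times> 's) option"
  rels :: "'r \<Rightarrow> 's list option"

definition wf_ctx :: "('s, 'f, 'r) signat \<Rightarrow> 's list \<Rightarrow> bool" where
  "wf_ctx Sg \<Gamma> \<longleftrightarrow> set \<Gamma> \<subseteq> sorts Sg"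

definition wf_sig :: "('s, 'f, 'r) signat \<Rightarrow> bool" where
  "wf_sig Sg \<longleftrightarrow>
     (\<forall>f \<sigma>s \<tau>. funs Sg f = Some (\<sigma>s, \<tau>) \<longrightarrow> wf_ctx Sg \<sigma>s \<and> \<tau> \<in> sorts Sg) \<and>
     (\<forall>r \<sigma>s. rels Sg r = Some \<sigma>s \<longrightarrow> wf_ctx Sg \<sigma>s)"

text \<open>Variables are de Bruijn levels. A context is the list of sorts of its variables, in the
  order of declaration, and \<open>Var i\<close> is the variable declared at position \<open>i\<close>. In a context of
  length \<open>n\<close> a quantifier binds \<open>Var n\<close>, so that the body of a quantified formula over \<open>\<Gamma>\<close> is a
  formula over \<open>\<Gamma> @ [\<sigma>]\<close>. In this way a formula in context has exactly one representation in
  its \<open>\<alpha>\<close>-equivalence class.\<close>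

datatype 'f tm = Var nat | Fun 'f "'f tm list"

datatype ('s, 'f, 'r, 'k) fm =
    Rel 'r "'f tm list"
  | Equal 's "'f tm" "'f tm"
  | Conn 'k "('s, 'f, 'r, 'k) fm list"
  | Quant quant 's "('s, 'f, 'r, 'k) fm"

inductive has_sort :: "('s, 'f, 'r) signat \<Rightarrow> 's list \<Rightarrow> 'f tm \<Rightarrow> 's \<Rightarrow> bool"
  for Sg \<Gamma> where
  Var: "i < length \<Gamma> \<Longrightarrow> has_sort Sg \<Gamma> (Var i) (\<Gamma> ! i)"
| Fun: "funs Sg f = Some (\<sigma>s, \<tau>) \<Longrightarrow> list_all2 (has_sort Sg \<Gamma>) ts \<sigma>s \<Longrightarrow>
    has_sort Sg \<Gamma> (Fun f ts) \<tau>"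

inductive wf_fm :: "'k lang \<Rightarrow> ('s, 'f, 'r) signat \<Rightarrow> 's list \<Rightarrow> ('s, 'f, 'r, 'k) fm \<Rightarrow> bool"
  for L Sg where
  Rel: "rels Sg r = Some \<sigma>s \<Longrightarrow> list_all2 (has_sort Sg \<Gamma>) ts \<sigma>s \<Longrightarrow> wf_fm L Sg \<Gamma> (Rel r ts)"
| Equal: "\<sigma> \<in> sorts Sg \<Longrightarrow> has_sort Sg \<Gamma> t \<sigma> \<Longrightarrow> has_sort Sg \<Gamma> u \<sigma> \<Longrightarrow>
    wf_fm L Sg \<Gamma> (Equal \<sigma> t u)"
| Conn: "length \<phi>s = arity L k \<Longrightarrow> \<forall>\<phi>\<in>set \<phi>s. wf_fm L Sg \<Gamma> \<phi> \<Longrightarrow> wf_fm L Sg \<Gamma> (Conn k \<phi>s)"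
| Quant: "\<sigma> \<in> sorts Sg \<Longrightarrow> wf_fm L Sg (\<Gamma> @ [\<sigma>]) \<phi> \<Longrightarrow> wf_fm L Sg \<Gamma> (Quant q \<sigma> \<phi>)"

text \<open>Simultaneous substitution: \<open>fsub m ts \<phi>\<close> is \<open>\<phi>\<close> with \<open>ts ! i\<close> for its \<open>i\<close>-th variable,
  where \<open>\<phi>\<close> lives over a context of length \<open>length ts\<close> and the terms \<open>ts\<close> over one of length \<open>m\<close>.
  Since weakening at the end does not change the representation of a term, no shifting of
  \<open>ts\<close> is needed below a binder.\<close>

primrec tsub :: "'f tm list \<Rightarrow> 'f tm \<Rightarrow> 'f tm" where
  "tsub ts (Var i) = ts ! i"
| "tsub ts (Fun f us) = Fun f (map (tsub ts) us)"

primrec fsub :: "nat \<Rightarrow> 'f tm list \<Rightarrow> ('s, 'f, 'r, 'k) fm \<Rightarrow> ('s, 'f, 'r, 'k) fm" where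
  "fsub m ts (Rel r us) = Rel r (map (tsub ts) us)"
| "fsub m ts (Equal \<sigma> t u) = Equal \<sigma> (tsub ts t) (tsub ts u)"
| "fsub m ts (Conn k \<phi>s) = Conn k (map (fsub m ts) \<phi>s)"
| "fsub m ts (Quant q \<sigma> \<phi>) = Quant q \<sigma> (fsub (Suc m) (ts @ [Var m]) \<phi>)"

definition vars :: "nat \<Rightarrow> nat \<Rightarrow> 'f tm list" where
  "vars i j = map Var [i..<j]"

text \<open>From a context of length \<open>n\<close> to its extension by one variable at the end.\<close>

definition wk :: "nat \<Rightarrow> ('s, 'f, 'r, 'k) fm \<Rightarrow> ('s, 'f, 'r, 'k) fm" where
  "wk n = fsub (Suc n) (vars 0 n)"


section \<open>Assertions and theories\<close>

text \<open>\<open>Eqn \<Gamma> M N \<tau>\<close> is the equation \<open>M = N : \<tau> [\<Gamma>]\<close>; \<open>Seq \<Gamma> \<Phi> \<psi>\<close> is the sequent \<open>\<Phi> \<turnstile> \<psi> [\<Gamma>]\<close>.\<close>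

datatype ('s, 'f, 'r, 'k) assertion =
    Eqn "'s list" "'f tm" "'f tm" 's
  | Seq "'s list" "('s, 'f, 'r, 'k) fm list" "('s, 'f, 'r, 'k) fm"

fun wf_assertion :: "'k lang \<Rightarrow> ('s, 'f, 'r) signat \<Rightarrow> ('s, 'f, 'r, 'k) assertion \<Rightarrow> bool" where
  "wf_assertion L Sg (Eqn \<Gamma> M N \<tau>) \<longleftrightarrow> wf_ctx Sg \<Gamma> \<and> has_sort Sg \<Gamma> M \<tau> \<and> has_sort Sg \<Gamma> N \<tau>"
| "wf_assertion L Sg (Seq \<Gamma> \<Phi> \<psi>) \<longleftrightarrow>
     wf_ctx Sg \<Gamma> \<and> (\<forall>\<phi>\<in>set \<Phi>. wf_fm L Sg \<Gamma> \<phi>) \<and> wf_fm L Sg \<Gamma> \<psi>"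

definition is_theory ::
  "'k lang \<Rightarrow> ('s, 'f, 'r) signat \<Rightarrow> ('s, 'f, 'r, 'k) assertion set \<Rightarrow> bool" where
  "is_theory L Sg T \<longleftrightarrow> (\<forall>a\<in>T. wf_assertion L Sg a)"


section \<open>Structural and propositional-connective rules\<close>

text \<open>Meta-formulas are built from variables for formulas (\<open>MVar\<close>) by connectives only, so a
  \<open>sequent_rule\<close> can mention neither equality nor quantifiers. It is a propositional-connective
  rule, and it is a structural rule if \<open>MConn\<close> does not occur in it. Antecedents may also
  contain variables for finite lists of formulas (\<open>MList\<close>). All premises and the conclusion
  are over one and the same arbitrary context.\<close>

datatype 'k meta = MVar nat | MConn 'k "'k meta list"

datatype 'k meta_item = MList nat | MForm "'k meta"

datatype 'k meta_seq = MSeq "'k meta_item list" "'k meta"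

datatype 'k sequent_rule = SRule (prems_of: "'k meta_seq list") (concl_of: "'k meta_seq")

primrec wf_meta :: "'k lang \<Rightarrow> 'k meta \<Rightarrow> bool" where
  "wf_meta L (MVar i) \<longleftrightarrow> True"
| "wf_meta L (MConn k ms) \<longleftrightarrow> length ms = arity L k \<and> list_all id (map (wf_meta L) ms)"

primrec wf_meta_item :: "'k lang \<Rightarrow> 'k meta_item \<Rightarrow> bool" where
  "wf_meta_item L (MList i) \<longleftrightarrow> True"
| "wf_meta_item L (MForm m) \<longleftrightarrow> wf_meta L m"

primrec wf_meta_seq :: "'k lang \<Rightarrow> 'k meta_seq \<Rightarrow> bool" where
  "wf_meta_seq L (MSeq xs m) \<longleftrightarrow> (\<forall>x\<in>set xs. wf_meta_item L x) \<and> wf_meta L m"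

definition wf_rule :: "'k lang \<Rightarrow> 'k sequent_rule \<Rightarrow> bool" where
  "wf_rule L r \<longleftrightarrow> (\<forall>s\<in>set (prems_of r). wf_meta_seq L s) \<and> wf_meta_seq L (concl_of r)"

primrec inst_meta :: "(nat \<Rightarrow> ('s, 'f, 'r, 'k) fm) \<Rightarrow> 'k meta \<Rightarrow> ('s, 'f, 'r, 'k) fm" where
  "inst_meta v (MVar i) = v i"
| "inst_meta v (MConn k ms) = Conn k (map (inst_meta v) ms)"

primrec inst_item :: "(nat \<Rightarrow> ('s, 'f, 'r, 'k) fm) \<Rightarrow> (nat \<Rightarrow> ('s, 'f, 'r, 'k) fm list) \<Rightarrow>
    'k meta_item \<Rightarrow> ('s, 'f, 'r, 'k) fm list" where
  "inst_item v w (MList i) = w i"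
| "inst_item v w (MForm m) = [inst_meta v m]"

primrec inst_seq :: "'s list \<Rightarrow> (nat \<Rightarrow> ('s, 'f, 'r, 'k) fm) \<Rightarrow>
    (nat \<Rightarrow> ('s, 'f, 'r, 'k) fm list) \<Rightarrow> 'k meta_seq \<Rightarrow> ('s, 'f, 'r, 'k) assertion" where
  "inst_seq \<Gamma> v w (MSeq xs m) = Seq \<Gamma> (concat (map (inst_item v w) xs)) (inst_meta v m)"


section \<open>The minimal logic and its extensions\<close>

record 'k logic =
  eq_adj :: bool
  ex_adj :: bool
  all_adj :: bool
  rules :: "'k sequent_rule set"

text \<open>\<open>closure L X Sg T\<close> is the least theory that contains \<open>T\<close> and is closed under typed
  equational logic, under the rules of the minimal logic and under the additional rules
  selected by \<open>X\<close>. Each two-directional rule is split into two. In \<open>Sub\<close> the substituted terms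
  are over the context of the conclusion. In \<open>Eq_Adj\<close>, \<open>\<Phi>\<close> may contain \<open>x\<close> but not \<open>x'\<close>.\<close>

inductive_set closure :: "'k lang \<Rightarrow> 'k logic \<Rightarrow> ('s, 'f, 'r) signat \<Rightarrow>
    ('s, 'f, 'r, 'k) assertion set \<Rightarrow> ('s, 'f, 'r, 'k) assertion set"
  for L :: "'k lang" and X :: "'k logic" and Sg :: "('s, 'f, 'r) signat"
    and T :: "('s, 'f, 'r, 'k) assertion set" where
  Hyp: "a \<in> T \<Longrightarrow> a \<in> closure L X Sg T"

| Refl: "wf_ctx Sg \<Gamma> \<Longrightarrow> has_sort Sg \<Gamma> M \<tau> \<Longrightarrow> Eqn \<Gamma> M M \<tau> \<in> closure L X Sg T"
| Sym: "Eqn \<Gamma> M N \<tau> \<in> closure L X Sg T \<Longrightarrow> Eqn \<Gamma> N M \<tau> \<in> closure L X Sg T"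
| Trans: "Eqn \<Gamma> M N \<tau> \<in> closure L X Sg T \<Longrightarrow> Eqn \<Gamma> N K \<tau> \<in> closure L X Sg T \<Longrightarrow>
    Eqn \<Gamma> M K \<tau> \<in> closure L X Sg T"
| Subst: "Eqn \<Gamma> M N \<tau> \<in> closure L X Sg T \<Longrightarrow> wf_ctx Sg \<Delta> \<Longrightarrow>
    length ts = length \<Gamma> \<Longrightarrow> length us = length \<Gamma> \<Longrightarrow>
    \<forall>i<length \<Gamma>. Eqn \<Delta> (ts ! i) (us ! i) (\<Gamma> ! i) \<in> closure L X Sg T \<Longrightarrow>
    Eqn \<Delta> (tsub ts M) (tsub us N) \<tau> \<in> closure L X Sg T"

| Ax: "wf_ctx Sg \<Gamma> \<Longrightarrow> wf_fm L Sg \<Gamma> \<phi> \<Longrightarrow> Seq \<Gamma> [\<phi>] \<phi> \<in> closure L X Sg T"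
| Cut: "Seq \<Gamma> \<Phi> \<phi> \<in> closure L X Sg T \<Longrightarrow> Seq \<Gamma> (\<Psi> @ [\<phi>] @ \<Psi>') \<psi> \<in> closure L X Sg T \<Longrightarrow>
    Seq \<Gamma> (\<Psi> @ \<Phi> @ \<Psi>') \<psi> \<in> closure L X Sg T"
| Cwk: "Seq (\<Gamma> @ \<Gamma>') \<Phi> \<psi> \<in> closure L X Sg T \<Longrightarrow> \<sigma> \<in> sorts Sg \<Longrightarrow>
    n = length \<Gamma> \<Longrightarrow> m = length (\<Gamma> @ [\<sigma>] @ \<Gamma>') \<Longrightarrow> xs = vars 0 n @ vars (Suc n) m \<Longrightarrow>
    Seq (\<Gamma> @ [\<sigma>] @ \<Gamma>') (map (fsub m xs) \<Phi>) (fsub m xs \<psi>) \<in> closure L X Sg T"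
| Sub: "Eqn (\<Gamma> @ \<Gamma>') M M' \<sigma> \<in> closure L X Sg T \<Longrightarrow>
    Seq (\<Gamma> @ [\<sigma>] @ \<Gamma>') \<Phi> \<psi> \<in> closure L X Sg T \<Longrightarrow>
    n = length \<Gamma> \<Longrightarrow> m = length (\<Gamma> @ \<Gamma>') \<Longrightarrow>
    Seq (\<Gamma> @ \<Gamma>') (map (fsub m (vars 0 n @ [M] @ vars n m)) \<Phi>)
      (fsub m (vars 0 n @ [M'] @ vars n m) \<psi>) \<in> closure L X Sg T"
| Quant_Con: "Seq (\<Gamma> @ [\<sigma>]) [\<phi>] \<psi> \<in> closure L X Sg T \<Longrightarrow>
    Seq (\<Gamma> @ [\<sigma>]) [\<psi>] \<phi> \<in> closure L X Sg T \<Longrightarrow>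
    Seq \<Gamma> [Quant q \<sigma> \<phi>] (Quant q \<sigma> \<psi>) \<in> closure L X Sg T"
| Conn_Cong: "wf_ctx Sg \<Gamma> \<Longrightarrow> length \<phi>s = arity L k \<Longrightarrow> length \<psi>s = arity L k \<Longrightarrow>
    \<forall>i<arity L k. Seq \<Gamma> [\<phi>s ! i] (\<psi>s ! i) \<in> closure L X Sg T \<and>
      Seq \<Gamma> [\<psi>s ! i] (\<phi>s ! i) \<in> closure L X Sg T \<Longrightarrow>
    Seq \<Gamma> [Conn k \<phi>s] (Conn k \<psi>s) \<in> closure L X Sg T"
| Tensor_Ref1: "Seq \<Gamma> (\<Phi> @ [\<alpha>, \<beta>] @ \<Psi>) \<theta> \<in> closure L X Sg T \<Longrightarrow>
    Seq \<Gamma> (\<Phi> @ [Conn (tensor_c L) [\<alpha>, \<beta>]] @ \<Psi>) \<theta> \<in> closure L X Sg T"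
| Tensor_Ref2: "Seq \<Gamma> (\<Phi> @ [Conn (tensor_c L) [\<alpha>, \<beta>]] @ \<Psi>) \<theta> \<in> closure L X Sg T \<Longrightarrow>
    Seq \<Gamma> (\<Phi> @ [\<alpha>, \<beta>] @ \<Psi>) \<theta> \<in> closure L X Sg T"
| Unit_Ref1: "Seq \<Gamma> (\<Phi> @ [Conn (unit_c L) []] @ \<Psi>) \<theta> \<in> closure L X Sg T \<Longrightarrow>
    Seq \<Gamma> (\<Phi> @ \<Psi>) \<theta> \<in> closure L X Sg T"
| Unit_Ref2: "Seq \<Gamma> (\<Phi> @ \<Psi>) \<theta> \<in> closure L X Sg T \<Longrightarrow>
    Seq \<Gamma> (\<Phi> @ [Conn (unit_c L) []] @ \<Psi>) \<theta> \<in> closure L X Sg T"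

| Eq_Adj1: "eq_adj X \<Longrightarrow> n = length \<Gamma> \<Longrightarrow> wf_fm L Sg (\<Gamma> @ [\<sigma>, \<sigma>]) \<psi> \<Longrightarrow>
    Seq (\<Gamma> @ [\<sigma>]) \<Phi> (fsub (Suc n) (vars 0 (Suc n) @ [Var n]) \<psi>) \<in> closure L X Sg T \<Longrightarrow>
    Seq (\<Gamma> @ [\<sigma>, \<sigma>]) (map (wk (Suc n)) \<Phi> @ [Equal \<sigma> (Var n) (Var (Suc n))]) \<psi>
      \<in> closure L X Sg T"
| Eq_Adj2: "eq_adj X \<Longrightarrow> n = length \<Gamma> \<Longrightarrow> \<forall>\<phi>\<in>set \<Phi>. wf_fm L Sg (\<Gamma> @ [\<sigma>]) \<phi> \<Longrightarrow>
    Seq (\<Gamma> @ [\<sigma>, \<sigma>]) (map (wk (Suc n)) \<Phi> @ [Equal \<sigma> (Var n) (Var (Suc n))]) \<psi>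
      \<in> closure L X Sg T \<Longrightarrow>
    Seq (\<Gamma> @ [\<sigma>]) \<Phi> (fsub (Suc n) (vars 0 (Suc n) @ [Var n]) \<psi>) \<in> closure L X Sg T"
| All_Adj1: "all_adj X \<Longrightarrow> \<forall>\<phi>\<in>set \<Phi>. wf_fm L Sg \<Gamma> \<phi> \<Longrightarrow>
    Seq (\<Gamma> @ [\<sigma>]) (map (wk (length \<Gamma>)) \<Phi>) \<psi> \<in> closure L X Sg T \<Longrightarrow>
    Seq \<Gamma> \<Phi> (Quant Forall \<sigma> \<psi>) \<in> closure L X Sg T"
| All_Adj2: "all_adj X \<Longrightarrow> Seq \<Gamma> \<Phi> (Quant Forall \<sigma> \<psi>) \<in> closure L X Sg T \<Longrightarrow>
    Seq (\<Gamma> @ [\<sigma>]) (map (wk (length \<Gamma>)) \<Phi>) \<psi> \<in> closure L X Sg T"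
| Ex_Adj1: "ex_adj X \<Longrightarrow> \<forall>\<phi>\<in>set \<Phi>. wf_fm L Sg \<Gamma> \<phi> \<Longrightarrow> wf_fm L Sg \<Gamma> \<theta> \<Longrightarrow>
    Seq (\<Gamma> @ [\<sigma>]) (map (wk (length \<Gamma>)) \<Phi> @ [\<psi>]) (wk (length \<Gamma>) \<theta>) \<in> closure L X Sg T \<Longrightarrow>
    Seq \<Gamma> (\<Phi> @ [Quant Exists \<sigma> \<psi>]) \<theta> \<in> closure L X Sg T"
| Ex_Adj2: "ex_adj X \<Longrightarrow> Seq \<Gamma> (\<Phi> @ [Quant Exists \<sigma> \<psi>]) \<theta> \<in> closure L X Sg T \<Longrightarrow>
    Seq (\<Gamma> @ [\<sigma>]) (map (wk (length \<Gamma>)) \<Phi> @ [\<psi>]) (wk (length \<Gamma>) \<theta>) \<in> closure L X Sg T"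

| Rule: "r \<in> rules X \<Longrightarrow> wf_ctx Sg \<Gamma> \<Longrightarrow>
    \<forall>i. wf_fm L Sg \<Gamma> (v i) \<Longrightarrow> \<forall>i. \<forall>\<phi>\<in>set (w i). wf_fm L Sg \<Gamma> \<phi> \<Longrightarrow>
    \<forall>s\<in>set (prems_of r). inst_seq \<Gamma> v w s \<in> closure L X Sg T \<Longrightarrow>
    inst_seq \<Gamma> v w (concl_of r) \<in> closure L X Sg T"

definition L_theory :: "'k lang \<Rightarrow> 'k logic \<Rightarrow> ('s, 'f, 'r) signat \<Rightarrow>
    ('s, 'f, 'r, 'k) assertion set \<Rightarrow> bool" where
  "L_theory L X Sg T \<longleftrightarrow> is_theory L Sg T \<and> closure L X Sg T = T"

definition entails :: "'k lang \<Rightarrow> 'k logic \<Rightarrow> ('s, 'f, 'r) signat \<Rightarrow>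
    ('s, 'f, 'r, 'k) assertion set \<Rightarrow> ('s, 'f, 'r, 'k) assertion set \<Rightarrow> bool" where
  "entails L X Sg T T' \<longleftrightarrow> T' \<subseteq> closure L X Sg T"


section \<open>Prop-categories\<close>

text \<open>\<open>prd C cs\<close> is the designated product of the finite list \<open>cs\<close> of objects, \<open>prj C cs i\<close> its
  \<open>i\<close>-th projection, and \<open>tup C b fs\<close> the induced morphism from \<open>b\<close> to the product of the
  codomains of \<open>fs\<close>; the terminal object is \<open>prd C []\<close>. \<open>cmp C g f\<close> is \<open>g\<close> after \<open>f\<close>. The
  poset over \<open>c\<close> has carrier \<open>props C c\<close> and order \<open>ple C c\<close>, and \<open>pmap C f\<close> is the reindexing
  map from \<open>props C (cod_of C f)\<close> to \<open>props C (dom_of C f)\<close>. \<open>pquant C q b c\<close> maps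
  \<open>props C (prd C [b, c])\<close> to \<open>props C b\<close>.\<close>

record ('o, 'm, 'p, 'k) prop_cat =
  obj :: "'o set"
  arr :: "'m set"
  dom_of :: "'m \<Rightarrow> 'o"
  cod_of :: "'m \<Rightarrow> 'o"
  ident :: "'o \<Rightarrow> 'm"
  cmp :: "'m \<Rightarrow> 'm \<Rightarrow> 'm"
  prd :: "'o list \<Rightarrow> 'o"
  prj :: "'o list \<Rightarrow> nat \<Rightarrow> 'm"
  tup :: "'o \<Rightarrow> 'm list \<Rightarrow> 'm"
  props :: "'o \<Rightarrow> 'p set"
  ple :: "'o \<Rightarrow> 'p \<Rightarrow> 'p \<Rightarrow> bool"
  pmap :: "'m \<Rightarrow> 'p \<Rightarrow> 'p"
  pconn :: "'o \<Rightarrow> 'k \<Rightarrow> 'p list \<Rightarrow> 'p"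
  pquant :: "quant \<Rightarrow> 'o \<Rightarrow> 'o \<Rightarrow> 'p \<Rightarrow> 'p"
  peq :: "'o \<Rightarrow> 'p"

definition hom :: "('o, 'm, 'p, 'k) prop_cat \<Rightarrow> 'o \<Rightarrow> 'o \<Rightarrow> 'm set" where
  "hom C b c = {f \<in> arr C. dom_of C f = b \<and> cod_of C f = c}"

definition is_category :: "('o, 'm, 'p, 'k) prop_cat \<Rightarrow> bool" where
  "is_category C \<longleftrightarrow>
     (\<forall>f\<in>arr C. dom_of C f \<in> obj C \<and> cod_of C f \<in> obj C) \<and>
     (\<forall>b\<in>obj C. ident C b \<in> hom C b b) \<and>
     (\<forall>b c d. \<forall>f\<in>hom C b c. \<forall>g\<in>hom C c d. cmp C g f \<in> hom C b d) \<and>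
     (\<forall>b c. \<forall>f\<in>hom C b c. cmp C f (ident C b) = f \<and> cmp C (ident C c) f = f) \<and>
     (\<forall>a b c d. \<forall>f\<in>hom C a b. \<forall>g\<in>hom C b c. \<forall>h\<in>hom C c d.
        cmp C h (cmp C g f) = cmp C (cmp C h g) f)"

definition has_products :: "('o, 'm, 'p, 'k) prop_cat \<Rightarrow> bool" where
  "has_products C \<longleftrightarrow> (\<forall>cs. set cs \<subseteq> obj C \<longrightarrow>
     prd C cs \<in> obj C \<and>
     (\<forall>i<length cs. prj C cs i \<in> hom C (prd C cs) (cs ! i)) \<and>
     (\<forall>b\<in>obj C. \<forall>fs. list_all2 (\<lambda>f c. f \<in> hom C b c) fs cs \<longrightarrow>
        tup C b fs \<in> hom C b (prd C cs) \<and>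
        (\<forall>i<length cs. cmp C (prj C cs i) (tup C b fs) = fs ! i) \<and>
        (\<forall>h\<in>hom C b (prd C cs). (\<forall>i<length cs. cmp C (prj C cs i) h = fs ! i) \<longrightarrow>
           h = tup C b fs)))"

definition is_pos_functor :: "('o, 'm, 'p, 'k) prop_cat \<Rightarrow> bool" where
  "is_pos_functor C \<longleftrightarrow>
     (\<forall>c\<in>obj C.
        (\<forall>p\<in>props C c. ple C c p p) \<and>
        (\<forall>p\<in>props C c. \<forall>q\<in>props C c. ple C c p q \<longrightarrow> ple C c q p \<longrightarrow> p = q) \<and>
        (\<forall>p\<in>props C c. \<forall>q\<in>props C c. \<forall>r\<in>props C c.
           ple C c p q \<longrightarrow> ple C c q r \<longrightarrow> ple C c p r)) \<and>
     (\<forall>b c. \<forall>f\<in>hom C b c.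
        (\<forall>p\<in>props C c. pmap C f p \<in> props C b) \<and>
        (\<forall>p\<in>props C c. \<forall>q\<in>props C c. ple C c p q \<longrightarrow> ple C b (pmap C f p) (pmap C f q))) \<and>
     (\<forall>c\<in>obj C. \<forall>p\<in>props C c. pmap C (ident C c) p = p) \<and>
     (\<forall>b c d. \<forall>f\<in>hom C b c. \<forall>g\<in>hom C c d. \<forall>p\<in>props C d.
        pmap C (cmp C g f) p = pmap C f (pmap C g p))"

definition prop_category :: "('o, 'm, 'p, 'k) prop_cat \<Rightarrow> bool" where
  "prop_category C \<longleftrightarrow> is_category C \<and> has_products C \<and> is_pos_functor C"

text \<open>The first and second projection of a binary product, the product \<open>f \<times> c\<close> of a morphism
  \<open>f\<close> from \<open>b\<close> with an object \<open>c\<close>, and the isomorphism from \<open>b \<times> (c \<times> d)\<close> to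
  \<open>(b \<times> c) \<times> d\<close>.\<close>

definition fst_p :: "('o, 'm, 'p, 'k) prop_cat \<Rightarrow> 'o \<Rightarrow> 'o \<Rightarrow> 'm" where
  "fst_p C b c = prj C [b, c] 0"

definition snd_p :: "('o, 'm, 'p, 'k) prop_cat \<Rightarrow> 'o \<Rightarrow> 'o \<Rightarrow> 'm" where
  "snd_p C b c = prj C [b, c] 1"

definition times_obj :: "('o, 'm, 'p, 'k) prop_cat \<Rightarrow> 'm \<Rightarrow> 'o \<Rightarrow> 'm" where
  "times_obj C f c = (let b = dom_of C f in
     tup C (prd C [b, c]) [cmp C f (fst_p C b c), snd_p C b c])"

definition assoc_p :: "('o, 'm, 'p, 'k) prop_cat \<Rightarrow> 'o \<Rightarrow> 'o \<Rightarrow> 'o \<Rightarrow> 'm" where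
  "assoc_p C b c d = (let cd = prd C [c, d]; x = prd C [b, cd] in
     tup C x
       [tup C x [fst_p C b cd, cmp C (fst_p C c d) (snd_p C b cd)],
        cmp C (snd_p C c d) (snd_p C b cd)])"

definition p_tensor :: "'k lang \<Rightarrow> ('o, 'm, 'p, 'k) prop_cat \<Rightarrow> 'o \<Rightarrow> 'p \<Rightarrow> 'p \<Rightarrow> 'p" where
  "p_tensor L C c p q = pconn C c (tensor_c L) [p, q]"

definition p_unit :: "'k lang \<Rightarrow> ('o, 'm, 'p, 'k) prop_cat \<Rightarrow> 'o \<Rightarrow> 'p" where
  "p_unit L C c = pconn C c (unit_c L) []"

definition FA :: "'k lang \<Rightarrow> ('o, 'm, 'p, 'k) prop_cat set" where
  "FA L = {C. prop_category C \<and>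
     \<comment> \<open>algebra structures preserved by reindexing\<close>
     (\<forall>c\<in>obj C. \<forall>k ps. set ps \<subseteq> props C c \<longrightarrow> length ps = arity L k \<longrightarrow>
        pconn C c k ps \<in> props C c) \<and>
     (\<forall>b c. \<forall>f\<in>hom C b c. \<forall>k ps. set ps \<subseteq> props C c \<longrightarrow> length ps = arity L k \<longrightarrow>
        pmap C f (pconn C c k ps) = pconn C b k (map (pmap C f) ps)) \<and>
     \<comment> \<open>\<open>Eq\<close> and \<open>\<Omega>\<close>, the latter natural in its first argument\<close>
     (\<forall>c\<in>obj C. peq C c \<in> props C (prd C [c, c])) \<and>
     (\<forall>q. \<forall>b\<in>obj C. \<forall>c\<in>obj C. \<forall>p\<in>props C (prd C [b, c]). pquant C q b c p \<in> props C b) \<and>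
     (\<forall>q b b'. \<forall>f\<in>hom C b' b. \<forall>c\<in>obj C. \<forall>p\<in>props C (prd C [b, c]).
        pmap C f (pquant C q b c p) = pquant C q b' c (pmap C (times_obj C f c) p)) \<and>
     \<comment> \<open>monoid laws\<close>
     (\<forall>c\<in>obj C. \<forall>p\<in>props C c.
        p_tensor L C c (p_unit L C c) p = p \<and> p_tensor L C c p (p_unit L C c) = p) \<and>
     (\<forall>c\<in>obj C. \<forall>p\<in>props C c. \<forall>q\<in>props C c. \<forall>r\<in>props C c.
        p_tensor L C c (p_tensor L C c p q) r = p_tensor L C c p (p_tensor L C c q r)) \<and>
     \<comment> \<open>\<open>\<Omega>\<close> over the terminal object and over a product\<close>
     (\<forall>q. \<forall>b\<in>obj C. \<forall>p\<in>props C b.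
        pquant C q b (prd C []) (pmap C (fst_p C b (prd C [])) p) = p) \<and>
     (\<forall>q. \<forall>b\<in>obj C. \<forall>c\<in>obj C. \<forall>d\<in>obj C. \<forall>p\<in>props C (prd C [prd C [b, c], d]).
        pquant C q b (prd C [c, d]) (pmap C (assoc_p C b c d) p) =
        pquant C q b c (pquant C q (prd C [b, c]) d p)) \<and>
     \<comment> \<open>\<open>Eq\<close> of the terminal object and of a product\<close>
     peq C (prd C []) = p_unit L C (prd C [prd C [], prd C []]) \<and>
     (\<forall>c\<in>obj C. \<forall>d\<in>obj C. let cd = prd C [c, d]; x = prd C [cd, cd] in
        peq C cd = p_tensor L C x
          (pmap C (tup C x [cmp C (fst_p C c d) (fst_p C cd cd),
                            cmp C (fst_p C c d) (snd_p C cd cd)]) (peq C c))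
          (pmap C (tup C x [cmp C (snd_p C c d) (fst_p C cd cd),
                            cmp C (snd_p C c d) (snd_p C cd cd)]) (peq C d)))}"


section \<open>Structures and satisfaction\<close>

record ('s, 'f, 'r, 'o, 'm, 'p) interp =
  sort_i :: "'s \<Rightarrow> 'o"
  fun_i :: "'f \<Rightarrow> 'm"
  rel_i :: "'r \<Rightarrow> 'p"

definition ctx_i ::
  "('o, 'm, 'p, 'k) prop_cat \<Rightarrow> ('s, 'f, 'r, 'o, 'm, 'p) interp \<Rightarrow> 's list \<Rightarrow> 'o" where
  "ctx_i C S \<Gamma> = prd C (map (sort_i S) \<Gamma>)"

definition is_structure :: "('s, 'f, 'r) signat \<Rightarrow> ('o, 'm, 'p, 'k) prop_cat \<Rightarrow>
    ('s, 'f, 'r, 'o, 'm, 'p) interp \<Rightarrow> bool" where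
  "is_structure Sg C S \<longleftrightarrow>
     (\<forall>\<sigma>\<in>sorts Sg. sort_i S \<sigma> \<in> obj C) \<and>
     (\<forall>f \<sigma>s \<tau>. funs Sg f = Some (\<sigma>s, \<tau>) \<longrightarrow> fun_i S f \<in> hom C (ctx_i C S \<sigma>s) (sort_i S \<tau>)) \<and>
     (\<forall>r \<sigma>s. rels Sg r = Some \<sigma>s \<longrightarrow> rel_i S r \<in> props C (ctx_i C S \<sigma>s))"

primrec tm_i :: "('o, 'm, 'p, 'k) prop_cat \<Rightarrow> ('s, 'f, 'r, 'o, 'm, 'p) interp \<Rightarrow> 's list \<Rightarrow>
    'f tm \<Rightarrow> 'm" where
  "tm_i C S \<Gamma> (Var i) = prj C (map (sort_i S) \<Gamma>) i"
| "tm_i C S \<Gamma> (Fun f ts) = cmp C (fun_i S f) (tup C (ctx_i C S \<Gamma>) (map (tm_i C S \<Gamma>) ts))"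

text \<open>The canonical isomorphism from \<open>\<lbrakk>\<Gamma>\<rbrakk> \<times> \<lbrakk>\<sigma>\<rbrakk>\<close> to \<open>\<lbrakk>\<Gamma>, x:\<sigma>\<rbrakk>\<close>.\<close>

definition ext_iso :: "('o, 'm, 'p, 'k) prop_cat \<Rightarrow> ('s, 'f, 'r, 'o, 'm, 'p) interp \<Rightarrow>
    's list \<Rightarrow> 's \<Rightarrow> 'm" where
  "ext_iso C S \<Gamma> \<sigma> = (let b = ctx_i C S \<Gamma>; c = sort_i S \<sigma> in
     tup C (prd C [b, c])
       (map (\<lambda>i. cmp C (prj C (map (sort_i S) \<Gamma>) i) (fst_p C b c)) [0..<length \<Gamma>] @
        [snd_p C b c]))"

primrec fm_i :: "('o, 'm, 'p, 'k) prop_cat \<Rightarrow> ('s, 'f, 'r, 'o, 'm, 'p) interp \<Rightarrow>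
    ('s, 'f, 'r, 'k) fm \<Rightarrow> 's list \<Rightarrow> 'p" where
  "fm_i C S (Rel r ts) \<Gamma> = pmap C (tup C (ctx_i C S \<Gamma>) (map (tm_i C S \<Gamma>) ts)) (rel_i S r)"
| "fm_i C S (Equal \<sigma> t u) \<Gamma> =
     pmap C (tup C (ctx_i C S \<Gamma>) [tm_i C S \<Gamma> t, tm_i C S \<Gamma> u]) (peq C (sort_i S \<sigma>))"
| "fm_i C S (Conn k \<phi>s) \<Gamma> = pconn C (ctx_i C S \<Gamma>) k (map (\<lambda>\<phi>. fm_i C S \<phi> \<Gamma>) \<phi>s)"
| "fm_i C S (Quant q \<sigma> \<phi>) \<Gamma> = pquant C q (ctx_i C S \<Gamma>) (sort_i S \<sigma>)
     (pmap C (ext_iso C S \<Gamma> \<sigma>) (fm_i C S \<phi> (\<Gamma> @ [\<sigma>])))"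

fun big_tensor :: "('a \<Rightarrow> 'a \<Rightarrow> 'a) \<Rightarrow> 'a \<Rightarrow> 'a list \<Rightarrow> 'a" where
  "big_tensor f e [] = e"
| "big_tensor f e [x] = x"
| "big_tensor f e (x # y # zs) = f x (big_tensor f e (y # zs))"

fun satisfies :: "'k lang \<Rightarrow> ('o, 'm, 'p, 'k) prop_cat \<Rightarrow> ('s, 'f, 'r, 'o, 'm, 'p) interp \<Rightarrow>
    ('s, 'f, 'r, 'k) assertion \<Rightarrow> bool" where
  "satisfies L C S (Eqn \<Gamma> M N \<tau>) \<longleftrightarrow> tm_i C S \<Gamma> M = tm_i C S \<Gamma> N"
| "satisfies L C S (Seq \<Gamma> \<Phi> \<psi>) \<longleftrightarrow> (let c = ctx_i C S \<Gamma> in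
     ple C c (big_tensor (p_tensor L C c) (p_unit L C c) (map (\<lambda>\<phi>. fm_i C S \<phi> \<Gamma>) \<Phi>))
       (fm_i C S \<psi> \<Gamma>))"

definition models :: "'k lang \<Rightarrow> ('s, 'f, 'r) signat \<Rightarrow> ('o, 'm, 'p, 'k) prop_cat set \<Rightarrow>
    ('s, 'f, 'r, 'k) assertion set \<Rightarrow> ('s, 'f, 'r, 'k) assertion set \<Rightarrow> bool" where
  "models L Sg \<X> T T' \<longleftrightarrow> (\<forall>C\<in>\<X>. \<forall>S. is_structure Sg C S \<longrightarrow>
     (\<forall>a\<in>T. satisfies L C S a) \<longrightarrow> (\<forall>a\<in>T'. satisfies L C S a))"


section \<open>Classifying prop-categories\<close>

type_synonym ('s, 'f) ctx_mor = "'s list \<times> 's list \<times> 'f tm list set"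

type_synonym ('s, 'f, 'r, 'k) class_cat =
  "('s list, ('s, 'f) ctx_mor, ('s, 'f, 'r, 'k) fm set, 'k) prop_cat"

text \<open>A morphism is a triple of domain, codomain and an equivalence class of lists of terms; an
  element of a poset is an equivalence class of formulas. The selectors \<open>m_rep\<close> and \<open>p_rep\<close>
  choose representatives.\<close>

definition m_class :: "('s, 'f, 'r, 'k) assertion set \<Rightarrow> 's list \<Rightarrow> 's list \<Rightarrow> 'f tm list \<Rightarrow>
    ('s, 'f) ctx_mor" where
  "m_class T \<Gamma> \<Delta> ts = (\<Gamma>, \<Delta>,
     {us. length us = length \<Delta> \<and> (\<forall>i<length \<Delta>. Eqn \<Gamma> (ts ! i) (us ! i) (\<Delta> ! i) \<in> T)})"

definition m_rep :: "('s, 'f) ctx_mor \<Rightarrow> 'f tm list" where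
  "m_rep f = (SOME ts. ts \<in> snd (snd f))"

definition p_class :: "('s, 'f, 'r, 'k) assertion set \<Rightarrow> 's list \<Rightarrow> ('s, 'f, 'r, 'k) fm \<Rightarrow>
    ('s, 'f, 'r, 'k) fm set" where
  "p_class T \<Gamma> \<phi> = {\<psi>. Seq \<Gamma> [\<phi>] \<psi> \<in> T \<and> Seq \<Gamma> [\<psi>] \<phi> \<in> T}"

definition p_rep :: "('s, 'f, 'r, 'k) fm set \<Rightarrow> ('s, 'f, 'r, 'k) fm" where
  "p_rep p = (SOME \<phi>. \<phi> \<in> p)"

definition classifying :: "'k lang \<Rightarrow> ('s, 'f, 'r) signat \<Rightarrow> ('s, 'f, 'r, 'k) assertion set \<Rightarrow>
    ('s, 'f, 'r, 'k) class_cat" where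
  "classifying L Sg T = \<lparr>
     obj = {\<Gamma>. wf_ctx Sg \<Gamma>},
     arr = {m_class T \<Gamma> \<Delta> ts | \<Gamma> \<Delta> ts.
       wf_ctx Sg \<Gamma> \<and> wf_ctx Sg \<Delta> \<and> list_all2 (has_sort Sg \<Gamma>) ts \<Delta>},
     dom_of = (\<lambda>f. fst f),
     cod_of = (\<lambda>f. fst (snd f)),
     ident = (\<lambda>\<Gamma>. m_class T \<Gamma> \<Gamma> (vars 0 (length \<Gamma>))),
     cmp = (\<lambda>g f. m_class T (fst f) (fst (snd g)) (map (tsub (m_rep f)) (m_rep g))),
     prd = concat,
     prj = (\<lambda>\<Gamma>s i. m_class T (concat \<Gamma>s) (\<Gamma>s ! i)
       (vars (length (concat (take i \<Gamma>s))) (length (concat (take (Suc i) \<Gamma>s))))),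
     tup = (\<lambda>\<Gamma> fs. m_class T \<Gamma> (concat (map (\<lambda>f. fst (snd f)) fs)) (concat (map m_rep fs))),
     props = (\<lambda>\<Gamma>. {p_class T \<Gamma> \<phi> | \<phi>. wf_fm L Sg \<Gamma> \<phi>}),
     ple = (\<lambda>\<Gamma> p q. Seq \<Gamma> [p_rep p] (p_rep q) \<in> T),
     pmap = (\<lambda>f p. p_class T (fst f) (fsub (length (fst f)) (m_rep f) (p_rep p))),
     pconn = (\<lambda>\<Gamma> k ps. p_class T \<Gamma> (Conn k (map p_rep ps))),
     pquant = (\<lambda>q \<Gamma> \<Delta> p. p_class T \<Gamma> (foldr (Quant q) \<Delta> (p_rep p))),
     peq = (\<lambda>\<Gamma>. p_class T (\<Gamma> @ \<Gamma>)
       (big_tensor (\<lambda>\<phi> \<psi>. Conn (tensor_c L) [\<phi>, \<psi>]) (Conn (unit_c L) [])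
         (map (\<lambda>i. Equal (\<Gamma> ! i) (Var i) (Var (length \<Gamma> + i))) [0..<length \<Gamma>])))\<rparr>"

text \<open>All theories over all signatures with symbols from the universes \<open>'s\<close>, \<open>'f\<close>, \<open>'r\<close>.
  A class of theories over signatures of arbitrary size is covered by letting these types
  vary: completeness needs only the universes of the given theory, soundness holds for all.\<close>

definition classifying_cats :: "'k lang \<Rightarrow> 'k logic \<Rightarrow> ('s, 'f, 'r, 'k) class_cat set" where
  "classifying_cats L X = {classifying L Sg T | Sg T. wf_sig Sg \<and> L_theory L X Sg T}"

end

(* A structure S in the classifying prop-category of T is a translation of syntax: a sort
   becomes a context, a term a list of terms and a formula a formula in T. With de Bruijn levels
   this translation commutes with substitution on the nose, not just up to provable equality, and
   S satisfies an assertion iff T contains its translation. So soundness means that T is closed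
   under the translated rules. Only the adjoint rules need an argument: translating a sort by a
   context, one has to derive them for lists of variables from the rules for single variables.
   Completeness comes from the generic structure, whose translation is the identity up to
   provable equality, in the classifying prop-category of the closure of T. *)
theory Submission
  imports Defs
begin

section \<open>Substitution\<close>

text \<open>The translation is purely syntactic because no choice is repeated: \<open>m_rep\<close>
  and \<open>p_rep\<close> are consulted once for each symbol, and a variable becomes a fixed block
  of consecutive levels. Concatenation is a strictly associative product, so the canonical
  isomorphisms in the quantifier clause and in the associativity law are identities and nothing is
  transported along them.

  Connectives are translated to themselves, hence an instance of a propositional rule becomes an
  instance of the same rule; this explains the restriction on \<open>rules X\<close>. A quantifier
  becomes a block of quantifiers and an equation a tensor of equations. For quantifiers the adjoint
  rules are simply iterated. For equality this fails: exchange and contraction cannot be assumed, so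
  the equations must appear in the order of the variables, while the rule acts only on the last
  variable of the context. Variables, unlike antecedents, can be permuted by substitution, so they
  are reordered around each use of the rule. This needs simultaneous substitution, whereas the logic
  only offers substitution for a single variable.\<close>

fun tm_scoped :: "nat \<Rightarrow> 'f tm \<Rightarrow> bool" where
  "tm_scoped n (Var i) \<longleftrightarrow> i < n"
| "tm_scoped n (Fun f ts) \<longleftrightarrow> (\<forall>t\<in>set ts. tm_scoped n t)"

text \<open>Scoping is kept apart from sorting: entries of a substitution beyond its length are
  unspecified, and a bound on the levels is all that the composition and identity laws of
  substitution require. The bound grows to \<open>Suc n\<close> under a binder because level
  \<open>n\<close> is the bound variable.\<close>

fun fm_scoped :: "nat \<Rightarrow> ('s, 'f, 'r, 'k) fm \<Rightarrow> bool" where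
  "fm_scoped n (Rel r ts) \<longleftrightarrow> (\<forall>t\<in>set ts. tm_scoped n t)"
| "fm_scoped n (Equal \<sigma> t u) \<longleftrightarrow> tm_scoped n t \<and> tm_scoped n u"
| "fm_scoped n (Conn k \<phi>s) \<longleftrightarrow> (\<forall>\<phi>\<in>set \<phi>s. fm_scoped n \<phi>)"
| "fm_scoped n (Quant q \<sigma> \<phi>) \<longleftrightarrow> fm_scoped (Suc n) \<phi>"

lemma length_vars [simp]: "length (vars i j) = j - i"
  by (simp add: vars_def)

lemma nth_vars [simp]: "k < j - i \<Longrightarrow> vars i j ! k = Var (i + k)"
  by (simp add: vars_def)

lemma set_vars [simp]: "set (vars i j) = Var ` {i..<j}"
  by (simp add: vars_def)

lemma vars_same [simp]: "vars i i = []"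
  by (simp add: vars_def)

lemma vars_Suc: "i \<le> j \<Longrightarrow> vars i (Suc j) = vars i j @ [Var j]"
  by (simp add: vars_def)

lemma vars_single: "vars i (Suc i) = [Var i]"
  by (simp add: vars_def)

lemma vars_append: "i \<le> j \<Longrightarrow> j \<le> k \<Longrightarrow> vars i j @ vars j k = vars i k"
  by (simp add: vars_def flip: map_append) (metis le_add_diff_inverse upt_add_eq_append)

lemma Cons_vars: "i < j \<Longrightarrow> Var i # vars (Suc i) j = vars i j"
  using vars_append[of i "Suc i" j] by (simp add: vars_single)

lemma map_tsub_vars: "map (tsub ts) (vars i j) = map ((!) ts) [i..<j]"
  by (simp add: vars_def comp_def)

lemma map_tsub_vars_slice:
  "j \<le> length ts \<Longrightarrow> map (tsub ts) (vars i j) = take (j - i) (drop i ts)"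
  by (rule nth_equalityI) (auto simp: map_tsub_vars)

lemma map_tsub_vars_append:
  "i = length A \<Longrightarrow> j = length A + length B \<Longrightarrow> map (tsub (A @ B @ C)) (vars i j) = B"
  by (simp add: map_tsub_vars_slice)

lemma tsub_tsub:
  "tm_scoped (length ts) t \<Longrightarrow> tsub us (tsub ts t) = tsub (map (tsub us) ts) t"
  by (induction t) auto

text \<open>Levels count from the front of the context, so a term in the scope of \<open>ts\<close>
  never reaches the entries appended behind. This spares the binder cases a shift.\<close>

lemma tsub_prefix: "tm_scoped (length ts) t \<Longrightarrow> tsub (ts @ us) t = tsub ts t"
  by (induction t) (auto simp: nth_append)

lemma tsub_vars: "tm_scoped n t \<Longrightarrow> tsub (vars 0 n) t = t"
  by (induction t) (auto intro: map_idI)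

lemma map_tsub_prefix:
  "\<forall>t\<in>set us. tm_scoped (length ts) t \<Longrightarrow> map (tsub (ts @ ts')) us = map (tsub ts) us"
  by (simp add: tsub_prefix)

lemma map_tsub_ident: "\<forall>t\<in>set ts. tm_scoped n t \<Longrightarrow> map (tsub (vars 0 n)) ts = ts"
  by (rule map_idI) (simp add: tsub_vars)

lemma tm_scoped_mono: "tm_scoped n t \<Longrightarrow> n \<le> m \<Longrightarrow> tm_scoped m t"
  by (induction t) auto

text \<open>The inner substitution carries the index \<open>length us\<close> because its results
  live over a context of that length: below a binder it introduces \<open>Var (length us)\<close>,
  exactly the position at which the outer one has then appended \<open>Var m\<close>.\<close>

lemma fsub_fsub:
  "fm_scoped (length ts) \<phi> \<Longrightarrow> \<forall>t\<in>set ts. tm_scoped (length us) t \<Longrightarrow>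
   fsub m us (fsub (length us) ts \<phi>) = fsub m (map (tsub us) ts) \<phi>"
proof (induction \<phi> arbitrary: ts us m)
  case (Quant q \<sigma> \<phi>)
  have "fsub (Suc m) (us @ [Var m]) (fsub (length (us @ [Var m])) (ts @ [Var (length us)]) \<phi>)
    = fsub (Suc m) (map (tsub (us @ [Var m])) (ts @ [Var (length us)])) \<phi>"
    using Quant.prems by (intro Quant.IH) (auto intro: tm_scoped_mono)
  then show ?case using Quant.prems by (simp add: map_tsub_prefix)
qed (auto simp: tsub_tsub)

lemma fsub_ident: "fm_scoped n \<phi> \<Longrightarrow> fsub n (vars 0 n) \<phi> = \<phi>"
proof (induction \<phi> arbitrary: n)
  case (Quant q \<sigma> \<phi>)
  then show ?case by (simp flip: vars_Suc)
qed (auto simp: tsub_vars map_tsub_ident intro: map_idI)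

lemma has_sort_scoped: "has_sort Sg \<Gamma> t \<tau> \<Longrightarrow> tm_scoped (length \<Gamma>) t"
proof (induction rule: has_sort.induct)
  case (Fun f \<sigma>s \<tau> ts)
  then show ?case by (auto simp: list_all2_conv_all_nth in_set_conv_nth)
qed simp

lemma list_sort_scoped:
  "list_all2 (has_sort Sg \<Gamma>) ts \<Delta> \<Longrightarrow> \<forall>t\<in>set ts. tm_scoped (length \<Gamma>) t"
  by (metis list_all2_conv_all_nth in_set_conv_nth has_sort_scoped)

lemma wf_fm_scoped: "wf_fm L Sg \<Gamma> \<phi> \<Longrightarrow> fm_scoped (length \<Gamma>) \<phi>"
  by (induction rule: wf_fm.induct) (auto dest: list_sort_scoped has_sort_scoped)

lemma has_sort_Var_iff [simp]: "has_sort Sg \<Gamma> (Var i) \<tau> \<longleftrightarrow> i < length \<Gamma> \<and> \<tau> = \<Gamma> ! i"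
  by (auto elim: has_sort.cases intro: has_sort.Var)

lemma has_sort_tsub:
  "has_sort Sg \<Gamma> t \<tau> \<Longrightarrow> list_all2 (has_sort Sg \<Delta>) ts \<Gamma> \<Longrightarrow> has_sort Sg \<Delta> (tsub ts t) \<tau>"
proof (induction rule: has_sort.induct)
  case (Var i)
  then show ?case by (simp add: list_all2_conv_all_nth)
next
  case (Fun f \<sigma>s \<tau> us)
  then have "list_all2 (has_sort Sg \<Delta>) (map (tsub ts) us) \<sigma>s"
    by (auto simp: list_all2_conv_all_nth)
  with Fun show ?case by (auto intro: has_sort.Fun)
qed

lemma list_sort_tsub:
  "list_all2 (has_sort Sg \<Gamma>) us \<Theta> \<Longrightarrow> list_all2 (has_sort Sg \<Delta>) ts \<Gamma> \<Longrightarrow>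
   list_all2 (has_sort Sg \<Delta>) (map (tsub ts) us) \<Theta>"
  by (auto simp: list_all2_conv_all_nth[of _ us] list_all2_conv_all_nth[of _ "map _ _"]
      intro: has_sort_tsub)

lemma list_sort_vars:
  "\<Delta> = A @ \<Gamma> @ B \<Longrightarrow> i = length A \<Longrightarrow> j = length A + length \<Gamma> \<Longrightarrow>
   list_all2 (has_sort Sg \<Delta>) (vars i j) \<Gamma>"
  by (auto simp: list_all2_conv_all_nth nth_append)

lemma list_sort_vars_ident [simp]: "list_all2 (has_sort Sg \<Gamma>) (vars 0 (length \<Gamma>)) \<Gamma>"
  by (auto simp: list_all2_conv_all_nth)

lemma has_sort_weaken: "has_sort Sg \<Gamma> t \<tau> \<Longrightarrow> has_sort Sg (\<Gamma> @ \<Delta>) t \<tau>"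
  using has_sort_tsub[of Sg \<Gamma> t \<tau> "\<Gamma> @ \<Delta>" "vars 0 (length \<Gamma>)"]
    list_sort_vars[of "\<Gamma> @ \<Delta>" "[]" \<Gamma> \<Delta> 0 "length \<Gamma>" Sg]
  by (simp add: tsub_vars[OF has_sort_scoped])

lemma list_sort_weaken:
  "list_all2 (has_sort Sg \<Gamma>) ts \<Theta> \<Longrightarrow> list_all2 (has_sort Sg (\<Gamma> @ \<Delta>)) ts \<Theta>"
  by (auto simp: list_all2_conv_all_nth intro: has_sort_weaken)

inductive_cases wf_RelE: "wf_fm L Sg \<Gamma> (Rel r ts)"
inductive_cases wf_EqualE: "wf_fm L Sg \<Gamma> (Equal \<sigma> t u)"
inductive_cases wf_ConnE: "wf_fm L Sg \<Gamma> (Conn k \<phi>s)"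
inductive_cases wf_QuantE: "wf_fm L Sg \<Gamma> (Quant q \<sigma> \<phi>)"

lemma wf_Equal_iff [simp]: "wf_fm L Sg \<Gamma> (Equal \<sigma> t u) \<longleftrightarrow>
    \<sigma> \<in> sorts Sg \<and> has_sort Sg \<Gamma> t \<sigma> \<and> has_sort Sg \<Gamma> u \<sigma>"
  by (auto intro: wf_fm.Equal elim: wf_EqualE)

lemma wf_Rel_iff [simp]: "wf_fm L Sg \<Gamma> (Rel r ts) \<longleftrightarrow>
    (\<exists>\<sigma>s. rels Sg r = Some \<sigma>s \<and> list_all2 (has_sort Sg \<Gamma>) ts \<sigma>s)"
  by (auto intro: wf_fm.Rel elim: wf_RelE)

lemma wf_Conn_iff [simp]: "wf_fm L Sg \<Gamma> (Conn k \<phi>s) \<longleftrightarrow>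
    length \<phi>s = arity L k \<and> (\<forall>\<phi>\<in>set \<phi>s. wf_fm L Sg \<Gamma> \<phi>)"
  by (auto intro: wf_fm.Conn elim: wf_ConnE)

lemma wf_Quant_iff [simp]: "wf_fm L Sg \<Gamma> (Quant q \<sigma> \<phi>) \<longleftrightarrow>
    \<sigma> \<in> sorts Sg \<and> wf_fm L Sg (\<Gamma> @ [\<sigma>]) \<phi>"
  by (auto intro: wf_fm.Quant elim: wf_QuantE)

lemma wf_ctx_append [simp]: "wf_ctx Sg (\<Gamma> @ \<Delta>) \<longleftrightarrow> wf_ctx Sg \<Gamma> \<and> wf_ctx Sg \<Delta>"
  by (auto simp: wf_ctx_def)

lemma wf_ctx_Cons [simp]: "wf_ctx Sg (\<sigma> # \<Delta>) \<longleftrightarrow> \<sigma> \<in> sorts Sg \<and> wf_ctx Sg \<Delta>"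
  by (auto simp: wf_ctx_def)

lemma wf_ctx_Nil [simp]: "wf_ctx Sg []"
  by (simp add: wf_ctx_def)

lemma wf_ctx_concat [simp]: "wf_ctx Sg (concat \<Gamma>s) \<longleftrightarrow> (\<forall>\<Gamma>\<in>set \<Gamma>s. wf_ctx Sg \<Gamma>)"
  by (auto simp: wf_ctx_def)

lemma wf_fm_fsub:
  "wf_fm L Sg \<Gamma> \<phi> \<Longrightarrow> list_all2 (has_sort Sg \<Delta>) ts \<Gamma> \<Longrightarrow> m = length \<Delta> \<Longrightarrow>
   wf_fm L Sg \<Delta> (fsub m ts \<phi>)"
proof (induction \<phi> arbitrary: \<Gamma> \<Delta> ts m)
  case (Quant q \<sigma> \<phi>)
  have "list_all2 (has_sort Sg (\<Delta> @ [\<sigma>])) (ts @ [Var m]) (\<Gamma> @ [\<sigma>])"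
    using Quant.prems by (simp add: list_all2_appendI list_sort_weaken)
  then show ?case
    using Quant.prems Quant.IH[of "\<Gamma> @ [\<sigma>]" "\<Delta> @ [\<sigma>]" "ts @ [Var m]" "Suc m"] by simp
qed (auto intro: has_sort_tsub list_sort_tsub)

text \<open>Passing a block of binders, a substitution maps the bound block to fresh consecutive
  levels. Naturality of quantification and the quantifier case of the translation both rest on this
  computation.\<close>

lemma fsub_foldr_Quant:
  "fsub m ts (foldr (Quant q) \<Delta> \<phi>) =
   foldr (Quant q) \<Delta> (fsub (m + length \<Delta>) (ts @ vars m (m + length \<Delta>)) \<phi>)"
proof (induction \<Delta> arbitrary: m ts)
  case (Cons \<sigma> \<Delta>)
  then show ?case by (simp add: Cons_vars)
qed simp

lemma wf_foldr_Quant [simp]: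
  "wf_fm L Sg \<Gamma> (foldr (Quant q) \<Delta> \<phi>) \<longleftrightarrow> wf_ctx Sg \<Delta> \<and> wf_fm L Sg (\<Gamma> @ \<Delta>) \<phi>"
  by (induction \<Delta> arbitrary: \<Gamma>) auto

lemma take_vars [simp]: "i + k \<le> j \<Longrightarrow> take k (vars i j) = vars i (i + k)"
  by (simp add: vars_def take_map)

lemma drop_vars [simp]: "drop k (vars i j) = vars (i + k) j"
  by (simp add: vars_def drop_map)

lemma vars_empty [simp]: "j \<le> i \<Longrightarrow> vars i j = []"
  by (simp add: vars_def)


section \<open>Closed theories\<close>

lemma wf_wk: "wf_fm L Sg \<Gamma> \<phi> \<Longrightarrow> wf_fm L Sg (\<Gamma> @ [\<sigma>]) (wk (length \<Gamma>) \<phi>)"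
  unfolding wk_def by (erule wf_fm_fsub) (auto intro: list_sort_weaken)

lemma wf_wk_append: "wf_fm L Sg (\<Gamma> @ [\<tau>]) \<phi> \<Longrightarrow> wf_fm L Sg (\<Gamma> @ [\<tau>, \<sigma>]) (wk (Suc (length \<Gamma>)) \<phi>)"
  using wf_wk[of L Sg "\<Gamma> @ [\<tau>]" \<phi> \<sigma>] by simp

lemma wf_inst_meta:
  "wf_meta L m \<Longrightarrow> \<forall>i. wf_fm L Sg \<Gamma> (v i) \<Longrightarrow> wf_fm L Sg \<Gamma> (inst_meta v m)"
  by (induction m) (auto simp: list_all_iff)

lemma wf_inst_seq:
  "wf_meta_seq L s \<Longrightarrow> wf_ctx Sg \<Gamma> \<Longrightarrow> \<forall>i. wf_fm L Sg \<Gamma> (v i) \<Longrightarrow>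
   \<forall>i. \<forall>\<phi>\<in>set (w i). wf_fm L Sg \<Gamma> \<phi> \<Longrightarrow> wf_assertion L Sg (inst_seq \<Gamma> v w s)"
proof (induction s)
  case (MSeq xs m)
  have "\<phi> \<in> set (inst_item v w x) \<Longrightarrow> wf_meta_item L x \<Longrightarrow> wf_fm L Sg \<Gamma> \<phi>" for x \<phi>
    using MSeq by (cases x) (auto intro: wf_inst_meta)
  with MSeq show ?case by (auto intro: wf_inst_meta)
qed

text \<open>The side conditions of the adjoint rules enter here: where a premise contains only a
  weakening or a diagonal instance of a formula, its well-formedness says nothing immediate about
  the formula in the conclusion, and the rule demands it separately.\<close>

lemma closure_wf:
  assumes L: "wf_lang L" and X: "\<forall>r\<in>rules X. wf_rule L r" and T: "is_theory L Sg T"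
  shows "a \<in> closure L X Sg T \<Longrightarrow> wf_assertion L Sg a"
proof (induction rule: closure.induct)
  case (Hyp a)
  then show ?case using T by (simp add: is_theory_def)
next
  case (Subst \<Gamma> M N \<tau> \<Delta> ts us)
  then show ?case
    by (auto intro!: has_sort_tsub simp: list_all2_conv_all_nth)
next
  case (Cwk \<Gamma> \<Gamma>' \<Phi> \<psi> \<sigma> n m xs)
  have "list_all2 (has_sort Sg (\<Gamma> @ [\<sigma>] @ \<Gamma>')) xs (\<Gamma> @ \<Gamma>')"
    using Cwk list_sort_vars[OF refl refl refl, of Sg "\<Gamma> @ [\<sigma>]" \<Gamma>' "[]"]
      list_sort_vars[OF refl refl refl, of Sg "[]" \<Gamma> "[\<sigma>] @ \<Gamma>'"]
    by (auto intro!: list_all2_appendI)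
  with Cwk show ?case by (auto intro!: wf_fm_fsub)
next
  case (Sub \<Gamma> \<Gamma>' M M' \<sigma> \<Phi> \<psi> n m)
  have "list_all2 (has_sort Sg (\<Gamma> @ \<Gamma>')) (vars 0 n @ [K] @ vars n m) (\<Gamma> @ [\<sigma>] @ \<Gamma>')"
    if "has_sort Sg (\<Gamma> @ \<Gamma>') K \<sigma>" for K
    using Sub that list_sort_vars[OF refl refl refl, of Sg \<Gamma> \<Gamma>' "[]"]
      list_sort_vars[OF refl refl refl, of Sg "[]" \<Gamma> \<Gamma>']
    by (auto intro!: list_all2_appendI)
  with Sub show ?case by (auto intro!: wf_fm_fsub)
next
  case (Conn_Cong \<Gamma> \<phi>s k \<psi>s)
  then show ?case by (auto simp: in_set_conv_nth)
next
  case (Eq_Adj1 n \<Gamma> \<sigma> \<psi> \<Phi>)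
  then show ?case by (auto intro: wf_wk_append simp: nth_append)
next
  case (Eq_Adj2 n \<Gamma> \<Phi> \<sigma> \<psi>)
  have "list_all2 (has_sort Sg (\<Gamma> @ [\<sigma>])) (vars 0 (Suc n) @ [Var n]) ((\<Gamma> @ [\<sigma>]) @ [\<sigma>])"
    using Eq_Adj2 by (intro list_all2_appendI list_sort_vars[where A = "[]"]) auto
  with Eq_Adj2 show ?case by (auto intro: wf_fm_fsub)
next
  case (Rule r \<Gamma> v w)
  then show ?case using X by (auto intro!: wf_inst_seq simp: wf_rule_def)
qed (use L in \<open>auto simp: wf_lang_def intro: wf_wk\<close>)

text \<open>This makes the closure of a theory an L-theory, hence an admissible index of a
  classifying prop-category in the completeness half.\<close>

lemma closure_idem: "closure L X Sg (closure L X Sg T) = closure L X Sg T"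
proof
  show "closure L X Sg (closure L X Sg T) \<subseteq> closure L X Sg T"
  proof
    fix a assume "a \<in> closure L X Sg (closure L X Sg T)"
    then show "a \<in> closure L X Sg T"
    proof (induction rule: closure.induct)
      case (Hyp a)
      then show ?case .
    next
      case Refl
      then show ?case by (blast intro: closure.Refl)
    next
      case Sym
      then show ?case by (blast intro: closure.Sym)
    next
      case Trans
      then show ?case by (blast intro: closure.Trans)
    next
      case Subst
      then show ?case by (simp add: closure.Subst)
    next
      case Ax
      then show ?case by (blast intro: closure.Ax)
    next
      case Cut
      then show ?case by (blast intro: closure.Cut)
    next
      case Cwk
      then show ?case by (blast intro: closure.Cwk)
    next
      case Sub
      then show ?case by (blast intro: closure.Sub)
    next
      case Quant_Con
      then show ?case by (blast intro: closure.Quant_Con)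
    next
      case Conn_Cong
      then show ?case by (simp add: closure.Conn_Cong)
    next
      case Tensor_Ref1
      then show ?case by (blast intro: closure.Tensor_Ref1)
    next
      case Tensor_Ref2
      then show ?case by (blast intro: closure.Tensor_Ref2)
    next
      case Unit_Ref1
      then show ?case by (blast intro: closure.Unit_Ref1)
    next
      case Unit_Ref2
      then show ?case by (blast intro: closure.Unit_Ref2)
    next
      case Eq_Adj1
      then show ?case by (blast intro: closure.Eq_Adj1)
    next
      case Eq_Adj2
      then show ?case by (blast intro: closure.Eq_Adj2)
    next
      case All_Adj1
      then show ?case by (blast intro: closure.All_Adj1)
    next
      case All_Adj2
      then show ?case by (blast intro: closure.All_Adj2)
    next
      case Ex_Adj1
      then show ?case by (blast intro: closure.Ex_Adj1)
    next
      case Ex_Adj2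
      then show ?case by (blast intro: closure.Ex_Adj2)
    next
      case Rule
      then show ?case by (simp add: closure.Rule)
    qed
  qed
qed (blast intro: closure.Hyp)

locale closed_theory =
  fixes L :: "'k lang" and X :: "'k logic" and Sg :: "('s, 'f, 'r) signat"
    and T :: "('s, 'f, 'r, 'k) assertion set"
  assumes wf_L: "wf_lang L"
    and wf_X: "\<forall>r\<in>rules X. wf_rule L r"
    and L_theory: "L_theory L X Sg T"
begin

lemma closure_eq: "closure L X Sg T = T"
  using L_theory by (simp add: L_theory_def)

text \<open>Since \<open>T\<close> is its own closure, the introduction rules of
  \<open>closure\<close> turn into closure properties of \<open>T\<close> itself.\<close>

lemmas rule_Refl = closure.Refl[where L = L and X = X and Sg = Sg and T = T, unfolded closure_eq]
lemmas rule_Sym = closure.Sym[where L = L and X = X and Sg = Sg and T = T, unfolded closure_eq]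
lemmas rule_Trans = closure.Trans[where L = L and X = X and Sg = Sg and T = T, unfolded closure_eq]
lemmas rule_Subst = closure.Subst[where L = L and X = X and Sg = Sg and T = T, unfolded closure_eq]
lemmas rule_Ax = closure.Ax[where L = L and X = X and Sg = Sg and T = T, unfolded closure_eq]
lemmas rule_Cut = closure.Cut[where L = L and X = X and Sg = Sg and T = T, unfolded closure_eq]
lemmas rule_Cwk = closure.Cwk[where L = L and X = X and Sg = Sg and T = T, unfolded closure_eq]
lemmas rule_Sub = closure.Sub[where L = L and X = X and Sg = Sg and T = T, unfolded closure_eq]
lemmas rule_Quant_Con =
  closure.Quant_Con[where L = L and X = X and Sg = Sg and T = T, unfolded closure_eq]
lemmas rule_Conn_Cong =
  closure.Conn_Cong[where L = L and X = X and Sg = Sg and T = T, unfolded closure_eq]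
lemmas rule_Tensor1 =
  closure.Tensor_Ref1[where L = L and X = X and Sg = Sg and T = T, unfolded closure_eq]
lemmas rule_Tensor2 =
  closure.Tensor_Ref2[where L = L and X = X and Sg = Sg and T = T, unfolded closure_eq]
lemmas rule_Unit1 =
  closure.Unit_Ref1[where L = L and X = X and Sg = Sg and T = T, unfolded closure_eq]
lemmas rule_Unit2 =
  closure.Unit_Ref2[where L = L and X = X and Sg = Sg and T = T, unfolded closure_eq]
lemmas rule_Eq_Adj1 =
  closure.Eq_Adj1[where L = L and X = X and Sg = Sg and T = T, unfolded closure_eq]
lemmas rule_Eq_Adj2 =
  closure.Eq_Adj2[where L = L and X = X and Sg = Sg and T = T, unfolded closure_eq]
lemmas rule_All_Adj1 =
  closure.All_Adj1[where L = L and X = X and Sg = Sg and T = T, unfolded closure_eq]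
lemmas rule_All_Adj2 =
  closure.All_Adj2[where L = L and X = X and Sg = Sg and T = T, unfolded closure_eq]
lemmas rule_Ex_Adj1 =
  closure.Ex_Adj1[where L = L and X = X and Sg = Sg and T = T, unfolded closure_eq]
lemmas rule_Ex_Adj2 =
  closure.Ex_Adj2[where L = L and X = X and Sg = Sg and T = T, unfolded closure_eq]
lemmas rule_Rule = closure.Rule[where L = L and X = X and Sg = Sg and T = T, unfolded closure_eq]

lemma wf_T: "a \<in> T \<Longrightarrow> wf_assertion L Sg a"
  using L_theory by (simp add: L_theory_def is_theory_def)

lemma wf_Eqn:
  assumes "Eqn \<Gamma> M N \<tau> \<in> T"
  shows "wf_ctx Sg \<Gamma>" "has_sort Sg \<Gamma> M \<tau>" "has_sort Sg \<Gamma> N \<tau>"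
  using wf_T[OF assms] by auto

lemma wf_Seq:
  assumes "Seq \<Gamma> \<Phi> \<psi> \<in> T"
  shows "wf_ctx Sg \<Gamma>" "\<phi> \<in> set \<Phi> \<Longrightarrow> wf_fm L Sg \<Gamma> \<phi>" "wf_fm L Sg \<Gamma> \<psi>"
  using wf_T[OF assms] by auto

lemma fsub_ident_wf: "wf_fm L Sg \<Gamma> \<phi> \<Longrightarrow> fsub (length \<Gamma>) (vars 0 (length \<Gamma>)) \<phi> = \<phi>"
  by (simp add: fsub_ident wf_fm_scoped)

lemma arity_tensor [simp]: "arity L (tensor_c L) = 2"
  and arity_unit [simp]: "arity L (unit_c L) = 0"
  using wf_L by (auto simp: wf_lang_def)


text \<open>The well-formedness of \<open>\<Gamma>\<close> is a separate conjunct because for empty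
  \<open>\<Delta>\<close> there is no equation from which it would follow.\<close>

definition tms_eqv :: "'s list \<Rightarrow> 's list \<Rightarrow> 'f tm list \<Rightarrow> 'f tm list \<Rightarrow> bool" where
  "tms_eqv \<Gamma> \<Delta> ts us \<longleftrightarrow> wf_ctx Sg \<Gamma> \<and> length ts = length \<Delta> \<and> length us = length \<Delta> \<and>
     (\<forall>i<length \<Delta>. Eqn \<Gamma> (ts ! i) (us ! i) (\<Delta> ! i) \<in> T)"

definition fm_eqv :: "'s list \<Rightarrow> ('s, 'f, 'r, 'k) fm \<Rightarrow> ('s, 'f, 'r, 'k) fm \<Rightarrow> bool" where
  "fm_eqv \<Gamma> \<phi> \<psi> \<longleftrightarrow> Seq \<Gamma> [\<phi>] \<psi> \<in> T \<and> Seq \<Gamma> [\<psi>] \<phi> \<in> T"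

lemma tms_eqv_refl: "wf_ctx Sg \<Gamma> \<Longrightarrow> list_all2 (has_sort Sg \<Gamma>) ts \<Delta> \<Longrightarrow> tms_eqv \<Gamma> \<Delta> ts ts"
  by (simp add: tms_eqv_def list_all2_conv_all_nth rule_Refl)

lemma tms_eqv_sym: "tms_eqv \<Gamma> \<Delta> ts us \<Longrightarrow> tms_eqv \<Gamma> \<Delta> us ts"
  by (simp add: tms_eqv_def rule_Sym)

lemma tms_eqv_trans: "tms_eqv \<Gamma> \<Delta> ts us \<Longrightarrow> tms_eqv \<Gamma> \<Delta> us vs \<Longrightarrow> tms_eqv \<Gamma> \<Delta> ts vs"
  unfolding tms_eqv_def by (blast intro: rule_Trans)

lemma tms_eqv_sort:
  assumes "tms_eqv \<Gamma> \<Delta> ts us"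
  shows "list_all2 (has_sort Sg \<Gamma>) ts \<Delta>" "list_all2 (has_sort Sg \<Gamma>) us \<Delta>"
  using assms by (auto simp: tms_eqv_def list_all2_conv_all_nth dest: wf_Eqn)

lemma tms_eqv_append:
  "length ts = length \<Delta> \<Longrightarrow> length us = length \<Delta> \<Longrightarrow>
   tms_eqv \<Gamma> (\<Delta> @ \<Delta>') (ts @ ts') (us @ us') \<longleftrightarrow> tms_eqv \<Gamma> \<Delta> ts us \<and> tms_eqv \<Gamma> \<Delta>' ts' us'"
  apply (auto simp: tms_eqv_def nth_append)
  by (metis add_less_cancel_left diff_add_inverse not_add_less1)

lemma tms_eqv_Nil [simp]: "tms_eqv \<Gamma> [] ts us \<longleftrightarrow> wf_ctx Sg \<Gamma> \<and> ts = [] \<and> us = []"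
  by (auto simp: tms_eqv_def)

lemma tms_eqv_single: "tms_eqv \<Gamma> [\<sigma>] [t] [u] \<longleftrightarrow> Eqn \<Gamma> t u \<sigma> \<in> T"
  by (auto simp: tms_eqv_def dest: wf_Eqn)

lemma tms_eqv_Cons:
  "tms_eqv \<Gamma> (\<sigma> # \<Delta>) (t # ts) (u # us) \<longleftrightarrow> Eqn \<Gamma> t u \<sigma> \<in> T \<and> tms_eqv \<Gamma> \<Delta> ts us"
  using tms_eqv_append[of "[t]" "[\<sigma>]" "[u]" \<Gamma> \<Delta> ts us] by (simp add: tms_eqv_single)

lemma Eqn_tsub:
  assumes "Eqn \<Gamma> M N \<tau> \<in> T" "tms_eqv \<Delta> \<Gamma> ts us"
  shows "Eqn \<Delta> (tsub ts M) (tsub us N) \<tau> \<in> T"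
  using assms by (auto simp: tms_eqv_def intro: rule_Subst)

lemma tms_eqv_tsub:
  "tms_eqv \<Gamma> \<Theta> ts us \<Longrightarrow> tms_eqv \<Delta> \<Gamma> vs ws \<Longrightarrow>
   tms_eqv \<Delta> \<Theta> (map (tsub vs) ts) (map (tsub ws) us)"
  unfolding tms_eqv_def[of _ \<Theta>] by (auto intro: Eqn_tsub simp: tms_eqv_def)

section \<open>Simultaneous substitution as an admissible rule\<close>

lemma Eqn_weaken: "Eqn \<Gamma> M N \<tau> \<in> T \<Longrightarrow> wf_ctx Sg \<Delta> \<Longrightarrow> Eqn (\<Gamma> @ \<Delta>) M N \<tau> \<in> T"
  using Eqn_tsub[of \<Gamma> M N \<tau> "\<Gamma> @ \<Delta>" "vars 0 (length \<Gamma>)" "vars 0 (length \<Gamma>)"]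
  by (simp add: tms_eqv_refl wf_Eqn(1) list_sort_weaken tsub_vars
      has_sort_scoped[OF wf_Eqn(2)] has_sort_scoped[OF wf_Eqn(3)])

text \<open>\<open>Cwk\<close> inserts one variable between two parts of a context. Growing
  \<open>\<Delta>\<close> from the right keeps the insertion point directly before
  \<open>\<Gamma>\<close>, so each round shifts the levels of \<open>\<Gamma>\<close> by
  one.\<close>

lemma Seq_weaken_front:
  assumes "Seq \<Gamma> \<Phi> \<psi> \<in> T" "wf_ctx Sg \<Delta>"
  defines "m \<equiv> length \<Delta> + length \<Gamma>"
  shows "Seq (\<Delta> @ \<Gamma>) (map (fsub m (vars (length \<Delta>) m)) \<Phi>) (fsub m (vars (length \<Delta>) m) \<psi>) \<in> T"
  using assms(2) unfolding m_def
proof (induction \<Delta> rule: rev_induct)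
  case Nil
  then show ?case
    using assms(1) by (simp add: fsub_ident_wf wf_Seq[OF assms(1)] cong: map_cong)
next
  case (snoc \<sigma> \<Delta>)
  let ?n = "length \<Delta>" let ?m = "length \<Delta> + length \<Gamma>"
  have eq: "fsub (Suc ?m) (vars 0 ?n @ vars (Suc ?n) (Suc ?m)) (fsub ?m (vars ?n ?m) \<phi>) =
    fsub (Suc ?m) (vars (Suc ?n) (Suc ?m)) \<phi>" if "wf_fm L Sg \<Gamma> \<phi>" for \<phi>
    using wf_fm_scoped[OF that]
      fsub_fsub[of "vars ?n ?m" \<phi> "vars 0 ?n @ vars (Suc ?n) (Suc ?m)"]
    by (simp add: map_tsub_vars_slice)
  show ?case
    using rule_Cwk[of \<Delta> \<Gamma> "map (fsub ?m (vars ?n ?m)) \<Phi>" "fsub ?m (vars ?n ?m) \<psi>" \<sigma>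
        ?n "Suc ?m" "vars 0 ?n @ vars (Suc ?n) (Suc ?m)"] snoc
    by (simp add: eq wf_Seq[OF assms(1)] cong: map_cong)
qed

text \<open>The terms live over \<open>\<Delta>\<close> alone, so eliminating the variables of
  \<open>\<Gamma>\<close> one after the other never alters terms inserted earlier: here iterated
  single substitution is simultaneous.\<close>

lemma Seq_subst_tail:
  assumes "Seq (\<Delta> @ \<Gamma>) \<Phi> \<psi> \<in> T" "tms_eqv \<Delta> \<Gamma> ts us"
  defines "d \<equiv> length \<Delta>"
  shows "Seq \<Delta> (map (fsub d (vars 0 d @ ts)) \<Phi>) (fsub d (vars 0 d @ us) \<psi>) \<in> T"
  using assms(1,2)
proof (induction \<Gamma> arbitrary: \<Phi> \<psi> ts us)
  case Nil
  then show ?case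
    by (simp add: d_def fsub_ident_wf wf_Seq[OF Nil(1), simplified] cong: map_cong)
next
  case (Cons \<sigma> \<Gamma>)
  let ?m = "d + length \<Gamma>"
  obtain t ts' u us' where ts: "ts = t # ts'" "us = u # us'"
    using Cons.prems(2) by (auto simp: tms_eqv_def length_Suc_conv)
  have tu: "Eqn \<Delta> t u \<sigma> \<in> T" and eqv: "tms_eqv \<Delta> \<Gamma> ts' us'"
    using Cons.prems(2) by (auto simp: ts tms_eqv_Cons)
  have len: "length ts' = length \<Gamma>" "length us' = length \<Gamma>"
    using eqv by (auto simp: tms_eqv_def)
  have "wf_ctx Sg \<Gamma>" using wf_Seq(1)[OF Cons.prems(1)] by simp
  \<comment> \<open>\<open>Sub\<close> wants the terms over the whole context of its conclusion, so
    the equation is weakened by the variables still to be eliminated; the terms themselves keep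
    their form.\<close>
  then have "Eqn (\<Delta> @ \<Gamma>) t u \<sigma> \<in> T" by (rule Eqn_weaken[OF tu])
  from rule_Sub[OF this, of \<Phi> \<psi> d ?m] Cons.prems(1)
  have 1: "Seq (\<Delta> @ \<Gamma>) (map (fsub ?m (vars 0 d @ [t] @ vars d ?m)) \<Phi>)
     (fsub ?m (vars 0 d @ [u] @ vars d ?m) \<psi>) \<in> T"
    by (simp add: d_def)
  have eq: "fsub d (vars 0 d @ ws) (fsub ?m (vars 0 d @ w # vars d ?m) \<phi>) =
      fsub d (vars 0 d @ w # ws) \<phi>"
    if "wf_fm L Sg (\<Delta> @ \<sigma> # \<Gamma>) \<phi>" "length ws = length \<Gamma>" "has_sort Sg \<Delta> w \<sigma>" for ws w \<phi>
  proof -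
    have w: "tm_scoped d w" using has_sort_scoped[OF that(3)] by (simp add: d_def)
    have "fsub d (vars 0 d @ ws)
       (fsub (length (vars 0 d @ ws)) (vars 0 d @ [w] @ vars d ?m) \<phi>) =
       fsub d (map (tsub (vars 0 d @ ws)) (vars 0 d @ [w] @ vars d ?m)) \<phi>"
      using wf_fm_scoped[OF that(1)] that(2) w
      by (intro fsub_fsub) (auto simp: d_def intro: tm_scoped_mono)
    then show ?thesis
      using that(2) w by (simp add: map_tsub_vars_slice tsub_prefix tsub_vars)
  qed
  show ?case
    using Cons.IH[OF 1 eqv]
    by (simp add: ts eq[OF wf_Seq(2)[OF Cons.prems(1)] _ wf_Eqn(2)[OF tu]]
      eq[OF wf_Seq(3)[OF Cons.prems(1)] _ wf_Eqn(3)[OF tu]] len cong: map_cong)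
qed

text \<open>The target context \<open>\<Delta>\<close> is first put in front as a disjoint copy;
  only then are the variables of \<open>\<Gamma>\<close> replaced, so source and target variables
  cannot interfere. This covers renaming, permuting and identifying variables as well. As in
  \<open>Sub\<close>, one list enters the antecedents and the provably equal one the
  succedent.\<close>

lemma Seq_subst_eqv:
  assumes "Seq \<Gamma> \<Phi> \<psi> \<in> T" "tms_eqv \<Delta> \<Gamma> ts us"
  defines "d \<equiv> length \<Delta>"
  shows "Seq \<Delta> (map (fsub d ts) \<Phi>) (fsub d us \<psi>) \<in> T"
proof -
  let ?m = "d + length \<Gamma>"
  have wfD: "wf_ctx Sg \<Delta>" and len: "length ts = length \<Gamma>" "length us = length \<Gamma>"
    using assms(2) by (auto simp: tms_eqv_def)
  have sc: "\<forall>t\<in>set ts. tm_scoped d t" "\<forall>t\<in>set us. tm_scoped d t"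
    using tms_eqv_sort[OF assms(2)] list_sort_scoped unfolding d_def by blast+
  have eq: "fsub d (vars 0 d @ ws) (fsub ?m (vars d ?m) \<phi>) = fsub d ws \<phi>"
    if "wf_fm L Sg \<Gamma> \<phi>" "length ws = length \<Gamma>" for ws \<phi>
    using wf_fm_scoped[OF that(1)] that(2) fsub_fsub[of "vars d ?m" \<phi> "vars 0 d @ ws"]
    by (simp add: map_tsub_vars_slice)
  show ?thesis
    using Seq_subst_tail[OF Seq_weaken_front[OF assms(1) wfD] assms(2)]
    by (simp add: d_def[symmetric] eq len wf_Seq[OF assms(1)] cong: map_cong)
qed

lemma Seq_subst:
  assumes "Seq \<Gamma> \<Phi> \<psi> \<in> T" "wf_ctx Sg \<Delta>" "list_all2 (has_sort Sg \<Delta>) ts \<Gamma>"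
  shows "Seq \<Delta> (map (fsub (length \<Delta>) ts) \<Phi>) (fsub (length \<Delta>) ts \<psi>) \<in> T"
  using assms by (intro Seq_subst_eqv tms_eqv_refl)

end

abbreviation tensors :: "'k lang \<Rightarrow> ('s, 'f, 'r, 'k) fm list \<Rightarrow> ('s, 'f, 'r, 'k) fm" where
  "tensors L \<equiv> big_tensor (\<lambda>\<phi> \<psi>. Conn (tensor_c L) [\<phi>, \<psi>]) (Conn (unit_c L) [])"

lemma fsub_tensors: "fsub m ts (tensors L \<Phi>) = tensors L (map (fsub m ts) \<Phi>)"
  by (induction \<Phi> rule: induct_list012) auto

lemma length_concat_take:
  "list_all2 (\<lambda>x y. length x = length y) xss yss \<Longrightarrow>
   length (concat (take i xss)) = length (concat (take i yss))"
  by (induction arbitrary: i rule: list_all2_induct) (auto simp: take_Cons split: nat.split)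

lemma concat_split: "i < length xss \<Longrightarrow>
  concat xss = concat (take i xss) @ xss ! i @ concat (drop (Suc i) xss)"
  by (metis concat.simps(2) concat_append id_take_nth_drop)

lemma concat_take_Suc: "i < length xss \<Longrightarrow> concat (take (Suc i) xss) = concat (take i xss) @ xss ! i"
  by (simp add: take_Suc_conv_app_nth)

text \<open>Projection after tupling, at the level of lists: corresponding pieces have equal
  lengths, so the levels of the \<open>i\<close>-th slice point exactly at the piece
  \<open>tss ! i\<close>.\<close>

lemma map_tsub_slice:
  assumes "list_all2 (\<lambda>ts \<Delta>. length ts = length \<Delta>) tss \<Delta>s" "i < length \<Delta>s"
  shows "map (tsub (concat tss))
    (vars (length (concat (take i \<Delta>s))) (length (concat (take (Suc i) \<Delta>s)))) = tss ! i"
proof -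
  have "length tss = length \<Delta>s" "length (tss ! i) = length (\<Delta>s ! i)"
    using assms by (auto simp: list_all2_conv_all_nth)
  then show ?thesis
    using assms(2) length_concat_take[OF assms(1), of i]
    by (simp add: concat_split[of i tss] concat_take_Suc del: length_concat concat_append)
      (rule map_tsub_vars_append; simp)
qed

lemma list_sort_slice:
  assumes "i < length \<Delta>s"
  shows "list_all2 (has_sort Sg (concat \<Delta>s))
    (vars (length (concat (take i \<Delta>s))) (length (concat (take (Suc i) \<Delta>s)))) (\<Delta>s ! i)"
  using assms by (intro list_sort_vars[OF concat_split]) (simp_all add: concat_take_Suc)

text \<open>Needed for uniqueness of tuples: a morphism into a product is a list of terms without
  visible division into components, and the codomain tells where to cut it.\<close>

lemma concat_pieces:
  "length xs = length (concat yss) \<Longrightarrow>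
   \<exists>xss. xs = concat xss \<and> list_all2 (\<lambda>x y. length x = length y) xss yss"
proof (induction yss arbitrary: xs)
  case (Cons ys yss)
  from Cons.IH[of "drop (length ys) xs"] Cons.prems obtain xss where
    "drop (length ys) xs = concat xss" "list_all2 (\<lambda>x y. length x = length y) xss yss" by auto
  then show ?case
    using Cons.prems by (intro exI[of _ "take (length ys) xs # xss"]) (auto, metis append_take_drop_id)
qed simp

context closed_theory
begin

section \<open>Provable equivalence of formulas, and antecedents joined by the tensor\<close>

lemma fm_eqv_wf:
  assumes "fm_eqv \<Gamma> \<phi> \<psi>"
  shows "wf_ctx Sg \<Gamma>" "wf_fm L Sg \<Gamma> \<phi>" "wf_fm L Sg \<Gamma> \<psi>"
  using assms by (auto simp: fm_eqv_def dest: wf_Seq)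

lemma fm_eqv_refl: "wf_ctx Sg \<Gamma> \<Longrightarrow> wf_fm L Sg \<Gamma> \<phi> \<Longrightarrow> fm_eqv \<Gamma> \<phi> \<phi>"
  by (simp add: fm_eqv_def rule_Ax)

lemma fm_eqv_sym: "fm_eqv \<Gamma> \<phi> \<psi> \<Longrightarrow> fm_eqv \<Gamma> \<psi> \<phi>"
  by (simp add: fm_eqv_def)

lemma Seq_trans: "Seq \<Gamma> \<Phi> \<phi> \<in> T \<Longrightarrow> Seq \<Gamma> [\<phi>] \<psi> \<in> T \<Longrightarrow> Seq \<Gamma> \<Phi> \<psi> \<in> T"
  using rule_Cut[of \<Gamma> \<Phi> \<phi> "[]" "[]" \<psi>] by simp

text \<open>A Yoneda argument: \<open>\<theta>\<close> is taken to be each of the two formulas, with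
  \<open>Ax\<close> on one side. It reduces laws of the tensor to regrouping antecedents.\<close>

lemma fm_eqvI:
  "wf_ctx Sg \<Gamma> \<Longrightarrow> wf_fm L Sg \<Gamma> \<phi> \<Longrightarrow> wf_fm L Sg \<Gamma> \<psi> \<Longrightarrow>
   (\<And>\<theta>. Seq \<Gamma> [\<phi>] \<theta> \<in> T \<longleftrightarrow> Seq \<Gamma> [\<psi>] \<theta> \<in> T) \<Longrightarrow> fm_eqv \<Gamma> \<phi> \<psi>"
  unfolding fm_eqv_def using rule_Ax by blast

lemma Seq_replace:
  "fm_eqv \<Gamma> \<phi> \<phi>' \<Longrightarrow> Seq \<Gamma> (A @ \<phi> # B) \<psi> \<in> T \<Longrightarrow> Seq \<Gamma> (A @ \<phi>' # B) \<psi> \<in> T"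
  using rule_Cut[of \<Gamma> "[\<phi>']" \<phi> A B \<psi>] by (simp add: fm_eqv_def)

lemma Seq_cong_antecedent:
  "list_all2 (fm_eqv \<Gamma>) \<Phi> \<Phi>' \<Longrightarrow> Seq \<Gamma> (A @ \<Phi>) \<psi> \<in> T \<Longrightarrow> Seq \<Gamma> (A @ \<Phi>') \<psi> \<in> T"
proof (induction arbitrary: A rule: list_all2_induct)
  case (Cons \<phi> \<Phi> \<phi>' \<Phi>')
  then show ?case
    using Cons.IH[of "A @ [\<phi>']"] Seq_replace[of \<Gamma> \<phi> \<phi>' A \<Phi> \<psi>] by simp
qed

lemma Seq_cong:
  assumes "list_all2 (fm_eqv \<Gamma>) \<Phi> \<Phi>'" "fm_eqv \<Gamma> \<psi> \<psi>'"
  shows "Seq \<Gamma> \<Phi> \<psi> \<in> T \<longleftrightarrow> Seq \<Gamma> \<Phi>' \<psi>' \<in> T"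
proof -
  have 1: "Seq \<Gamma> \<Phi> \<psi> \<in> T \<longleftrightarrow> Seq \<Gamma> \<Phi> \<psi>' \<in> T"
    using assms(2) by (auto simp: fm_eqv_def intro: Seq_trans)
  have "list_all2 (fm_eqv \<Gamma>) \<Phi>' \<Phi>"
    using assms(1) by (auto simp: list_all2_conv_all_nth fm_eqv_sym)
  with 1 show ?thesis
    using Seq_cong_antecedent[of \<Gamma> \<Phi> \<Phi>' "[]"] Seq_cong_antecedent[of \<Gamma> \<Phi>' \<Phi> "[]"] assms(1)
    by auto
qed

lemma Seq_tensor_iff:
  "Seq \<Gamma> (A @ Conn (tensor_c L) [\<alpha>, \<beta>] # B) \<theta> \<in> T \<longleftrightarrow> Seq \<Gamma> (A @ \<alpha> # \<beta> # B) \<theta> \<in> T"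
  using rule_Tensor1[of \<Gamma> A \<alpha> \<beta> B \<theta>] rule_Tensor2[of \<Gamma> A \<alpha> \<beta> B \<theta>] by auto

lemma Seq_unit_iff: "Seq \<Gamma> (A @ Conn (unit_c L) [] # B) \<theta> \<in> T \<longleftrightarrow> Seq \<Gamma> (A @ B) \<theta> \<in> T"
  using rule_Unit1[of \<Gamma> A B \<theta>] rule_Unit2[of \<Gamma> A B \<theta>] by auto

text \<open>The surrounding lists are arbitrary because the induction moves the head of
  \<open>\<Phi>\<close> into \<open>A\<close>. The empty \<open>\<Phi>\<close> is the reflection
  rule for the unit.\<close>

lemma Seq_tensors_iff:
  "Seq \<Gamma> (A @ tensors L \<Phi> # B) \<theta> \<in> T \<longleftrightarrow> Seq \<Gamma> (A @ \<Phi> @ B) \<theta> \<in> T"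
proof (induction \<Phi> arbitrary: A rule: induct_list012)
  case (3 \<phi> \<psi> \<Phi>)
  then show ?case using 3(2)[of "A @ [\<phi>]"] by (simp add: Seq_tensor_iff)
qed (simp_all add: Seq_unit_iff)

lemmas Seq_tensor_iffs =
  Seq_tensor_iff[of _ "[]", simplified] Seq_tensor_iff[of _ "[_]", simplified]
  Seq_unit_iff[of _ "[]", simplified] Seq_unit_iff[of _ "[_]", simplified]
  Seq_tensors_iff[of _ "[]", simplified] Seq_tensors_iff[of _ "[_]", simplified]

lemma wf_tensors: "wf_fm L Sg \<Gamma> (tensors L \<Phi>) \<longleftrightarrow> (\<forall>\<phi>\<in>set \<Phi>. wf_fm L Sg \<Gamma> \<phi>)"
  by (induction \<Phi> rule: induct_list012) auto

text \<open>The right-nested tensor of an append is not literally the tensor of the two parts, and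
  an empty part would even leave a unit behind. As antecedents, however, both sides flatten to the
  same list.\<close>

lemma tensors_append_eqv:
  assumes "wf_ctx Sg \<Gamma>" "\<forall>\<phi>\<in>set (\<Phi> @ \<Psi>). wf_fm L Sg \<Gamma> \<phi>"
  shows "fm_eqv \<Gamma> (tensors L (\<Phi> @ \<Psi>)) (Conn (tensor_c L) [tensors L \<Phi>, tensors L \<Psi>])"
proof (rule fm_eqvI)
  fix \<theta>
  show "Seq \<Gamma> [tensors L (\<Phi> @ \<Psi>)] \<theta> \<in> T \<longleftrightarrow>
    Seq \<Gamma> [Conn (tensor_c L) [tensors L \<Phi>, tensors L \<Psi>]] \<theta> \<in> T"
    using Seq_tensors_iff[of \<Gamma> \<Phi> \<Psi> "[]" \<theta>] by (simp add: Seq_tensor_iffs)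
qed (use assms in \<open>auto simp: wf_tensors\<close>)

lemma fm_eqv_Conn:
  "wf_ctx Sg \<Gamma> \<Longrightarrow> list_all2 (fm_eqv \<Gamma>) \<phi>s \<psi>s \<Longrightarrow> length \<phi>s = arity L k \<Longrightarrow>
   fm_eqv \<Gamma> (Conn k \<phi>s) (Conn k \<psi>s)"
  unfolding fm_eqv_def[of \<Gamma> "Conn k \<phi>s"]
  by (auto simp: list_all2_conv_all_nth fm_eqv_def intro!: rule_Conn_Cong)

lemma fm_eqv_Quant:
  "fm_eqv (\<Gamma> @ [\<sigma>]) \<phi> \<psi> \<Longrightarrow> fm_eqv \<Gamma> (Quant q \<sigma> \<phi>) (Quant q \<sigma> \<psi>)"
  by (auto simp: fm_eqv_def intro!: rule_Quant_Con)

lemma fm_eqv_foldr_Quant: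
  "fm_eqv (\<Gamma> @ \<Delta>) \<phi> \<psi> \<Longrightarrow> fm_eqv \<Gamma> (foldr (Quant q) \<Delta> \<phi>) (foldr (Quant q) \<Delta> \<psi>)"
  by (induction \<Delta> arbitrary: \<Gamma>) (auto intro!: fm_eqv_Quant)

lemma fm_eqv_fsub:
  assumes "fm_eqv \<Gamma> \<phi> \<psi>" "tms_eqv \<Delta> \<Gamma> ts us" "m = length \<Delta>"
  shows "fm_eqv \<Delta> (fsub m ts \<phi>) (fsub m us \<psi>)"
  using assms Seq_subst_eqv[of \<Gamma> "[\<phi>]" \<psi> \<Delta> ts us] Seq_subst_eqv[of \<Gamma> "[\<psi>]" \<phi> \<Delta> us ts]
  by (simp add: fm_eqv_def tms_eqv_sym)


section \<open>Computing in the classifying prop-category\<close>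

abbreviation C :: "('s, 'f, 'r, 'k) class_cat" where
  "C \<equiv> classifying L Sg T"

abbreviation mor :: "'s list \<Rightarrow> 's list \<Rightarrow> 'f tm list \<Rightarrow> bool" where
  "mor \<Gamma> \<Delta> ts \<equiv> wf_ctx Sg \<Gamma> \<and> wf_ctx Sg \<Delta> \<and> list_all2 (has_sort Sg \<Gamma>) ts \<Delta>"

abbreviation form :: "'s list \<Rightarrow> ('s, 'f, 'r, 'k) fm \<Rightarrow> bool" where
  "form \<Gamma> \<phi> \<equiv> wf_ctx Sg \<Gamma> \<and> wf_fm L Sg \<Gamma> \<phi>"

lemma fst_m_class [simp]:
  "fst (m_class T \<Gamma> \<Delta> ts) = \<Gamma>" "fst (snd (m_class T \<Gamma> \<Delta> ts)) = \<Delta>"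
  by (simp_all add: m_class_def)

text \<open>\<open>SOME\<close> returns an arbitrary member of the class, so provable equality with
  the given list is all that is known about it. The operations below are therefore evaluated by
  means of congruence under substitution.\<close>

lemma m_rep_eqv: "mor \<Gamma> \<Delta> ts \<Longrightarrow> tms_eqv \<Gamma> \<Delta> ts (m_rep (m_class T \<Gamma> \<Delta> ts))"
  unfolding m_rep_def
  by (rule someI2[of _ ts])
    (auto simp: m_class_def tms_eqv_def list_all2_conv_all_nth intro: rule_Refl)

lemma m_class_eqI: "tms_eqv \<Gamma> \<Delta> ts us \<Longrightarrow> m_class T \<Gamma> \<Delta> ts = m_class T \<Gamma> \<Delta> us"
  unfolding m_class_def tms_eqv_def by (auto; meson rule_Sym rule_Trans)

lemma m_class_eq_iff:
  assumes "mor \<Gamma> \<Delta> ts" "mor \<Gamma> \<Delta> us"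
  shows "m_class T \<Gamma> \<Delta> ts = m_class T \<Gamma> \<Delta> us \<longleftrightarrow> tms_eqv \<Gamma> \<Delta> ts us"
proof
  show "m_class T \<Gamma> \<Delta> ts = m_class T \<Gamma> \<Delta> us \<Longrightarrow> tms_eqv \<Gamma> \<Delta> ts us"
    using m_rep_eqv[OF assms(1)] m_rep_eqv[OF assms(2)]
    by (metis tms_eqv_sym tms_eqv_trans)
next
  assume "tms_eqv \<Gamma> \<Delta> ts us"
  then show "m_class T \<Gamma> \<Delta> ts = m_class T \<Gamma> \<Delta> us" by (rule m_class_eqI)
qed

lemma p_rep_eqv: "form \<Gamma> \<phi> \<Longrightarrow> fm_eqv \<Gamma> \<phi> (p_rep (p_class T \<Gamma> \<phi>))"
  unfolding p_rep_def by (rule someI2[of _ \<phi>]) (auto simp: p_class_def fm_eqv_def rule_Ax)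

lemma p_class_eqI: "fm_eqv \<Gamma> \<phi> \<psi> \<Longrightarrow> p_class T \<Gamma> \<phi> = p_class T \<Gamma> \<psi>"
  unfolding p_class_def fm_eqv_def by (auto intro: Seq_trans)

section \<open>The operations evaluated on arbitrary representatives\<close>

lemma C_obj: "\<Gamma> \<in> obj C \<longleftrightarrow> wf_ctx Sg \<Gamma>"
  by (simp add: classifying_def)

lemma C_hom: "f \<in> hom C \<Gamma> \<Delta> \<longleftrightarrow> (\<exists>ts. f = m_class T \<Gamma> \<Delta> ts \<and> mor \<Gamma> \<Delta> ts)"
  by (auto simp: hom_def classifying_def)

lemma C_arr: "f \<in> arr C \<longleftrightarrow> (\<exists>\<Gamma> \<Delta> ts. f = m_class T \<Gamma> \<Delta> ts \<and> mor \<Gamma> \<Delta> ts)"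
  by (auto simp: classifying_def)

lemma C_dom [simp]: "dom_of C (m_class T \<Gamma> \<Delta> ts) = \<Gamma>"
  and C_cod [simp]: "cod_of C (m_class T \<Gamma> \<Delta> ts) = \<Delta>"
  by (simp_all add: classifying_def)

lemma C_props: "p \<in> props C \<Gamma> \<longleftrightarrow> (\<exists>\<phi>. p = p_class T \<Gamma> \<phi> \<and> wf_fm L Sg \<Gamma> \<phi>)"
  by (auto simp: classifying_def)

lemma C_ident: "ident C \<Gamma> = m_class T \<Gamma> \<Gamma> (vars 0 (length \<Gamma>))"
  by (simp add: classifying_def)

lemma C_prd [simp]: "prd C \<Gamma>s = concat \<Gamma>s"
  by (simp add: classifying_def)

lemma C_prj: "prj C \<Gamma>s i = m_class T (concat \<Gamma>s) (\<Gamma>s ! i)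
    (vars (length (concat (take i \<Gamma>s))) (length (concat (take (Suc i) \<Gamma>s))))"
  by (simp add: classifying_def)

lemma C_cmp:
  assumes "mor \<Gamma> \<Delta> ts" "mor \<Delta> \<Theta> us"
  shows "cmp C (m_class T \<Delta> \<Theta> us) (m_class T \<Gamma> \<Delta> ts) = m_class T \<Gamma> \<Theta> (map (tsub ts) us)"
  using tms_eqv_tsub[OF m_rep_eqv[OF assms(2)] m_rep_eqv[OF assms(1)]]
  by (simp add: classifying_def m_class_eqI[OF tms_eqv_sym])

lemma mor_concat:
  "wf_ctx Sg \<Gamma> \<Longrightarrow> list_all2 (\<lambda>ts \<Delta>. mor \<Gamma> \<Delta> ts) tss \<Delta>s \<Longrightarrow> mor \<Gamma> (concat \<Delta>s) (concat tss)"
  by (rotate_tac, induction rule: list_all2_induct) (auto intro: list_all2_appendI)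

lemma C_tup:
  assumes "wf_ctx Sg \<Gamma>" "list_all2 (\<lambda>ts \<Delta>. mor \<Gamma> \<Delta> ts) tss \<Delta>s"
  shows "tup C \<Gamma> (map2 (m_class T \<Gamma>) \<Delta>s tss) = m_class T \<Gamma> (concat \<Delta>s) (concat tss)"
proof -
  have *: "concat (map (\<lambda>f. fst (snd f)) (map2 (m_class T \<Gamma>) \<Delta>s tss)) = concat \<Delta>s \<and>
    tms_eqv \<Gamma> (concat \<Delta>s) (concat tss) (concat (map m_rep (map2 (m_class T \<Gamma>) \<Delta>s tss)))"
    using assms(2)
  proof (induction rule: list_all2_induct)
    case (Cons ts tss \<Delta> \<Delta>s)
    then have "tms_eqv \<Gamma> \<Delta> ts (m_rep (m_class T \<Gamma> \<Delta> ts))" using m_rep_eqv by blast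
    with Cons show ?case
      by (simp, subst tms_eqv_append) (auto simp: tms_eqv_def)
  qed (simp add: assms(1))
  have "tup C \<Gamma> (map2 (m_class T \<Gamma>) \<Delta>s tss) =
    m_class T \<Gamma> (concat \<Delta>s) (concat (map m_rep (map2 (m_class T \<Gamma>) \<Delta>s tss)))"
    using * by (simp add: classifying_def)
  also have "\<dots> = m_class T \<Gamma> (concat \<Delta>s) (concat tss)"
    using * by (simp add: m_class_eqI[OF tms_eqv_sym])
  finally show ?thesis .
qed

lemma C_tup2:
  assumes "mor \<Gamma> \<Delta> ts" "mor \<Gamma> \<Theta> us"
  shows "tup C \<Gamma> [m_class T \<Gamma> \<Delta> ts, m_class T \<Gamma> \<Theta> us] = m_class T \<Gamma> (\<Delta> @ \<Theta>) (ts @ us)"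
  using C_tup[of \<Gamma> "[ts, us]" "[\<Delta>, \<Theta>]"] assms by simp

lemma C_ple:
  assumes "form \<Gamma> \<phi>" "form \<Gamma> \<psi>"
  shows "ple C \<Gamma> (p_class T \<Gamma> \<phi>) (p_class T \<Gamma> \<psi>) \<longleftrightarrow> Seq \<Gamma> [\<phi>] \<psi> \<in> T"
  using Seq_cong[of \<Gamma> "[\<phi>]" "[p_rep (p_class T \<Gamma> \<phi>)]", OF _ p_rep_eqv[OF assms(2)]]
    p_rep_eqv[OF assms(1)]
  by (simp add: classifying_def)

lemma C_pmap:
  assumes "mor \<Gamma> \<Delta> ts" "wf_fm L Sg \<Delta> \<phi>"
  shows "pmap C (m_class T \<Gamma> \<Delta> ts) (p_class T \<Delta> \<phi>) = p_class T \<Gamma> (fsub (length \<Gamma>) ts \<phi>)"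
proof -
  have "fm_eqv \<Delta> \<phi> (p_rep (p_class T \<Delta> \<phi>))" using assms by (intro p_rep_eqv) simp
  from fm_eqv_fsub[OF this m_rep_eqv[OF assms(1)] refl]
  show ?thesis by (simp add: classifying_def p_class_eqI[OF fm_eqv_sym])
qed

lemma C_pconn:
  assumes "wf_ctx Sg \<Gamma>" "\<forall>\<phi>\<in>set \<phi>s. wf_fm L Sg \<Gamma> \<phi>" "length \<phi>s = arity L k"
  shows "pconn C \<Gamma> k (map (p_class T \<Gamma>) \<phi>s) = p_class T \<Gamma> (Conn k \<phi>s)"
proof -
  have "list_all2 (fm_eqv \<Gamma>) \<phi>s (map (\<lambda>\<phi>. p_rep (p_class T \<Gamma> \<phi>)) \<phi>s)"
    using assms by (auto simp: list_all2_conv_all_nth intro: p_rep_eqv)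
  from fm_eqv_Conn[OF assms(1) this assms(3)]
  show ?thesis by (simp add: classifying_def comp_def p_class_eqI[OF fm_eqv_sym])
qed

lemma C_pquant:
  assumes "form (\<Gamma> @ \<Delta>) \<phi>"
  shows "pquant C q \<Gamma> \<Delta> (p_class T (\<Gamma> @ \<Delta>) \<phi>) = p_class T \<Gamma> (foldr (Quant q) \<Delta> \<phi>)"
  using fm_eqv_foldr_Quant[OF p_rep_eqv[OF assms], of q]
  by (simp add: classifying_def p_class_eqI[OF fm_eqv_sym])

end

text \<open>The equations behind \<open>peq\<close>, with arbitrary terms in place of the two lists
  of variables. They are kept as a list because antecedents without exchange have to treat them one
  at a time and in order; \<open>tensors\<close> joins them where a single formula is
  required.\<close>

definition eqs :: "'s list \<Rightarrow> 'f tm list \<Rightarrow> 'f tm list \<Rightarrow> ('s, 'f, 'r, 'k) fm list" where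
  "eqs \<Delta> ts us = map (\<lambda>(\<sigma>, t, u). Equal \<sigma> t u) (zip \<Delta> (zip ts us))"

lemma eqs_Nil [simp]: "eqs [] ts us = []"
  and eqs_Cons [simp]: "eqs (\<sigma> # \<Delta>) (t # ts) (u # us) = Equal \<sigma> t u # eqs \<Delta> ts us"
  by (simp_all add: eqs_def)

lemma eqs_append: "length ts = length \<Delta> \<Longrightarrow> length us = length \<Delta> \<Longrightarrow>
  eqs (\<Delta> @ \<Delta>') (ts @ ts') (us @ us') = eqs \<Delta> ts us @ eqs \<Delta>' ts' us'"
  by (simp add: eqs_def)

lemma map_fsub_eqs: "map (fsub m vs) (eqs \<Delta> ts us) = eqs \<Delta> (map (tsub vs) ts) (map (tsub vs) us)"
  by (auto simp: eqs_def zip_map1 zip_map2)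

lemma wf_eqs:
  "wf_ctx Sg \<Delta> \<Longrightarrow> list_all2 (has_sort Sg \<Gamma>) ts \<Delta> \<Longrightarrow> list_all2 (has_sort Sg \<Gamma>) us \<Delta> \<Longrightarrow>
   \<forall>\<phi>\<in>set (eqs \<Delta> ts us). wf_fm L Sg \<Gamma> \<phi>"
  by (auto simp: eqs_def in_set_zip list_all2_conv_all_nth wf_ctx_def subset_iff)

context closed_theory
begin

lemma C_peq: "peq C \<Gamma> =
    p_class T (\<Gamma> @ \<Gamma>) (tensors L (eqs \<Gamma> (vars 0 (length \<Gamma>)) (vars (length \<Gamma>) (2 * length \<Gamma>))))"
proof -
  have "map (\<lambda>i. Equal (\<Gamma> ! i) (Var i) (Var (length \<Gamma> + i))) [0..<length \<Gamma>] =
    (eqs \<Gamma> (vars 0 (length \<Gamma>)) (vars (length \<Gamma>) (2 * length \<Gamma>)) :: ('s, 'f, 'r, 'k) fm list)"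
    by (rule nth_equalityI) (auto simp: eqs_def)
  then show ?thesis by (simp add: classifying_def)
qed

section \<open>Category axioms, finite products and the poset-valued functor\<close>

lemma C_is_category: "is_category C"
  unfolding is_category_def
proof (intro conjI)
  show "\<forall>f\<in>arr C. dom_of C f \<in> obj C \<and> cod_of C f \<in> obj C"
    by (auto simp: C_arr C_obj)
  show "\<forall>b\<in>obj C. ident C b \<in> hom C b b"
    by (auto simp: C_obj C_ident C_hom)
  show "\<forall>b c d. \<forall>f\<in>hom C b c. \<forall>g\<in>hom C c d. cmp C g f \<in> hom C b d"
    by (force simp: C_hom C_cmp intro: list_sort_tsub)
  show "\<forall>b c. \<forall>f\<in>hom C b c. cmp C f (ident C b) = f \<and> cmp C (ident C c) f = f"
  proof (intro allI ballI)
    fix b c f assume "f \<in> hom C b c"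
    then obtain ts where f: "f = m_class T b c ts" and m: "mor b c ts" by (auto simp: C_hom)
    have "map (tsub (vars 0 (length b))) ts = ts"
      using m by (intro map_tsub_ident list_sort_scoped) auto
    moreover have "length ts = length c" using m by (auto dest: list_all2_lengthD)
    then have "map (tsub ts) (vars 0 (length c)) = ts" by (simp add: map_tsub_vars_slice)
    ultimately show "cmp C f (ident C b) = f \<and> cmp C (ident C c) f = f"
      using m by (simp add: f C_ident C_cmp)
  qed
  show "\<forall>a b c d. \<forall>f\<in>hom C a b. \<forall>g\<in>hom C b c. \<forall>h\<in>hom C c d.
      cmp C h (cmp C g f) = cmp C (cmp C h g) f"
  proof (intro allI ballI)
    fix a b c d f g h assume "f \<in> hom C a b" "g \<in> hom C b c" "h \<in> hom C c d"
    then obtain ts us vs where f: "f = m_class T a b ts" and g: "g = m_class T b c us"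
      and h: "h = m_class T c d vs" and m: "mor a b ts" "mor b c us" "mor c d vs"
      by (auto simp: C_hom)
    have m': "mor a c (map (tsub ts) us)" "mor b d (map (tsub us) vs)"
      using m by (auto intro: list_sort_tsub)
    have "tsub (map (tsub ts) us) v = tsub ts (tsub us v)" if "v \<in> set vs" for v
      using m that list_sort_scoped[of Sg c vs d] list_all2_lengthD[of _ us c]
      by (auto simp: tsub_tsub)
    with m m' show "cmp C h (cmp C g f) = cmp C (cmp C h g) f"
      by (simp add: f g h C_cmp comp_def cong: map_cong)
  qed
qed

lemma mor_slice:
  assumes "set \<Gamma>s \<subseteq> obj C" "i < length \<Gamma>s"
  shows "mor (concat \<Gamma>s) (\<Gamma>s ! i)
    (vars (length (concat (take i \<Gamma>s))) (length (concat (take (Suc i) \<Gamma>s))))"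
  using assms list_sort_slice[of i \<Gamma>s Sg] by (auto simp: C_obj subset_eq)

lemma C_prj_cmp:
  assumes "set \<Delta>s \<subseteq> obj C" "i < length \<Delta>s" "wf_ctx Sg \<Gamma>"
    and "list_all2 (\<lambda>ts \<Delta>. mor \<Gamma> \<Delta> ts) tss \<Delta>s"
  shows "cmp C (prj C \<Delta>s i) (m_class T \<Gamma> (concat \<Delta>s) (concat tss)) = m_class T \<Gamma> (\<Delta>s ! i) (tss ! i)"
proof -
  have "list_all2 (\<lambda>ts \<Delta>. length ts = length \<Delta>) tss \<Delta>s"
    using assms(4) by (rule list_all2_mono) (auto dest: list_all2_lengthD)
  note slice = map_tsub_slice[OF this assms(2)]
  show ?thesis
    unfolding C_prj by (subst C_cmp[OF mor_concat[OF assms(3,4)] mor_slice[OF assms(1,2)]])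
      (simp only: slice)
qed

lemma tms_eqv_concat:
  "wf_ctx Sg \<Gamma> \<Longrightarrow> length tss = length \<Delta>s \<Longrightarrow> length uss = length \<Delta>s \<Longrightarrow>
   \<forall>i<length \<Delta>s. tms_eqv \<Gamma> (\<Delta>s ! i) (tss ! i) (uss ! i) \<Longrightarrow>
   tms_eqv \<Gamma> (concat \<Delta>s) (concat tss) (concat uss)"
proof (induction \<Delta>s arbitrary: tss uss)
  case (Cons \<Delta> \<Delta>s)
  obtain ts tss' us uss' where [simp]: "tss = ts # tss'" "uss = us # uss'"
    using Cons.prems by (auto simp: length_Suc_conv)
  have "tms_eqv \<Gamma> \<Delta> ts us" using Cons.prems(4) by (auto dest: spec[of _ 0])
  moreover have "tms_eqv \<Gamma> (concat \<Delta>s) (concat tss') (concat uss')"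
    using Cons.prems by (intro Cons.IH) auto
  ultimately show ?case by (simp add: tms_eqv_append) (subst tms_eqv_append; simp add: tms_eqv_def)
qed simp

lemma hom_list_classes:
  "list_all2 (\<lambda>f \<Delta>. f \<in> hom C \<Gamma> \<Delta>) fs \<Delta>s \<Longrightarrow>
   \<exists>tss. list_all2 (\<lambda>ts \<Delta>. mor \<Gamma> \<Delta> ts) tss \<Delta>s \<and> fs = map2 (m_class T \<Gamma>) \<Delta>s tss"
proof (induction rule: list_all2_induct)
  case (Cons f fs \<Delta> \<Delta>s)
  then obtain ts tss where "f = m_class T \<Gamma> \<Delta> ts" "mor \<Gamma> \<Delta> ts"
    "list_all2 (\<lambda>ts \<Delta>. mor \<Gamma> \<Delta> ts) tss \<Delta>s" "fs = map2 (m_class T \<Gamma>) \<Delta>s tss"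
    by (auto simp: C_hom)
  then show ?case by (intro exI[of _ "ts # tss"]) simp
qed simp

lemma C_has_products: "has_products C"
  unfolding has_products_def
proof (intro allI impI conjI ballI)
  fix \<Delta>s assume D: "set \<Delta>s \<subseteq> obj C"
  then show "prd C \<Delta>s \<in> obj C" by (auto simp: C_obj)
  show "prj C \<Delta>s i \<in> hom C (prd C \<Delta>s) (\<Delta>s ! i)" if "i < length \<Delta>s" for i
    using mor_slice[OF D that] by (simp only: C_prj C_hom C_prd) blast
  fix \<Gamma> fs assume "\<Gamma> \<in> obj C" and fs: "list_all2 (\<lambda>f \<Delta>. f \<in> hom C \<Gamma> \<Delta>) fs \<Delta>s"
  then have G: "wf_ctx Sg \<Gamma>" by (simp add: C_obj)
  obtain tss where m: "list_all2 (\<lambda>ts \<Delta>. mor \<Gamma> \<Delta> ts) tss \<Delta>s"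
    and fs: "fs = map2 (m_class T \<Gamma>) \<Delta>s tss"
    using hom_list_classes[OF fs] by blast
  note tup = C_tup[OF G m, folded fs]
  note mc = mor_concat[OF G m]
  have len: "length tss = length \<Delta>s" using m by (rule list_all2_lengthD)
  show "tup C \<Gamma> fs \<in> hom C \<Gamma> (prd C \<Delta>s)"
    using mc by (auto simp: tup C_hom)
  have nth: "fs ! i = m_class T \<Gamma> (\<Delta>s ! i) (tss ! i)" if "i < length \<Delta>s" for i
    using that len by (simp add: fs)
  show "cmp C (prj C \<Delta>s i) (tup C \<Gamma> fs) = fs ! i" if "i < length \<Delta>s" for i
    by (simp only: tup C_prj_cmp[OF D that G m] nth[OF that])
  fix h assume "h \<in> hom C \<Gamma> (prd C \<Delta>s)" and h: "\<forall>i<length \<Delta>s. cmp C (prj C \<Delta>s i) h = fs ! i"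
  then obtain us where us: "h = m_class T \<Gamma> (concat \<Delta>s) us" "mor \<Gamma> (concat \<Delta>s) us"
    by (auto simp: C_hom)
  \<comment> \<open>The list is cut along the codomain. Its \<open>i\<close>-th piece represents the
    composite of \<open>h\<close> with the \<open>i\<close>-th projection, so the assumption on
    \<open>h\<close> identifies it with \<open>tss ! i\<close> up to provable equality.\<close>
  then obtain uss where uss: "us = concat uss" "list_all2 (\<lambda>us \<Delta>. length us = length \<Delta>) uss \<Delta>s"
    using concat_pieces[of us \<Delta>s] by (auto dest: list_all2_lengthD)
  have "tms_eqv \<Gamma> (\<Delta>s ! i) (uss ! i) (tss ! i)" if i: "i < length \<Delta>s" for i
  proof -
    note ms = mor_slice[OF D i]
    have eq: "m_class T \<Gamma> (\<Delta>s ! i) (uss ! i) = m_class T \<Gamma> (\<Delta>s ! i) (tss ! i)"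
      using h[rule_format, OF i]
      by (simp only: C_prj us(1) C_cmp[OF us(2) ms] nth[OF i] map_tsub_slice[OF uss(2) i, folded uss(1)])
    have "mor \<Gamma> (\<Delta>s ! i) (uss ! i)"
      using ms us(2) list_sort_tsub[of Sg "concat \<Delta>s" _ "\<Delta>s ! i" \<Gamma> us]
      unfolding map_tsub_slice[OF uss(2) i, symmetric] uss(1) by blast
    moreover have "mor \<Gamma> (\<Delta>s ! i) (tss ! i)"
      using m i by (auto simp: list_all2_conv_all_nth)
    ultimately show ?thesis using eq by (simp add: m_class_eq_iff)
  qed
  then have "tms_eqv \<Gamma> (concat \<Delta>s) (concat uss) (concat tss)"
    using G len uss(2) by (intro tms_eqv_concat) (auto dest: list_all2_lengthD)
  then show "h = tup C \<Gamma> fs"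
    by (simp only: tup us uss) (rule m_class_eqI)
qed

lemma C_pmap_ident:
  "wf_ctx Sg \<Gamma> \<Longrightarrow> wf_fm L Sg \<Gamma> \<phi> \<Longrightarrow> pmap C (ident C \<Gamma>) (p_class T \<Gamma> \<phi>) = p_class T \<Gamma> \<phi>"
  by (simp add: C_ident C_pmap fsub_ident_wf)

lemma C_is_pos_functor: "is_pos_functor C"
  unfolding is_pos_functor_def
proof (intro conjI)
  show "\<forall>c\<in>obj C. (\<forall>p\<in>props C c. ple C c p p) \<and>
      (\<forall>p\<in>props C c. \<forall>q\<in>props C c. ple C c p q \<longrightarrow> ple C c q p \<longrightarrow> p = q) \<and>
      (\<forall>p\<in>props C c. \<forall>q\<in>props C c. \<forall>r\<in>props C c. ple C c p q \<longrightarrow> ple C c q r \<longrightarrow> ple C c p r)"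
  proof (intro ballI conjI impI)
    fix c p q assume "c \<in> obj C" "p \<in> props C c" "q \<in> props C c" and le: "ple C c p q"
    then obtain \<phi> \<psi> where c: "wf_ctx Sg c" and p: "p = p_class T c \<phi>" "wf_fm L Sg c \<phi>"
      and q: "q = p_class T c \<psi>" "wf_fm L Sg c \<psi>"
      by (auto simp: C_obj C_props)
    show "p = q" if "ple C c q p"
    proof -
      have "fm_eqv c \<phi> \<psi>" using c p q le that by (simp add: C_ple fm_eqv_def)
      then show ?thesis unfolding p(1) q(1) by (rule p_class_eqI)
    qed
    fix r assume "r \<in> props C c" "ple C c q r"
    then show "ple C c p r" using c p q le by (auto simp: C_props C_ple intro: Seq_trans)
  qed (auto simp: C_obj C_props C_ple rule_Ax)
  show "\<forall>b c. \<forall>f\<in>hom C b c. (\<forall>p\<in>props C c. pmap C f p \<in> props C b) \<and>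
      (\<forall>p\<in>props C c. \<forall>q\<in>props C c. ple C c p q \<longrightarrow> ple C b (pmap C f p) (pmap C f q))"
  proof (intro allI ballI conjI impI)
    fix b c f p assume "f \<in> hom C b c" "p \<in> props C c"
    then obtain ts \<phi> where f: "f = m_class T b c ts" "mor b c ts"
      and p: "p = p_class T c \<phi>" "wf_fm L Sg c \<phi>"
      by (auto simp: C_hom C_props)
    have w: "wf_fm L Sg b (fsub (length b) ts \<phi>)" using f p by (auto intro: wf_fm_fsub)
    then show "pmap C f p \<in> props C b" using f p by (auto simp: C_pmap C_props)
    fix q assume "q \<in> props C c" and le: "ple C c p q"
    then obtain \<psi> where q: "q = p_class T c \<psi>" "wf_fm L Sg c \<psi>" by (auto simp: C_props)
    have w': "wf_fm L Sg b (fsub (length b) ts \<psi>)" using f q by (auto intro: wf_fm_fsub)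
    show "ple C b (pmap C f p) (pmap C f q)"
      using le f p q w w' Seq_subst[of c "[\<phi>]" \<psi> b ts] by (simp add: C_pmap C_ple)
  qed
  show "\<forall>c\<in>obj C. \<forall>p\<in>props C c. pmap C (ident C c) p = p"
    by (auto simp: C_obj C_props C_pmap_ident)
  show "\<forall>b c d. \<forall>f\<in>hom C b c. \<forall>g\<in>hom C c d. \<forall>p\<in>props C d.
      pmap C (cmp C g f) p = pmap C f (pmap C g p)"
  proof (intro allI ballI)
    fix b c d f g p assume "f \<in> hom C b c" "g \<in> hom C c d" "p \<in> props C d"
    then obtain ts us \<phi> where f: "f = m_class T b c ts" "mor b c ts"
      and g: "g = m_class T c d us" "mor c d us" and p: "p = p_class T d \<phi>" "wf_fm L Sg d \<phi>"
      by (auto simp: C_hom C_props)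
    have m: "mor b d (map (tsub ts) us)" "wf_fm L Sg c (fsub (length c) us \<phi>)"
      using f g p by (auto intro: list_sort_tsub wf_fm_fsub)
    have "fsub (length b) ts (fsub (length ts) us \<phi>) = fsub (length b) (map (tsub ts) us) \<phi>"
      using f(2) g(2) wf_fm_scoped[OF p(2)] list_sort_scoped[of Sg c us d]
      by (intro fsub_fsub) (auto dest: list_all2_lengthD)
    moreover have "length ts = length c" using f(2) by (auto dest: list_all2_lengthD)
    ultimately show "pmap C (cmp C g f) p = pmap C f (pmap C g p)"
      using f g p m by (simp add: C_cmp C_pmap)
  qed
qed


section \<open>The algebraic structure required by \<open>FA\<close>\<close>

lemma C_fst_p: "fst_p C b c = m_class T (b @ c) b (vars 0 (length b))"
  and C_snd_p: "snd_p C b c = m_class T (b @ c) c (vars (length b) (length b + length c))"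
  by (simp_all add: fst_p_def snd_p_def C_prj)

lemma mor_fst: "wf_ctx Sg b \<Longrightarrow> wf_ctx Sg c \<Longrightarrow> mor (b @ c) b (vars 0 (length b))"
  and mor_snd: "wf_ctx Sg b \<Longrightarrow> wf_ctx Sg c \<Longrightarrow> mor (b @ c) c (vars (length b) (length b + length c))"
  by (simp_all add: list_sort_weaken list_sort_vars[where A = b and B = "[]"])

lemma C_times_obj:
  assumes "mor b' b ts" "wf_ctx Sg c"
  shows "times_obj C (m_class T b' b ts) c =
    m_class T (b' @ c) (b @ c) (ts @ vars (length b') (length b' + length c))"
proof -
  have "map (tsub (vars 0 (length b'))) ts = ts"
    using assms by (intro map_tsub_ident list_sort_scoped) auto
  moreover have "mor (b' @ c) b' (vars 0 (length b'))"
    "mor (b' @ c) c (vars (length b') (length b' + length c))"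
    using assms mor_fst[of b' c] mor_snd[of b' c] by blast+
  ultimately show ?thesis
    using assms by (simp add: times_obj_def C_fst_p C_snd_p C_cmp C_tup2 list_sort_weaken)
qed

text \<open>Both bracketings of the triple product are the same context, and the associativity map
  merely lists its variables in order.\<close>

lemma C_assoc_p:
  assumes "wf_ctx Sg b" "wf_ctx Sg c" "wf_ctx Sg d"
  shows "assoc_p C b c d = ident C (b @ c @ d)"
proof -
  let ?b = "length b" and ?c = "length c" and ?d = "length d"
  have m: "mor (b @ c @ d) b (vars 0 ?b)" "mor (b @ c @ d) (c @ d) (vars ?b (?b + (?c + ?d)))"
      "mor (c @ d) c (vars 0 ?c)" "mor (c @ d) d (vars ?c (?c + ?d))"
    using assms mor_fst[of b "c @ d"] mor_snd[of b "c @ d"] mor_fst[of c d] mor_snd[of c d]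
    by simp_all
  have s: "map (tsub (vars ?b (?b + (?c + ?d)))) (vars 0 ?c) = vars ?b (?b + ?c)"
    "map (tsub (vars ?b (?b + (?c + ?d)))) (vars ?c (?c + ?d)) = vars (?b + ?c) (?b + (?c + ?d))"
    by (simp_all add: map_tsub_vars_slice add.assoc)
  have m': "mor (b @ c @ d) c (vars ?b (?b + ?c))" "mor (b @ c @ d) d (vars (?b + ?c) (?b + (?c + ?d)))"
    using assms by (auto intro: list_sort_vars[where A = b] list_sort_vars[where A = "b @ c"])
  have "mor (b @ c @ d) (b @ c) (vars 0 ?b @ vars ?b (?b + ?c))"
    using m(1) m'(1) by (auto intro: list_all2_appendI)
  with m m' show ?thesis
    unfolding assoc_p_def
    by (simp add: Let_def C_fst_p C_snd_p C_cmp[OF m(2,3)] C_cmp[OF m(2,4)] s C_tup2 C_ident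
        vars_append)
qed

lemma props_list:
  assumes "set ps \<subseteq> props C c"
  obtains \<phi>s where "ps = map (p_class T c) \<phi>s" "\<forall>\<phi>\<in>set \<phi>s. wf_fm L Sg c \<phi>"
proof -
  from assms have "\<exists>\<phi>s. ps = map (p_class T c) \<phi>s \<and> (\<forall>\<phi>\<in>set \<phi>s. wf_fm L Sg c \<phi>)"
  proof (induction ps)
    case (Cons p ps)
    then obtain \<phi> \<phi>s where "p = p_class T c \<phi>" "wf_fm L Sg c \<phi>"
      "ps = map (p_class T c) \<phi>s" "\<forall>\<phi>\<in>set \<phi>s. wf_fm L Sg c \<phi>"
      by (auto simp: C_props)
    then show ?case by (intro exI[of _ "\<phi> # \<phi>s"]) simp
  qed simp
  with that show ?thesis by blast
qed

lemma C_tensor: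
  "wf_ctx Sg c \<Longrightarrow> wf_fm L Sg c \<phi> \<Longrightarrow> wf_fm L Sg c \<psi> \<Longrightarrow>
   p_tensor L C c (p_class T c \<phi>) (p_class T c \<psi>) = p_class T c (Conn (tensor_c L) [\<phi>, \<psi>])"
  using C_pconn[of c "[\<phi>, \<psi>]" "tensor_c L"] by (simp add: p_tensor_def)

lemma C_unit: "wf_ctx Sg c \<Longrightarrow> p_unit L C c = p_class T c (Conn (unit_c L) [])"
  using C_pconn[of c "[]" "unit_c L"] by (simp add: p_unit_def)

text \<open>Moving a substitution below the block extends it by the fresh variables of
  \<open>c\<close>, which is precisely what \<open>times_obj\<close> does to
  \<open>f\<close>.\<close>

lemma C_quant_natural:
  assumes f: "f \<in> hom C b' b" and c: "c \<in> obj C" and p: "p \<in> props C (prd C [b, c])"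
  shows "pmap C f (pquant C q b c p) = pquant C q b' c (pmap C (times_obj C f c) p)"
proof -
  obtain ts \<phi> where f: "f = m_class T b' b ts" "mor b' b ts" and c: "wf_ctx Sg c"
    and p: "p = p_class T (b @ c) \<phi>" "wf_fm L Sg (b @ c) \<phi>"
    using assms by (auto simp: C_hom C_obj C_props)
  let ?us = "ts @ vars (length b') (length b' + length c)"
  have m: "mor (b' @ c) (b @ c) ?us"
    using f(2) c
    by (simp add: list_all2_appendI list_sort_weaken list_sort_vars[where A = b' and B = "[]"])
  then have "wf_fm L Sg (b' @ c) (fsub (length b' + length c) ?us \<phi>)"
    using p(2) by (auto intro: wf_fm_fsub)
  with f c p m show ?thesis
    by (simp add: C_pquant C_pmap C_times_obj fsub_foldr_Quant)
qed

lemma wf_peq: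
  assumes "wf_ctx Sg \<Gamma>"
  shows "wf_fm L Sg (\<Gamma> @ \<Gamma>)
    (tensors L (eqs \<Gamma> (vars 0 (length \<Gamma>)) (vars (length \<Gamma>) (2 * length \<Gamma>))))"
  unfolding wf_tensors using assms
  by (intro wf_eqs list_sort_vars[where A = "[]"] list_sort_vars[where A = \<Gamma> and B = "[]"]) auto

text \<open>This computes the interpretation of an equation at a sort that is interpreted by an
  arbitrary context, and also the two factors in the product law for \<open>Eq\<close>.\<close>

lemma C_pmap_peq:
  assumes "mor \<Gamma> \<Delta> ts" "mor \<Gamma> \<Delta> us"
  shows "pmap C (m_class T \<Gamma> (\<Delta> @ \<Delta>) (ts @ us)) (peq C \<Delta>) = p_class T \<Gamma> (tensors L (eqs \<Delta> ts us))"
proof -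
  have "length ts = length \<Delta>" "length us = length \<Delta>" using assms by (auto dest: list_all2_lengthD)
  then have "map (tsub (ts @ us)) (vars 0 (length \<Delta>)) = ts"
    "map (tsub (ts @ us)) (vars (length \<Delta>) (2 * length \<Delta>)) = us"
    by (simp_all add: map_tsub_vars_slice)
  moreover have "mor \<Gamma> (\<Delta> @ \<Delta>) (ts @ us)" using assms by (auto intro: list_all2_appendI)
  ultimately show ?thesis
    unfolding C_peq using assms wf_peq[of \<Delta>] by (simp add: C_pmap fsub_tensors map_fsub_eqs)
qed

text \<open>The equations of a concatenated context are an append, and the two reindexings select
  the equations of \<open>c\<close> and of \<open>d\<close>. Only the regrouping of the tensor is an
  equivalence instead of a literal equality.\<close>

lemma C_peq_prod:
  assumes c: "c \<in> obj C" and d: "d \<in> obj C"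
  defines "cd \<equiv> prd C [c, d]"
  defines "x \<equiv> prd C [cd, cd]"
  shows "peq C cd = p_tensor L C x
    (pmap C (tup C x [cmp C (fst_p C c d) (fst_p C cd cd), cmp C (fst_p C c d) (snd_p C cd cd)])
      (peq C c))
    (pmap C (tup C x [cmp C (snd_p C c d) (fst_p C cd cd), cmp C (snd_p C c d) (snd_p C cd cd)])
      (peq C d))"
proof -
  let ?c = "length c" and ?d = "length d" and ?x = "(c @ d) @ c @ d"
  let ?n = "?c + ?d"
  have wf: "wf_ctx Sg c" "wf_ctx Sg d" using c d by (simp_all add: C_obj)
  have m: "mor ?x (c @ d) (vars 0 ?n)" "mor ?x (c @ d) (vars ?n (?n + ?n))"
      "mor (c @ d) c (vars 0 ?c)" "mor (c @ d) d (vars ?c ?n)"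
    using wf mor_fst[of "c @ d" "c @ d"] mor_snd[of "c @ d" "c @ d"] mor_fst[of c d] mor_snd[of c d]
    by simp_all
  have s: "map (tsub (vars 0 ?n)) (vars 0 ?c) = vars 0 ?c"
    "map (tsub (vars ?n (?n + ?n))) (vars 0 ?c) = vars ?n (?n + ?c)"
    "map (tsub (vars 0 ?n)) (vars ?c ?n) = vars ?c ?n"
    "map (tsub (vars ?n (?n + ?n))) (vars ?c ?n) = vars (?n + ?c) (?n + ?n)"
    by (simp_all add: map_tsub_vars_slice)
  have v: "mor ?x c (vars 0 ?c)" "mor ?x c (vars ?n (?n + ?c))" "mor ?x d (vars ?c ?n)"
    "mor ?x d (vars (?n + ?c) (?n + ?n))"
    using m list_sort_tsub[of Sg "c @ d" "vars 0 ?c" c ?x "vars 0 ?n", unfolded s]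
      list_sort_tsub[of Sg "c @ d" "vars 0 ?c" c ?x "vars ?n (?n + ?n)", unfolded s]
      list_sort_tsub[of Sg "c @ d" "vars ?c ?n" d ?x "vars 0 ?n", unfolded s]
      list_sort_tsub[of Sg "c @ d" "vars ?c ?n" d ?x "vars ?n (?n + ?n)", unfolded s]
    by blast+
  have t: "tup C ?x [cmp C (fst_p C c d) (fst_p C (c @ d) (c @ d)),
      cmp C (fst_p C c d) (snd_p C (c @ d) (c @ d))] =
      m_class T ?x (c @ c) (vars 0 ?c @ vars ?n (?n + ?c))"
    "tup C ?x [cmp C (snd_p C c d) (fst_p C (c @ d) (c @ d)),
      cmp C (snd_p C c d) (snd_p C (c @ d) (c @ d))] =
      m_class T ?x (d @ d) (vars ?c ?n @ vars (?n + ?c) (?n + ?n))"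
    using v C_cmp[OF m(1,3)] C_cmp[OF m(2,3)] C_cmp[OF m(1,4)] C_cmp[OF m(2,4)]
    by (simp_all add: C_fst_p C_snd_p s C_tup2)
  let ?\<Phi> = "eqs c (vars 0 ?c) (vars ?n (?n + ?c)) :: ('s, 'f, 'r, 'k) fm list"
    and ?\<Psi> = "eqs d (vars ?c ?n) (vars (?n + ?c) (?n + ?n)) :: ('s, 'f, 'r, 'k) fm list"
  have w: "\<forall>\<phi>\<in>set (?\<Phi> @ ?\<Psi>). wf_fm L Sg ?x \<phi>"
    using v wf wf_eqs[of Sg c ?x "vars 0 ?c" "vars ?n (?n + ?c)" L]
      wf_eqs[of Sg d ?x "vars ?c ?n" "vars (?n + ?c) (?n + ?n)" L] by auto
  have "eqs (c @ d) (vars 0 ?n) (vars ?n (?n + ?n)) = ?\<Phi> @ ?\<Psi>"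
    using eqs_append[of "vars 0 ?c" c "vars ?n (?n + ?c)" d "vars ?c ?n" "vars (?n + ?c) (?n + ?n)"]
    by (simp add: vars_append)
  then have "peq C (c @ d) = p_class T ?x (tensors L (?\<Phi> @ ?\<Psi>))"
    by (simp only: C_peq length_append mult_2)
  also have "\<dots> = p_class T ?x (Conn (tensor_c L) [tensors L ?\<Phi>, tensors L ?\<Psi>])"
    by (rule p_class_eqI, rule tensors_append_eqv) (use wf w in auto)
  also have "\<dots> = p_tensor L C ?x (p_class T ?x (tensors L ?\<Phi>)) (p_class T ?x (tensors L ?\<Psi>))"
    using wf w by (intro C_tensor[symmetric]) (auto simp: wf_tensors)
  finally have "peq C (c @ d) =
    p_tensor L C ?x (p_class T ?x (tensors L ?\<Phi>)) (p_class T ?x (tensors L ?\<Psi>))" .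
  moreover have "cd = c @ d" "x = ?x" by (simp_all add: cd_def x_def)
  ultimately show ?thesis
    by (simp only: t C_pmap_peq[OF v(1,2)] C_pmap_peq[OF v(3,4)])
qed

text \<open>By the reflection rules for tensor and unit, both sides of each law unfold in the
  antecedent to the same list of formulas, hence have the same consequences.\<close>

lemma tensor_monoid_eqv:
  assumes "wf_ctx Sg \<Gamma>" "wf_fm L Sg \<Gamma> \<phi>" "wf_fm L Sg \<Gamma> \<psi>" "wf_fm L Sg \<Gamma> \<chi>"
  shows "fm_eqv \<Gamma> (Conn (tensor_c L) [Conn (unit_c L) [], \<phi>]) \<phi>"
    and "fm_eqv \<Gamma> (Conn (tensor_c L) [\<phi>, Conn (unit_c L) []]) \<phi>"
    and "fm_eqv \<Gamma> (Conn (tensor_c L) [Conn (tensor_c L) [\<phi>, \<psi>], \<chi>])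
      (Conn (tensor_c L) [\<phi>, Conn (tensor_c L) [\<psi>, \<chi>]])"
  by (rule fm_eqvI; use assms in \<open>simp add: Seq_tensor_iffs\<close>)+

lemma C_in_FA: "C \<in> FA L"
  unfolding FA_def mem_Collect_eq
proof (intro conjI)
  show "prop_category C"
    by (simp add: prop_category_def C_is_category C_has_products C_is_pos_functor)
  show "\<forall>c\<in>obj C. \<forall>k ps. set ps \<subseteq> props C c \<longrightarrow> length ps = arity L k \<longrightarrow>
      pconn C c k ps \<in> props C c"
    by (auto simp: C_obj elim!: props_list) (auto simp: C_pconn C_props)
  show "\<forall>b c. \<forall>f\<in>hom C b c. \<forall>k ps. set ps \<subseteq> props C c \<longrightarrow> length ps = arity L k \<longrightarrow>
      pmap C f (pconn C c k ps) = pconn C b k (map (pmap C f) ps)"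
  proof (intro allI ballI impI)
    fix b c f k ps
    assume "f \<in> hom C b c" and ps: "set ps \<subseteq> props C c" and k: "length ps = arity L k"
    then obtain ts where f: "f = m_class T b c ts" "mor b c ts" by (auto simp: C_hom)
    obtain \<phi>s where \<phi>s: "ps = map (p_class T c) \<phi>s" "\<forall>\<phi>\<in>set \<phi>s. wf_fm L Sg c \<phi>"
      using props_list[OF ps] .
    have "\<forall>\<phi>\<in>set \<phi>s. wf_fm L Sg b (fsub (length b) ts \<phi>)"
      using f \<phi>s by (auto intro: wf_fm_fsub)
    then have "p_class T b (Conn k (map (fsub (length b) ts) \<phi>s)) =
        pconn C b k (map (p_class T b) (map (fsub (length b) ts) \<phi>s))"
      using f k \<phi>s by (intro C_pconn[symmetric]) auto
    also have "map (p_class T b) (map (fsub (length b) ts) \<phi>s) = map (pmap C f) ps"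
      using f \<phi>s by (auto simp: C_pmap)
    finally show "pmap C f (pconn C c k ps) = pconn C b k (map (pmap C f) ps)"
      using f \<phi>s k by (simp add: C_pconn C_pmap)
  qed
  show "\<forall>c\<in>obj C. peq C c \<in> props C (prd C [c, c])"
  proof
    fix c assume "c \<in> obj C"
    then have "wf_ctx Sg c" by (simp add: C_obj)
    then show "peq C c \<in> props C (prd C [c, c])" unfolding C_peq using wf_peq by (auto simp: C_props)
  qed
  show "\<forall>q. \<forall>b\<in>obj C. \<forall>c\<in>obj C. \<forall>p\<in>props C (prd C [b, c]). pquant C q b c p \<in> props C b"
    by (auto simp: C_obj C_props C_pquant) (rule exI, rule conjI, rule refl, simp)
  show "\<forall>c\<in>obj C. \<forall>p\<in>props C c.
      p_tensor L C c (p_unit L C c) p = p \<and> p_tensor L C c p (p_unit L C c) = p"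
    by (auto simp: C_obj C_props C_tensor C_unit p_class_eqI[OF tensor_monoid_eqv(1)]
        p_class_eqI[OF tensor_monoid_eqv(2)])
  show "\<forall>c\<in>obj C. \<forall>p\<in>props C c. \<forall>q\<in>props C c. \<forall>r\<in>props C c.
      p_tensor L C c (p_tensor L C c p q) r = p_tensor L C c p (p_tensor L C c q r)"
    by (auto simp: C_obj C_props C_tensor p_class_eqI[OF tensor_monoid_eqv(3)])
  \<comment> \<open>The terminal object is the empty context: the projection becomes an identity and
    the block of quantifiers is empty.\<close>
  show "\<forall>q. \<forall>b\<in>obj C. \<forall>p\<in>props C b.
      pquant C q b (prd C []) (pmap C (fst_p C b (prd C [])) p) = p"
  proof (intro allI ballI)
    fix q b p assume "b \<in> obj C" "p \<in> props C b"
    then obtain \<phi> where "wf_ctx Sg b" "p = p_class T b \<phi>" "wf_fm L Sg b \<phi>"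
      by (auto simp: C_obj C_props)
    then show "pquant C q b (prd C []) (pmap C (fst_p C b (prd C [])) p) = p"
      using C_pquant[of b "[]" \<phi> q] by (simp add: C_fst_p C_pmap fsub_ident_wf)
  qed
  show "\<forall>q. \<forall>b\<in>obj C. \<forall>c\<in>obj C. \<forall>d\<in>obj C. \<forall>p\<in>props C (prd C [prd C [b, c], d]).
      pquant C q b (prd C [c, d]) (pmap C (assoc_p C b c d) p) =
      pquant C q b c (pquant C q (prd C [b, c]) d p)"
  proof (intro allI ballI)
    fix q b c d p assume "b \<in> obj C" "c \<in> obj C" "d \<in> obj C" "p \<in> props C (prd C [prd C [b, c], d])"
    then obtain \<phi> where wf: "wf_ctx Sg b" "wf_ctx Sg c" "wf_ctx Sg d"
      and p: "p = p_class T (b @ c @ d) \<phi>" "wf_fm L Sg (b @ c @ d) \<phi>"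
      by (auto simp: C_obj C_props)
    \<comment> \<open>With the associativity map out of the way, a block over \<open>c @ d\<close>
      is a block over \<open>c\<close> around a block over \<open>d\<close>.\<close>
    have "pmap C (assoc_p C b c d) p = p"
      using wf p by (simp add: C_assoc_p C_pmap_ident)
    then show "pquant C q b (prd C [c, d]) (pmap C (assoc_p C b c d) p) =
        pquant C q b c (pquant C q (prd C [b, c]) d p)"
      using wf p C_pquant[of "b @ c" d \<phi> q] by (simp add: C_pquant)
  qed
  show "peq C (prd C []) = p_unit L C (prd C [prd C [], prd C []])"
    by (simp add: C_peq C_unit)
  show "\<forall>q b b'. \<forall>f\<in>hom C b' b. \<forall>c\<in>obj C. \<forall>p\<in>props C (prd C [b, c]).
      pmap C f (pquant C q b c p) = pquant C q b' c (pmap C (times_obj C f c) p)"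
    by (intro allI ballI C_quant_natural)
  show "\<forall>c\<in>obj C. \<forall>d\<in>obj C. let cd = prd C [c, d]; x = prd C [cd, cd] in
        peq C cd = p_tensor L C x
          (pmap C (tup C x [cmp C (fst_p C c d) (fst_p C cd cd),
                            cmp C (fst_p C c d) (snd_p C cd cd)]) (peq C c))
          (pmap C (tup C x [cmp C (snd_p C c d) (fst_p C cd cd),
                            cmp C (snd_p C c d) (snd_p C cd cd)]) (peq C d))"
    unfolding Let_def by (intro ballI C_peq_prod)
qed

section \<open>Adjoint rules for lists of variables\<close>

lemma fsub_comp:
  assumes "wf_fm L Sg \<Gamma> \<phi>" "list_all2 (has_sort Sg \<Delta>) ts \<Gamma>" "length us = length \<Delta>" "l = length \<Delta>"
  shows "fsub m us (fsub l ts \<phi>) = fsub m (map (tsub us) ts) \<phi>"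
  using fsub_fsub[of ts \<phi> us m] wf_fm_scoped[OF assms(1)] list_sort_scoped[OF assms(2)] assms
  by (simp add: list_all2_lengthD)

text \<open>The axiom for the equation between two variables, read backwards through
  \<open>=\<close>-Adj, gives reflexivity for one variable; substitution extends it to
  terms.\<close>

lemma Seq_equal_refl:
  assumes "eq_adj X" "wf_ctx Sg \<Gamma>" "\<sigma> \<in> sorts Sg" "has_sort Sg \<Gamma> t \<sigma>"
  shows "Seq \<Gamma> [] (Equal \<sigma> t t) \<in> T"
proof -
  have "Seq [\<sigma>, \<sigma>] [Equal \<sigma> (Var 0) (Var 1)] (Equal \<sigma> (Var 0) (Var 1)) \<in> T"
    using assms by (intro rule_Ax) auto
  with rule_Eq_Adj2[of 0 "[]" "[]" \<sigma> "Equal \<sigma> (Var 0) (Var 1)"] assms(1)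
  have "Seq [\<sigma>] [] (Equal \<sigma> (Var 0) (Var 0)) \<in> T" by (simp add: vars_single)
  from Seq_subst[OF this assms(2), of "[t]"] assms(4) show ?thesis by simp
qed

text \<open>Each equation is derivable from no antecedents at all, so \<open>Cut\<close> replaces it
  by the empty list.\<close>

lemma Seq_cut_refl_eqs:
  assumes "eq_adj X" "wf_ctx Sg \<Delta>"
  shows "list_all2 (has_sort Sg \<Gamma>) ts \<Delta> \<Longrightarrow> Seq \<Gamma> (\<Phi> @ eqs \<Delta> ts ts) \<psi> \<in> T \<Longrightarrow> Seq \<Gamma> \<Phi> \<psi> \<in> T"
  using assms(2)
proof (induction \<Delta> arbitrary: ts)
  case (Cons \<sigma> \<Delta>)
  then obtain t ts' where [simp]: "ts = t # ts'" and t: "has_sort Sg \<Gamma> t \<sigma>"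
    and ts': "list_all2 (has_sort Sg \<Gamma>) ts' \<Delta>"
    by (auto simp: list_all2_Cons2)
  have "Seq \<Gamma> [] (Equal \<sigma> t t) \<in> T"
    using Cons.prems wf_Seq(1)[OF Cons.prems(2)] assms(1) t by (intro Seq_equal_refl) auto
  from rule_Cut[OF this, of \<Phi> "eqs \<Delta> ts' ts'" \<psi>] Cons show ?case using ts' by simp
qed simp

text \<open>\<open>=\<close>-Adj with a substitution built in. The rule speaks only of the last
  variable and its copy; the induction below needs it for chosen variables of a reordered
  context.\<close>

lemma Seq_eq_subst:
  assumes X: "eq_adj X" and wf: "wf_fm L Sg (\<Theta> @ [\<sigma>, \<sigma>]) \<chi>"
    and S: "Seq (\<Theta> @ [\<sigma>]) \<Phi> (fsub (Suc n) (vars 0 (Suc n) @ [Var n]) \<chi>) \<in> T"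
    and n: "n = length \<Theta>" and \<Xi>: "wf_ctx Sg \<Xi>" "list_all2 (has_sort Sg \<Xi>) \<rho> \<Theta>"
    and tu: "has_sort Sg \<Xi> t \<sigma>" "has_sort Sg \<Xi> u \<sigma>"
  shows "Seq \<Xi> (map (fsub (length \<Xi>) (\<rho> @ [t])) \<Phi> @ [Equal \<sigma> t u])
    (fsub (length \<Xi>) (\<rho> @ [t, u]) \<chi>) \<in> T"
proof -
  have len: "length \<rho> = n" using \<Xi> n by (simp add: list_all2_lengthD)
  have ts: "list_all2 (has_sort Sg \<Xi>) (\<rho> @ [t, u]) (\<Theta> @ [\<sigma>, \<sigma>])"
    using \<Xi> tu by (intro list_all2_appendI) auto
  have "fsub (length \<Xi>) (\<rho> @ [t, u]) (wk (Suc n) \<phi>) = fsub (length \<Xi>) (\<rho> @ [t]) \<phi>"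
    if "wf_fm L Sg (\<Theta> @ [\<sigma>]) \<phi>" for \<phi>
    unfolding wk_def
    using fsub_comp[OF that, of "\<Theta> @ [\<sigma>, \<sigma>]" "vars 0 (Suc n)" "\<rho> @ [t, u]" "Suc (Suc n)" "length \<Xi>"]
      list_sort_vars[OF refl refl refl, of Sg "[]" "\<Theta> @ [\<sigma>]" "[\<sigma>]"] n len
    by (simp add: map_tsub_vars_slice)
  with Seq_subst[OF rule_Eq_Adj1[OF X n wf S] \<Xi>(1) ts] wf_Seq(2)[OF S] n len show ?thesis
    by (simp add: nth_append cong: map_cong)
qed

text \<open>One variable \<open>\<sigma>\<close> is moved past the remaining ones \<open>\<Delta>\<close>, which at that stage
  are still identified with their copies; the induction hypothesis then separates the latter.\<close>

lemma Seq_eqs_subst: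
  assumes X: "eq_adj X"
  shows "wf_fm L Sg (\<Theta> @ \<Delta> @ \<Delta>) \<chi> \<Longrightarrow>
    Seq (\<Theta> @ \<Delta>) \<Phi> (fsub (n + k) (vars 0 (n + k) @ vars n (n + k)) \<chi>) \<in> T \<Longrightarrow>
    n = length \<Theta> \<Longrightarrow> k = length \<Delta> \<Longrightarrow> wf_ctx Sg \<Xi> \<Longrightarrow>
    list_all2 (has_sort Sg \<Xi>) \<rho> \<Theta> \<Longrightarrow> list_all2 (has_sort Sg \<Xi>) ts \<Delta> \<Longrightarrow>
    list_all2 (has_sort Sg \<Xi>) us \<Delta> \<Longrightarrow>
    Seq \<Xi> (map (fsub (length \<Xi>) (\<rho> @ ts)) \<Phi> @ eqs \<Delta> ts us) (fsub (length \<Xi>) (\<rho> @ ts @ us) \<chi>) \<in> T"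
proof (induction \<Delta> arbitrary: \<Theta> \<Phi> \<chi> n k \<Xi> \<rho> ts us)
  case Nil
  then show ?case using Seq_subst[of \<Theta> \<Phi> \<chi> \<Xi> \<rho>] by (simp add: fsub_ident_wf)
next
  case (Cons \<sigma> \<Delta>)
  note H = Cons.prems(2)
  note n = Cons.prems(3)
  define k' where "k' = length \<Delta>"
  have k: "k = Suc k'" using Cons.prems by (simp add: k'_def)
  obtain t ts' u us' where [simp]: "ts = t # ts'" "us = u # us'"
    and tu: "has_sort Sg \<Xi> t \<sigma>" "has_sort Sg \<Xi> u \<sigma>"
    and ts': "list_all2 (has_sort Sg \<Xi>) ts' \<Delta>" "list_all2 (has_sort Sg \<Xi>) us' \<Delta>"
    using Cons.prems by (auto simp: list_all2_Cons2)
  have len: "length \<rho> = n" "length ts' = k'" "length us' = k'"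
    using Cons.prems(6) ts' n k'_def by (auto dest: list_all2_lengthD)
  have wf: "wf_ctx Sg \<Theta>" "\<sigma> \<in> sorts Sg" "wf_ctx Sg \<Delta>" using wf_Seq(1)[OF H] by auto
  note \<chi> = Cons.prems(1)
  \<comment> \<open>\<open>?a\<close> renames into the context
    \<open>\<Theta> @ \<Delta> @ [\<sigma>]\<close>: the adjoint rule needs its variable last, so
    \<open>\<sigma>\<close> moves behind \<open>\<Delta>\<close> and gets level
    \<open>n + k'\<close>.\<close>
  let ?a = "vars 0 n @ [Var (n + k')] @ vars n (n + k')"
  have a: "list_all2 (has_sort Sg ((\<Theta> @ \<Delta>) @ [\<sigma>])) ?a (\<Theta> @ \<sigma> # \<Delta>)"
    using n k'_def list_sort_vars[OF refl refl refl, of Sg "[]" \<Theta> "\<Delta> @ [\<sigma>]"]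
      list_sort_vars[OF refl refl refl, of Sg \<Theta> \<Delta> "[\<sigma>]"]
    by (intro list_all2_appendI) (auto simp: nth_append)
  \<comment> \<open>\<open>?b\<close> separates \<open>\<sigma>\<close> from its copy, at level
    \<open>n + k'\<close> and its successor, while both occurrences of \<open>\<Delta>\<close> still
    share the levels from \<open>n\<close> on.\<close>
  let ?b = "vars 0 n @ [Var (n + k')] @ vars n (n + k') @ [Var (Suc (n + k'))] @ vars n (n + k')"
  have b: "list_all2 (has_sort Sg ((\<Theta> @ \<Delta>) @ [\<sigma>, \<sigma>])) ?b (\<Theta> @ (\<sigma> # \<Delta>) @ \<sigma> # \<Delta>)"
    using n k'_def list_sort_vars[OF refl refl refl, of Sg "[]" \<Theta> "\<Delta> @ [\<sigma>, \<sigma>]"]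
      list_sort_vars[OF refl refl refl, of Sg \<Theta> \<Delta> "[\<sigma>, \<sigma>]"]
    by (simp add: list_all2_appendI nth_append)
  let ?\<chi>1 = "fsub (n + k' + 2) ?b \<chi>" and ?\<Phi>1 = "map (fsub (n + k' + 1) ?a) \<Phi>"
  have \<chi>1: "wf_fm L Sg ((\<Theta> @ \<Delta>) @ [\<sigma>, \<sigma>]) ?\<chi>1"
    using n k'_def by (intro wf_fm_fsub[OF \<chi> b]) simp
  let ?d = "vars 0 (n + k) @ vars n (n + k)"
  have d: "list_all2 (has_sort Sg (\<Theta> @ \<sigma> # \<Delta>)) ?d (\<Theta> @ (\<sigma> # \<Delta>) @ \<sigma> # \<Delta>)"
    using n k k'_def list_sort_vars[OF refl refl refl, of Sg "[]" "\<Theta> @ \<sigma> # \<Delta>" "[]"]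
      list_sort_vars[OF refl refl refl, of Sg \<Theta> "\<sigma> # \<Delta>" "[]"]
    by (subst append_assoc[symmetric], intro list_all2_appendI) auto
  \<comment> \<open>Identifying the two copies of \<open>\<sigma>\<close> in \<open>?\<chi>1\<close>
    gives the renamed diagonal of \<open>\<chi>\<close>, so the renamed assumption is a premise of
    the rule for one variable.\<close>
  have "fsub (n + k' + 1) ?a (fsub (n + k) ?d \<chi>) = fsub (n + k' + 1) (map (tsub ?a) ?d) \<chi>"
    using n k k'_def by (intro fsub_comp[OF \<chi> d]) simp_all
  also have "map (tsub ?a) ?d = map (tsub (vars 0 (Suc (n + k')) @ [Var (n + k')])) ?b"
    using k by (simp add: map_tsub_vars_slice nth_append)
  also have "fsub (n + k' + 1) \<dots> \<chi> =
      fsub (n + k' + 1) (vars 0 (Suc (n + k')) @ [Var (n + k')]) ?\<chi>1"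
    using n k'_def by (intro fsub_comp[OF \<chi> b, symmetric]) simp_all
  finally have S1: "Seq ((\<Theta> @ \<Delta>) @ [\<sigma>]) ?\<Phi>1
      (fsub (n + k' + 1) (vars 0 (Suc (n + k')) @ [Var (n + k')]) ?\<chi>1) \<in> T"
    using Seq_subst[OF H _ a] wf n k'_def by simp
  \<comment> \<open>In this context \<open>\<Delta>\<close> is last again, so the induction
    hypothesis can be applied with \<open>\<Theta> @ [\<sigma>, \<sigma>]\<close> in the role of
    \<open>\<Theta>\<close>; the equation just produced becomes one of the antecedents it carries
    along.\<close>
  let ?\<Xi> = "\<Theta> @ [\<sigma>, \<sigma>] @ \<Delta>" and ?D = "vars (n + 2) (n + 2 + k')"
  let ?r = "vars 0 n @ ?D"
  have D: "list_all2 (has_sort Sg ?\<Xi>) ?D \<Delta>" "list_all2 (has_sort Sg ?\<Xi>) (vars 0 n) \<Theta>"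
    using n k'_def list_sort_vars[OF refl refl refl, of Sg "[]" \<Theta> "[\<sigma>, \<sigma>] @ \<Delta>"]
      list_sort_vars[OF refl refl refl, of Sg "\<Theta> @ [\<sigma>, \<sigma>]" \<Delta> "[]"] by simp_all
  have r: "list_all2 (has_sort Sg ?\<Xi>) ?r (\<Theta> @ \<Delta>)" using D by (intro list_all2_appendI)
  have S2: "Seq ?\<Xi> (map (fsub (length ?\<Xi>) (?r @ [Var n])) ?\<Phi>1 @ [Equal \<sigma> (Var n) (Var (Suc n))])
      (fsub (length ?\<Xi>) (?r @ [Var n, Var (Suc n)]) ?\<chi>1) \<in> T"
    using S1 n k'_def wf by (intro Seq_eq_subst[OF X \<chi>1 _ _ _ r]) (simp_all add: nth_append)
  let ?a' = "vars 0 n @ [Var n] @ ?D"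
  have "fsub (length ?\<Xi>) (?r @ [Var n]) (fsub (n + k' + 1) ?a \<phi>) = fsub (length ?\<Xi>) ?a' \<phi>"
    if "wf_fm L Sg (\<Theta> @ \<sigma> # \<Delta>) \<phi>" for \<phi>
  proof -
    have "fsub (length ?\<Xi>) (?r @ [Var n]) (fsub (n + k' + 1) ?a \<phi>) =
        fsub (length ?\<Xi>) (map (tsub (?r @ [Var n])) ?a) \<phi>"
      using n k'_def by (intro fsub_comp[OF that a]) simp_all
    also have "map (tsub (?r @ [Var n])) ?a = ?a'"
      by (simp add: map_tsub_vars_slice nth_append)
    finally show ?thesis .
  qed
  then have \<Phi>2: "map (fsub (length ?\<Xi>) (?r @ [Var n])) ?\<Phi>1 = map (fsub (length ?\<Xi>) ?a') \<Phi>"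
    using wf_Seq(2)[OF H] by simp
  \<comment> \<open>Now the second occurrence of \<open>\<Delta>\<close> also gets levels of its
    own, from \<open>n + 2 + k'\<close> on, so all copies are separate in
    \<open>?\<chi>2\<close>.\<close>
  let ?b' = "vars 0 n @ [Var n] @ ?D @ [Var (Suc n)] @ vars (n + 2 + k') (n + 2 + k' + k')"
  have b': "list_all2 (has_sort Sg ((\<Theta> @ [\<sigma>, \<sigma>]) @ \<Delta> @ \<Delta>)) ?b' (\<Theta> @ (\<sigma> # \<Delta>) @ \<sigma> # \<Delta>)"
    using n k'_def list_sort_vars[OF refl refl refl, of Sg "[]" \<Theta> "[\<sigma>, \<sigma>] @ \<Delta> @ \<Delta>"]
      list_sort_vars[OF refl refl refl, of Sg "\<Theta> @ [\<sigma>, \<sigma>]" \<Delta> \<Delta>]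
      list_sort_vars[OF refl refl refl, of Sg "\<Theta> @ [\<sigma>, \<sigma>] @ \<Delta>" \<Delta> "[]"]
    by (simp add: list_all2_appendI nth_append)
  let ?\<chi>2 = "fsub (n + 2 + k' + k') ?b' \<chi>"
  have \<chi>2: "wf_fm L Sg ((\<Theta> @ [\<sigma>, \<sigma>]) @ \<Delta> @ \<Delta>) ?\<chi>2"
    using n k'_def by (intro wf_fm_fsub[OF \<chi> b']) simp
  let ?d' = "vars 0 (n + 2 + k') @ vars (n + 2) (n + 2 + k')"
  \<comment> \<open>The succedent reached so far is the diagonal of \<open>?\<chi>2\<close> along
    \<open>\<Delta>\<close>, the form in which the induction hypothesis expects it.\<close>
  have "fsub (length ?\<Xi>) (?r @ [Var n, Var (Suc n)]) ?\<chi>1 =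
      fsub (length ?\<Xi>) (map (tsub (?r @ [Var n, Var (Suc n)])) ?b) \<chi>"
    using n k'_def by (intro fsub_comp[OF \<chi> b]) simp_all
  also have "map (tsub (?r @ [Var n, Var (Suc n)])) ?b = map (tsub ?d') ?b'"
    by (simp add: map_tsub_vars_slice nth_append)
  also have "fsub (length ?\<Xi>) (map (tsub ?d') ?b') \<chi> = fsub (n + 2 + k') ?d' ?\<chi>2"
    using n k'_def by (subst fsub_comp[OF \<chi> b']) simp_all
  finally have S3: "Seq ((\<Theta> @ [\<sigma>, \<sigma>]) @ \<Delta>)
      (map (fsub (length ?\<Xi>) ?a') \<Phi> @ [Equal \<sigma> (Var n) (Var (Suc n))])
      (fsub (n + 2 + k') ?d' ?\<chi>2) \<in> T"
    using S2 unfolding \<Phi>2 by simp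
  have \<rho>': "list_all2 (has_sort Sg \<Xi>) (\<rho> @ [t, u]) (\<Theta> @ [\<sigma>, \<sigma>])"
    using Cons.prems(6) tu by (intro list_all2_appendI) auto
  \<comment> \<open>Extending \<open>\<rho>\<close> by \<open>t\<close> and \<open>u\<close> turns
    the carried equation into \<open>Equal \<sigma> t u\<close>. It stands directly before
    \<open>eqs \<Delta> ts' us'\<close>, as the order in \<open>eqs\<close> demands.\<close>
  have S4: "Seq \<Xi> (map (fsub (length \<Xi>) ((\<rho> @ [t, u]) @ ts'))
      (map (fsub (length ?\<Xi>) ?a') \<Phi> @ [Equal \<sigma> (Var n) (Var (Suc n))]) @ eqs \<Delta> ts' us')
      (fsub (length \<Xi>) ((\<rho> @ [t, u]) @ ts' @ us') ?\<chi>2) \<in> T"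
    using n k'_def by (intro Cons.IH[OF \<chi>2 S3 _ _ Cons.prems(5) \<rho>' ts']) simp_all
  have a': "list_all2 (has_sort Sg ?\<Xi>) ?a' (\<Theta> @ \<sigma> # \<Delta>)"
    using D n by (simp add: list_all2_appendI nth_append)
  have "fsub (length \<Xi>) ((\<rho> @ [t, u]) @ ts') (fsub (length ?\<Xi>) ?a' \<phi>) =
      fsub (length \<Xi>) (\<rho> @ t # ts') \<phi>" if "wf_fm L Sg (\<Theta> @ \<sigma> # \<Delta>) \<phi>" for \<phi>
  proof -
    have "fsub (length \<Xi>) ((\<rho> @ [t, u]) @ ts') (fsub (length ?\<Xi>) ?a' \<phi>) =
        fsub (length \<Xi>) (map (tsub ((\<rho> @ [t, u]) @ ts')) ?a') \<phi>"
      using n k'_def len by (intro fsub_comp[OF that a']) simp_all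
    also have "map (tsub ((\<rho> @ [t, u]) @ ts')) ?a' = \<rho> @ t # ts'"
      using len by (simp add: map_tsub_vars_slice nth_append)
    finally show ?thesis .
  qed
  then have \<Phi>4: "map (fsub (length \<Xi>) ((\<rho> @ [t, u]) @ ts')) (map (fsub (length ?\<Xi>) ?a') \<Phi>) =
      map (fsub (length \<Xi>) (\<rho> @ ts)) \<Phi>"
    using wf_Seq(2)[OF H] by simp
  have "fsub (length \<Xi>) ((\<rho> @ [t, u]) @ ts' @ us') ?\<chi>2 =
      fsub (length \<Xi>) (map (tsub ((\<rho> @ [t, u]) @ ts' @ us')) ?b') \<chi>"
    using n k'_def len by (intro fsub_comp[OF \<chi> b']) simp_all
  also have "map (tsub ((\<rho> @ [t, u]) @ ts' @ us')) ?b' = \<rho> @ ts @ us"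
    using len by (simp add: map_tsub_vars_slice nth_append)
  finally show ?case
    using S4[unfolded map_append \<Phi>4] len by (simp add: nth_append)
qed

text \<open>The case of \<open>Seq_eqs_subst\<close> in which all terms are the variables
  themselves; tensor reflection then joins the equations to one antecedent.\<close>

lemma Eq_Adj1_list:
  assumes "eq_adj X" "n = length \<Gamma>" "k = length \<Delta>" "wf_fm L Sg (\<Gamma> @ \<Delta> @ \<Delta>) \<psi>"
    and "Seq (\<Gamma> @ \<Delta>) \<Phi> (fsub (n + k) (vars 0 (n + k) @ vars n (n + k)) \<psi>) \<in> T"
  shows "Seq (\<Gamma> @ \<Delta> @ \<Delta>) (map (fsub (n + k + k) (vars 0 (n + k))) \<Phi> @
    [tensors L (eqs \<Delta> (vars n (n + k)) (vars (n + k) (n + k + k)))]) \<psi> \<in> T"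
proof -
  have "wf_ctx Sg (\<Gamma> @ \<Delta> @ \<Delta>)" using wf_Seq(1)[OF assms(5)] by simp
  moreover have "fsub (n + k + k) (vars 0 n @ vars n (n + k) @ vars (n + k) (n + k + k)) \<psi> = \<psi>"
    using fsub_ident_wf[OF assms(4)] assms(2,3) by (simp add: vars_append add.assoc)
  ultimately show ?thesis
    using Seq_eqs_subst[OF assms(1,4,5,2,3), of "\<Gamma> @ \<Delta> @ \<Delta>" "vars 0 n" "vars n (n + k)" "vars (n + k) (n + k + k)"]
      list_sort_vars[OF refl refl refl, of Sg "[]" \<Gamma> "\<Delta> @ \<Delta>"]
      list_sort_vars[OF refl refl refl, of Sg \<Gamma> \<Delta> \<Delta>]
      list_sort_vars[OF refl refl refl, of Sg "\<Gamma> @ \<Delta>" \<Delta> "[]"] assms(2,3)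
    by (simp add: Seq_tensors_iff[of _ _ _ "[]", simplified] vars_append add.assoc)
qed

text \<open>No induction on the adjoint rule is needed: substituting along the diagonal makes all
  equations reflexive, so they can be cut, and undoes the weakening of
  \<open>\<Phi>\<close>.\<close>

lemma Eq_Adj2_list:
  assumes "eq_adj X" "n = length \<Gamma>" "k = length \<Delta>" "\<forall>\<phi>\<in>set \<Phi>. wf_fm L Sg (\<Gamma> @ \<Delta>) \<phi>"
    and "Seq (\<Gamma> @ \<Delta> @ \<Delta>) (map (fsub (n + k + k) (vars 0 (n + k))) \<Phi> @
      [tensors L (eqs \<Delta> (vars n (n + k)) (vars (n + k) (n + k + k)))]) \<psi> \<in> T"
  shows "Seq (\<Gamma> @ \<Delta>) \<Phi> (fsub (n + k) (vars 0 (n + k) @ vars n (n + k)) \<psi>) \<in> T"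
proof -
  let ?d = "vars 0 (n + k) @ vars n (n + k)"
  have wf: "wf_ctx Sg \<Gamma>" "wf_ctx Sg \<Delta>" using wf_Seq(1)[OF assms(5)] by auto
  have v: "list_all2 (has_sort Sg (\<Gamma> @ \<Delta>)) (vars n (n + k)) \<Delta>"
    using assms(2,3) list_sort_vars[OF refl refl refl, of Sg \<Gamma> \<Delta> "[]"] by simp
  have d: "list_all2 (has_sort Sg (\<Gamma> @ \<Delta>)) ?d ((\<Gamma> @ \<Delta>) @ \<Delta>)"
    using assms(2,3) v list_sort_vars[OF refl refl refl, of Sg "[]" "\<Gamma> @ \<Delta>" "[]"]
    by (intro list_all2_appendI) simp_all
  have w: "list_all2 (has_sort Sg (\<Gamma> @ \<Delta> @ \<Delta>)) (vars 0 (n + k)) (\<Gamma> @ \<Delta>)"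
    using assms(2,3) list_sort_vars[OF refl refl refl, of Sg "[]" "\<Gamma> @ \<Delta>" \<Delta>] by simp
  have "fsub (n + k) ?d (fsub (n + k + k) (vars 0 (n + k)) \<phi>) = \<phi>" if "\<phi> \<in> set \<Phi>" for \<phi>
  proof -
    have "wf_fm L Sg (\<Gamma> @ \<Delta>) \<phi>" using assms(4) that by blast
    then show ?thesis
      using fsub_ident_wf[of "\<Gamma> @ \<Delta>" \<phi>] assms(2,3)
      by (subst fsub_comp[OF _ w]) (simp_all add: map_tsub_vars_slice)
  qed
  then have e1: "map (fsub (n + k) ?d) (map (fsub (n + k + k) (vars 0 (n + k))) \<Phi>) = \<Phi>"
    by (simp add: map_idI)
  have e2: "map (fsub (n + k) ?d) (eqs \<Delta> (vars n (n + k)) (vars (n + k) (n + k + k))) =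
      eqs \<Delta> (vars n (n + k)) (vars n (n + k))"
    by (simp add: map_fsub_eqs map_tsub_vars_slice)
  have "Seq ((\<Gamma> @ \<Delta>) @ \<Delta>) (map (fsub (n + k + k) (vars 0 (n + k))) \<Phi> @
      eqs \<Delta> (vars n (n + k)) (vars (n + k) (n + k + k))) \<psi> \<in> T"
    using assms(5) Seq_tensors_iff[of "\<Gamma> @ \<Delta> @ \<Delta>" _ _ "[]" \<psi>] by simp
  from Seq_subst[OF this _ d] have "Seq (\<Gamma> @ \<Delta>) (map (fsub (n + k) ?d)
      (map (fsub (n + k + k) (vars 0 (n + k))) \<Phi> @ eqs \<Delta> (vars n (n + k)) (vars (n + k) (n + k + k))))
      (fsub (n + k) ?d \<psi>) \<in> T"
    using wf assms(2,3) by simp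
  then have "Seq (\<Gamma> @ \<Delta>) (\<Phi> @ eqs \<Delta> (vars n (n + k)) (vars n (n + k))) (fsub (n + k) ?d \<psi>) \<in> T"
    unfolding map_append e1 e2 .
  then show ?thesis by (rule Seq_cut_refl_eqs[OF assms(1) wf(2) v])
qed

section \<open>Quantifier adjunctions for blocks of variables\<close>

lemma fsub_wk:
  assumes "wf_fm L Sg \<Gamma> \<phi>" "n = length \<Gamma>"
  shows "fsub m (vars 0 (Suc n)) (wk n \<phi>) = fsub m (vars 0 n) \<phi>"
  \<comment> \<open>No sort is given for the added variable, and \<open>undefined\<close> serves as
    one: the composition law looks only at the length of the context and the sorts of its first
    \<open>n\<close> variables.\<close>
  unfolding wk_def using assms list_sort_vars[OF refl refl refl, of Sg "[]" \<Gamma> "[undefined]"]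
  by (subst fsub_comp[OF assms(1), of "\<Gamma> @ [undefined]"]) (simp_all add: map_tsub_vars_slice)

text \<open>The inner block is introduced over \<open>\<Gamma> @ [\<sigma>]\<close>, which is why
  the context varies in the induction; the rule then adds the outermost quantifier. Successive
  one-step weakenings merge by \<open>fsub_wk\<close>.\<close>

lemma All_Adj1_list:
  assumes "all_adj X"
  shows "\<forall>\<phi>\<in>set \<Phi>. wf_fm L Sg \<Gamma> \<phi> \<Longrightarrow> n = length \<Gamma> \<Longrightarrow> k = length \<Delta> \<Longrightarrow>
    Seq (\<Gamma> @ \<Delta>) (map (fsub (n + k) (vars 0 n)) \<Phi>) \<psi> \<in> T \<Longrightarrow>
    Seq \<Gamma> \<Phi> (foldr (Quant Forall) \<Delta> \<psi>) \<in> T"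
proof (induction \<Delta> arbitrary: \<Gamma> \<Phi> n k)
  case Nil
  then show ?case by (simp add: fsub_ident_wf cong: map_cong)
next
  case (Cons \<sigma> \<Delta>)
  have "\<forall>\<phi>\<in>set \<Phi>. fsub m (vars 0 (Suc n)) (wk n \<phi>) = fsub m (vars 0 n) \<phi>" for m
    using Cons.prems by (auto intro: fsub_wk)
  then have "Seq (\<Gamma> @ [\<sigma>]) (map (wk n) \<Phi>) (foldr (Quant Forall) \<Delta> \<psi>) \<in> T"
    using Cons.prems by (intro Cons.IH[OF _ refl refl]) (auto intro: wf_wk cong: map_cong)
  then show ?case using Cons.prems rule_All_Adj1[OF assms, of \<Phi> \<Gamma> \<sigma>] by simp
qed

lemma All_Adj2_list:
  assumes "all_adj X"
  shows "n = length \<Gamma> \<Longrightarrow> k = length \<Delta> \<Longrightarrow> Seq \<Gamma> \<Phi> (foldr (Quant Forall) \<Delta> \<psi>) \<in> T \<Longrightarrow>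
    Seq (\<Gamma> @ \<Delta>) (map (fsub (n + k) (vars 0 n)) \<Phi>) \<psi> \<in> T"
proof (induction \<Delta> arbitrary: \<Gamma> \<Phi> n k)
  case Nil
  then show ?case by (simp add: fsub_ident_wf wf_Seq[OF Nil(3)] cong: map_cong)
next
  case (Cons \<sigma> \<Delta>)
  have "Seq (\<Gamma> @ [\<sigma>]) (map (wk n) \<Phi>) (foldr (Quant Forall) \<Delta> \<psi>) \<in> T"
    using Cons.prems rule_All_Adj2[OF assms, of \<Gamma> \<Phi> \<sigma>] by simp
  from Cons.IH[OF refl refl this] Cons.prems(1,2) show ?case
    by (simp add: fsub_wk[OF wf_Seq(2)[OF Cons.prems(3)]] cong: map_cong)
qed

text \<open>As for the universal quantifier, but the succedent is weakened as well and so has to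
  vary in the induction.\<close>

lemma Ex_Adj1_list:
  assumes "ex_adj X"
  shows "\<forall>\<phi>\<in>set \<Phi>. wf_fm L Sg \<Gamma> \<phi> \<Longrightarrow> wf_fm L Sg \<Gamma> \<theta> \<Longrightarrow> n = length \<Gamma> \<Longrightarrow> k = length \<Delta> \<Longrightarrow>
    Seq (\<Gamma> @ \<Delta>) (map (fsub (n + k) (vars 0 n)) \<Phi> @ [\<psi>]) (fsub (n + k) (vars 0 n) \<theta>) \<in> T \<Longrightarrow>
    Seq \<Gamma> (\<Phi> @ [foldr (Quant Exists) \<Delta> \<psi>]) \<theta> \<in> T"
proof (induction \<Delta> arbitrary: \<Gamma> \<Phi> \<theta> n k)
  case Nil
  then show ?case by (simp add: fsub_ident_wf cong: map_cong)
next
  case (Cons \<sigma> \<Delta>)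
  have "\<forall>\<phi>\<in>insert \<theta> (set \<Phi>). fsub m (vars 0 (Suc n)) (wk n \<phi>) = fsub m (vars 0 n) \<phi>" for m
    using Cons.prems by (auto intro: fsub_wk)
  then have "Seq (\<Gamma> @ [\<sigma>]) (map (wk n) \<Phi> @ [foldr (Quant Exists) \<Delta> \<psi>]) (wk n \<theta>) \<in> T"
    using Cons.prems by (intro Cons.IH[OF _ _ refl refl]) (auto intro: wf_wk cong: map_cong)
  then show ?case using Cons.prems rule_Ex_Adj1[OF assms, of \<Phi> \<Gamma> \<theta> \<sigma>] by simp
qed

lemma Ex_Adj2_list:
  assumes "ex_adj X"
  shows "n = length \<Gamma> \<Longrightarrow> k = length \<Delta> \<Longrightarrow> Seq \<Gamma> (\<Phi> @ [foldr (Quant Exists) \<Delta> \<psi>]) \<theta> \<in> T \<Longrightarrow>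
    Seq (\<Gamma> @ \<Delta>) (map (fsub (n + k) (vars 0 n)) \<Phi> @ [\<psi>]) (fsub (n + k) (vars 0 n) \<theta>) \<in> T"
proof (induction \<Delta> arbitrary: \<Gamma> \<Phi> \<theta> n k)
  case Nil
  then show ?case by (simp add: fsub_ident_wf wf_Seq[OF Nil(3)] cong: map_cong)
next
  case (Cons \<sigma> \<Delta>)
  have "Seq (\<Gamma> @ [\<sigma>]) (map (wk n) \<Phi> @ [foldr (Quant Exists) \<Delta> \<psi>]) (wk n \<theta>) \<in> T"
    using Cons.prems rule_Ex_Adj2[OF assms, of \<Gamma> \<Phi> \<sigma>] by simp
  from Cons.IH[OF refl refl this] Cons.prems(1,2) show ?case
    by (simp add: fsub_wk[OF wf_Seq(2)[OF Cons.prems(3)]] fsub_wk[OF wf_Seq(3)[OF Cons.prems(3)]]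
        cong: map_cong)
qed

end

section \<open>Structures in a classifying prop-category as translations\<close>

text \<open>The projections of a product of contexts, listed together, are the identity
  substitution. This is why \<open>ext_iso\<close> turns out to be an identity.\<close>

lemma concat_slices:
  "concat (map (\<lambda>i. vars (length (concat (take i \<Gamma>s))) (length (concat (take (Suc i) \<Gamma>s))))
     [0..<length \<Gamma>s]) = vars 0 (length (concat \<Gamma>s))"
proof -
  have "n \<le> length \<Gamma>s \<Longrightarrow>
    concat (map (\<lambda>i. vars (length (concat (take i \<Gamma>s))) (length (concat (take (Suc i) \<Gamma>s)))) [0..<n])
    = vars 0 (length (concat (take n \<Gamma>s)))" for n
    by (induction n) (simp_all add: concat_take_Suc vars_append del: length_concat)
  from this[of "length \<Gamma>s"] show ?thesis by simp
qed

text \<open>\<open>Sg'\<close> is the signature being interpreted and \<open>Sg\<close> the one over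
  which \<open>T\<close> is written. Their type parameters are independent, so soundness is obtained
  for classifying prop-categories over any universes of symbols.\<close>

locale structure_in_classifying = closed_theory L X Sg T
  for L :: "'k lang" and X :: "'k logic" and Sg :: "('s, 'f, 'r) signat"
    and T :: "('s, 'f, 'r, 'k) assertion set" +
  fixes Sg' :: "('s1, 'f1, 'r1) signat"
    and S :: "('s1, 'f1, 'r1, 's list, ('s, 'f) ctx_mor, ('s, 'f, 'r, 'k) fm set) interp"
  assumes wf_Sg': "wf_sig Sg'"
    and is_str: "is_structure Sg' (classifying L Sg T) S"
begin

definition cx :: "'s1 list \<Rightarrow> 's list" where
  "cx \<Gamma> = concat (map (sort_i S) \<Gamma>)"

text \<open>The representative of a function symbol is chosen once, whereas composition in the
  classifying category selects representatives anew at every step. This makes the translation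
  commute literally with substitution.\<close>

primrec tr_tm :: "'s1 list \<Rightarrow> 'f1 tm \<Rightarrow> 'f tm list" where
  "tr_tm \<Gamma> (Var i) = vars (length (cx (take i \<Gamma>))) (length (cx (take (Suc i) \<Gamma>)))"
| "tr_tm \<Gamma> (Fun f ts) = map (tsub (concat (map (tr_tm \<Gamma>) ts))) (m_rep (fun_i S f))"

primrec tr_fm :: "('s1, 'f1, 'r1, 'k) fm \<Rightarrow> 's1 list \<Rightarrow> ('s, 'f, 'r, 'k) fm" where
  "tr_fm (Rel r ts) \<Gamma> = fsub (length (cx \<Gamma>)) (concat (map (tr_tm \<Gamma>) ts)) (p_rep (rel_i S r))"
| "tr_fm (Equal \<sigma> t u) \<Gamma> = tensors L (eqs (sort_i S \<sigma>) (tr_tm \<Gamma> t) (tr_tm \<Gamma> u))"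
| "tr_fm (Conn k \<phi>s) \<Gamma> = Conn k (map (\<lambda>\<phi>. tr_fm \<phi> \<Gamma>) \<phi>s)"
| "tr_fm (Quant q \<sigma> \<phi>) \<Gamma> = foldr (Quant q) (sort_i S \<sigma>) (tr_fm \<phi> (\<Gamma> @ [\<sigma>]))"

fun tr_holds :: "('s1, 'f1, 'r1, 'k) assertion \<Rightarrow> bool" where
  "tr_holds (Eqn \<Gamma> M N \<tau>) \<longleftrightarrow> tms_eqv (cx \<Gamma>) (sort_i S \<tau>) (tr_tm \<Gamma> M) (tr_tm \<Gamma> N)"
| "tr_holds (Seq \<Gamma> \<Phi> \<psi>) \<longleftrightarrow> Seq (cx \<Gamma>) (map (\<lambda>\<phi>. tr_fm \<phi> \<Gamma>) \<Phi>) (tr_fm \<psi> \<Gamma>) \<in> T"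

lemma cx_append [simp]: "cx (\<Gamma> @ \<Delta>) = cx \<Gamma> @ cx \<Delta>"
  and cx_Cons [simp]: "cx (\<sigma> # \<Gamma>) = sort_i S \<sigma> @ cx \<Gamma>"
  and cx_Nil [simp]: "cx [] = []"
  by (simp_all add: cx_def)

lemma cx_take: "cx (take i \<Gamma>) = concat (take i (map (sort_i S) \<Gamma>))"
  by (simp add: cx_def take_map)

lemma ctx_i_eq: "ctx_i C S \<Gamma> = cx \<Gamma>"
  by (simp add: ctx_i_def cx_def)

lemma wf_sort: "\<sigma> \<in> sorts Sg' \<Longrightarrow> wf_ctx Sg (sort_i S \<sigma>)"
  using is_str by (simp add: is_structure_def C_obj)

lemma wf_cx: "wf_ctx Sg' \<Gamma> \<Longrightarrow> wf_ctx Sg (cx \<Gamma>)"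
  by (induction \<Gamma>) (auto intro: wf_sort)

lemma fun_sorts:
  "funs Sg' f = Some (\<sigma>s, \<tau>) \<Longrightarrow> wf_ctx Sg' \<sigma>s \<and> \<tau> \<in> sorts Sg'"
  using wf_Sg' by (auto simp: wf_sig_def)

lemma rel_sorts: "rels Sg' r = Some \<sigma>s \<Longrightarrow> wf_ctx Sg' \<sigma>s"
  using wf_Sg' by (auto simp: wf_sig_def)

lemma has_sort_in_sorts: "has_sort Sg' \<Gamma> t \<tau> \<Longrightarrow> wf_ctx Sg' \<Gamma> \<Longrightarrow> \<tau> \<in> sorts Sg'"
  by (cases rule: has_sort.cases) (auto simp: wf_ctx_def dest: fun_sorts)

lemma fun_i_rep:
  assumes "funs Sg' f = Some (\<sigma>s, \<tau>)"
  shows "fun_i S f = m_class T (cx \<sigma>s) (sort_i S \<tau>) (m_rep (fun_i S f))"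
    and "mor (cx \<sigma>s) (sort_i S \<tau>) (m_rep (fun_i S f))"
proof -
  have "fun_i S f \<in> hom C (cx \<sigma>s) (sort_i S \<tau>)"
    using is_str assms by (auto simp: is_structure_def ctx_i_eq)
  then obtain ts where ts: "fun_i S f = m_class T (cx \<sigma>s) (sort_i S \<tau>) ts" "mor (cx \<sigma>s) (sort_i S \<tau>) ts"
    by (auto simp: C_hom)
  note eqv = m_rep_eqv[OF ts(2), folded ts(1)]
  show "fun_i S f = m_class T (cx \<sigma>s) (sort_i S \<tau>) (m_rep (fun_i S f))"
    using ts(1) m_class_eqI[OF eqv] by (rule trans)
  show "mor (cx \<sigma>s) (sort_i S \<tau>) (m_rep (fun_i S f))"
    using ts(2) tms_eqv_sort(2)[OF eqv] by blast
qed

lemma rel_i_rep: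
  assumes "rels Sg' r = Some \<sigma>s"
  shows "rel_i S r = p_class T (cx \<sigma>s) (p_rep (rel_i S r))"
    and "wf_fm L Sg (cx \<sigma>s) (p_rep (rel_i S r))"
proof -
  have "rel_i S r \<in> props C (cx \<sigma>s)"
    using is_str assms by (auto simp: is_structure_def ctx_i_eq)
  then obtain \<phi> where \<phi>: "rel_i S r = p_class T (cx \<sigma>s) \<phi>" "form (cx \<sigma>s) \<phi>"
    using wf_cx[OF rel_sorts[OF assms]] by (auto simp: C_props)
  note eqv = p_rep_eqv[OF \<phi>(2), folded \<phi>(1)]
  show "rel_i S r = p_class T (cx \<sigma>s) (p_rep (rel_i S r))"
    using \<phi>(1) p_class_eqI[OF eqv] by (rule trans)
  show "wf_fm L Sg (cx \<sigma>s) (p_rep (rel_i S r))" by (rule fm_eqv_wf(3)[OF eqv])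
qed

lemma tr_list_sort:
  "list_all2 (\<lambda>t \<tau>. list_all2 (has_sort Sg (cx \<Gamma>)) (tr_tm \<Gamma> t) (sort_i S \<tau>)) ts \<sigma>s \<Longrightarrow>
   list_all2 (has_sort Sg (cx \<Gamma>)) (concat (map (tr_tm \<Gamma>) ts)) (cx \<sigma>s)"
  by (induction rule: list_all2_induct) (auto intro: list_all2_appendI)

lemma tr_tm_sort:
  "has_sort Sg' \<Gamma> t \<tau> \<Longrightarrow> list_all2 (has_sort Sg (cx \<Gamma>)) (tr_tm \<Gamma> t) (sort_i S \<tau>)"
proof (induction rule: has_sort.induct)
  case (Var i)
  then show ?case
    using list_sort_slice[of i "map (sort_i S) \<Gamma>" Sg] by (simp add: cx_take flip: cx_def)
next
  case (Fun f \<sigma>s \<tau> ts)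
  have "list_all2 (has_sort Sg (cx \<Gamma>)) (concat (map (tr_tm \<Gamma>) ts)) (cx \<sigma>s)"
    using Fun.IH by (intro tr_list_sort) (auto elim: list_all2_mono)
  then show ?case using fun_i_rep(2)[OF Fun.hyps] by (auto intro: list_sort_tsub)
qed

lemma tr_tms_sort:
  "list_all2 (has_sort Sg' \<Gamma>) ts \<sigma>s \<Longrightarrow>
   list_all2 (has_sort Sg (cx \<Gamma>)) (concat (map (tr_tm \<Gamma>) ts)) (cx \<sigma>s)"
  by (rule tr_list_sort) (auto elim: list_all2_mono intro: tr_tm_sort)

lemma length_tr_tms:
  "list_all2 (has_sort Sg' \<Gamma>) ts \<sigma>s \<Longrightarrow>
   list_all2 (\<lambda>us \<Delta>. length us = length \<Delta>) (map (tr_tm \<Gamma>) ts) (map (sort_i S) \<sigma>s)"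
  by (simp add: list_all2_map1 list_all2_map2)
    (auto elim!: list_all2_mono dest: list_all2_lengthD[OF tr_tm_sort])

lemma tr_tm_mor: "has_sort Sg' \<Gamma> t \<tau> \<Longrightarrow> wf_ctx Sg' \<Gamma> \<Longrightarrow> mor (cx \<Gamma>) (sort_i S \<tau>) (tr_tm \<Gamma> t)"
  by (simp add: tr_tm_sort wf_cx wf_sort has_sort_in_sorts)

lemma tup_tr:
  assumes "wf_ctx Sg' \<Gamma>" "list_all2 (has_sort Sg' \<Gamma>) ts \<sigma>s"
    "list_all2 (\<lambda>t \<tau>. tm_i C S \<Gamma> t = m_class T (cx \<Gamma>) (sort_i S \<tau>) (tr_tm \<Gamma> t)) ts \<sigma>s"
  shows "tup C (cx \<Gamma>) (map (tm_i C S \<Gamma>) ts) = m_class T (cx \<Gamma>) (cx \<sigma>s) (concat (map (tr_tm \<Gamma>) ts))"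
proof -
  have "map (tm_i C S \<Gamma>) ts = map2 (m_class T (cx \<Gamma>)) (map (sort_i S) \<sigma>s) (map (tr_tm \<Gamma>) ts)"
    using assms(3) by (induction rule: list_all2_induct) auto
  moreover have "list_all2 (\<lambda>us \<Delta>. mor (cx \<Gamma>) \<Delta> us) (map (tr_tm \<Gamma>) ts) (map (sort_i S) \<sigma>s)"
    using assms(1,2) tr_tm_mor by (auto simp: list_all2_map1 list_all2_map2 elim!: list_all2_mono)
  ultimately show ?thesis
    using C_tup[of "cx \<Gamma>" "map (tr_tm \<Gamma>) ts" "map (sort_i S) \<sigma>s"] wf_cx[OF assms(1)]
    by (simp add: cx_def)
qed

lemma tm_i_eq:
  "has_sort Sg' \<Gamma> t \<tau> \<Longrightarrow> wf_ctx Sg' \<Gamma> \<Longrightarrow>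
   tm_i C S \<Gamma> t = m_class T (cx \<Gamma>) (sort_i S \<tau>) (tr_tm \<Gamma> t)"
proof (induction rule: has_sort.induct)
  case (Var i)
  then show ?case by (simp add: C_prj cx_take flip: cx_def)
next
  case (Fun f \<sigma>s \<tau> ts)
  have s: "list_all2 (has_sort Sg' \<Gamma>) ts \<sigma>s" using Fun.IH by (auto elim: list_all2_mono)
  have "tup C (cx \<Gamma>) (map (tm_i C S \<Gamma>) ts) = m_class T (cx \<Gamma>) (cx \<sigma>s) (concat (map (tr_tm \<Gamma>) ts))"
    using Fun.IH Fun.prems by (intro tup_tr[OF Fun.prems s]) (auto elim: list_all2_mono)
  moreover have "mor (cx \<Gamma>) (cx \<sigma>s) (concat (map (tr_tm \<Gamma>) ts))"
    using Fun.prems fun_sorts[OF Fun.hyps] tr_tms_sort[OF s] by (simp add: wf_cx)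
  ultimately show ?case
    using C_cmp[of "cx \<Gamma>" "cx \<sigma>s" _ "sort_i S \<tau>" "m_rep (fun_i S f)"] fun_i_rep[OF Fun.hyps]
    by (simp add: ctx_i_eq)
qed

lemma tm_i_list:
  assumes "wf_ctx Sg' \<Gamma>" "list_all2 (has_sort Sg' \<Gamma>) ts \<sigma>s"
  shows "tup C (cx \<Gamma>) (map (tm_i C S \<Gamma>) ts) = m_class T (cx \<Gamma>) (cx \<sigma>s) (concat (map (tr_tm \<Gamma>) ts))"
  using assms(2) by (intro tup_tr[OF assms]) (auto elim: list_all2_mono intro: tm_i_eq[OF _ assms(1)])

lemma tr_fm_wf:
  "wf_fm L Sg' \<Gamma> \<phi> \<Longrightarrow> wf_ctx Sg' \<Gamma> \<Longrightarrow> wf_fm L Sg (cx \<Gamma>) (tr_fm \<phi> \<Gamma>)"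
proof (induction rule: wf_fm.induct)
  case (Rel r \<sigma>s \<Gamma> ts)
  then show ?case
    by (auto intro: wf_fm_fsub[OF rel_i_rep(2)[OF Rel(1)]] tr_tms_sort)
next
  case (Equal \<sigma> \<Gamma> t u)
  then have "\<forall>\<phi>\<in>set (eqs (sort_i S \<sigma>) (tr_tm \<Gamma> t) (tr_tm \<Gamma> u)). wf_fm L Sg (cx \<Gamma>) \<phi>"
    by (intro wf_eqs wf_sort tr_tm_sort)
  then show ?case by (simp add: wf_tensors)
qed (auto simp: wf_sort)

text \<open>Extending a context by the block of a sort is already concatenation, so the reindexing
  in the quantifier clause of \<open>fm_i\<close> disappears.\<close>

lemma ext_iso_eq:
  assumes "wf_ctx Sg' \<Gamma>" "\<sigma> \<in> sorts Sg'"
  shows "ext_iso C S \<Gamma> \<sigma> = ident C (cx (\<Gamma> @ [\<sigma>]))"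
proof -
  let ?\<Gamma> = "map (sort_i S) \<Gamma>" and ?b = "cx \<Gamma>" and ?c = "sort_i S \<sigma>"
  let ?v = "\<lambda>i. vars (length (concat (take i ?\<Gamma>))) (length (concat (take (Suc i) ?\<Gamma>))) :: 'f tm list"
  let ?w = "vars (length ?b) (length ?b + length ?c) :: 'f tm list"
  have wf: "wf_ctx Sg ?b" "wf_ctx Sg ?c" using assms by (simp_all add: wf_cx wf_sort)
  have obj: "set ?\<Gamma> \<subseteq> obj C" using assms wf_sort by (auto simp: C_obj wf_ctx_def)
  have sl: "mor ?b (?\<Gamma> ! i) (?v i)" if "i < length \<Gamma>" for i
    using mor_slice[OF obj, of i] that by (simp add: cx_def)
  have "concat (map ?v [0..<length \<Gamma>]) = vars 0 (length ?b)"
    by (rule concat_slices[of ?\<Gamma>, unfolded length_map, folded cx_def])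
  then have vs: "concat (map ?v [0..<length \<Gamma>] @ [?w]) = vars 0 (length (?b @ ?c))"
    by (simp add: vars_append del: length_concat)
  have "cmp C (prj C ?\<Gamma> i) (fst_p C ?b ?c) = m_class T (?b @ ?c) (?\<Gamma> ! i) (?v i)"
    if i: "i < length \<Gamma>" for i
  proof -
    have "map (tsub (vars 0 (length ?b))) (?v i) = ?v i"
      using sl[OF i] list_sort_scoped[of Sg ?b "?v i" "?\<Gamma> ! i"] by (intro map_tsub_ident) blast
    then show ?thesis
      using C_cmp[OF mor_fst[OF wf] sl[OF i]] by (simp only: C_prj C_fst_p cx_def)
  qed
  then have "ext_iso C S \<Gamma> \<sigma> = tup C (?b @ ?c)
      (map2 (m_class T (?b @ ?c)) (?\<Gamma> @ [?c]) (map ?v [0..<length \<Gamma>] @ [?w]))"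
    unfolding ext_iso_def Let_def ctx_i_eq C_snd_p
    by (simp, intro arg_cong[of _ _ "tup C (?b @ ?c)"]) (auto intro: nth_equalityI)
  also have "\<dots> = m_class T (?b @ ?c) (concat (?\<Gamma> @ [?c])) (concat (map ?v [0..<length \<Gamma>] @ [?w]))"
  proof (rule C_tup)
    show "wf_ctx Sg (?b @ ?c)" using wf by simp
    have "mor (?b @ ?c) (?\<Gamma> ! i) (?v i)" if "i < length \<Gamma>" for i
      using sl[OF that] wf list_sort_weaken[of Sg ?b "?v i" "?\<Gamma> ! i" ?c] by simp
    then have "list_all2 (\<lambda>ts \<Delta>. mor (?b @ ?c) \<Delta> ts) (map ?v [0..<length \<Gamma>]) ?\<Gamma>"
      by (subst list_all2_conv_all_nth) (simp del: length_concat)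
    then show "list_all2 (\<lambda>ts \<Delta>. mor (?b @ ?c) \<Delta> ts) (map ?v [0..<length \<Gamma>] @ [?w]) (?\<Gamma> @ [?c])"
      using mor_snd[OF wf] by (intro list_all2_appendI) simp_all
  qed
  also note vs
  also have "concat (?\<Gamma> @ [?c]) = ?b @ ?c" by (simp add: cx_def)
  finally show ?thesis by (simp add: C_ident)
qed

lemma fm_i_eq:
  "wf_fm L Sg' \<Gamma> \<phi> \<Longrightarrow> wf_ctx Sg' \<Gamma> \<Longrightarrow> fm_i C S \<phi> \<Gamma> = p_class T (cx \<Gamma>) (tr_fm \<phi> \<Gamma>)"
proof (induction rule: wf_fm.induct)
  case (Rel r \<sigma>s \<Gamma> ts)
  have "mor (cx \<Gamma>) (cx \<sigma>s) (concat (map (tr_tm \<Gamma>) ts))"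
    using Rel rel_sorts[OF Rel(1)] tr_tms_sort by (simp add: wf_cx)
  from C_pmap[OF this rel_i_rep(2)[OF Rel(1)]] rel_i_rep(1)[OF Rel(1)]
  show ?case using tm_i_list[OF Rel(3,2)] by (simp add: ctx_i_eq)
next
  case (Equal \<sigma> \<Gamma> t u)
  then have "mor (cx \<Gamma>) (sort_i S \<sigma>) (tr_tm \<Gamma> t)" "mor (cx \<Gamma>) (sort_i S \<sigma>) (tr_tm \<Gamma> u)"
    using tr_tm_mor by blast+
  from C_pmap_peq[OF this] C_tup2[OF this] Equal show ?case
    by (simp add: ctx_i_eq tm_i_eq)
next
  case (Conn \<phi>s k \<Gamma>)
  have "map (\<lambda>\<phi>. fm_i C S \<phi> \<Gamma>) \<phi>s = map (p_class T (cx \<Gamma>)) (map (\<lambda>\<phi>. tr_fm \<phi> \<Gamma>) \<phi>s)"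
    using Conn by auto
  moreover have "\<forall>\<phi>\<in>set (map (\<lambda>\<phi>. tr_fm \<phi> \<Gamma>) \<phi>s). wf_fm L Sg (cx \<Gamma>) \<phi>"
    using Conn by (auto intro: tr_fm_wf)
  ultimately show ?case
    using C_pconn[of "cx \<Gamma>" "map (\<lambda>\<phi>. tr_fm \<phi> \<Gamma>) \<phi>s" k] Conn.hyps Conn.prems wf_cx
    by (simp only: fm_i.simps tr_fm.simps ctx_i_eq length_map)
next
  case (Quant \<sigma> \<Gamma> \<phi> q)
  have "fm_i C S \<phi> (\<Gamma> @ [\<sigma>]) = p_class T (cx \<Gamma> @ sort_i S \<sigma>) (tr_fm \<phi> (\<Gamma> @ [\<sigma>]))"
    using Quant by simp
  moreover have "wf_fm L Sg (cx \<Gamma> @ sort_i S \<sigma>) (tr_fm \<phi> (\<Gamma> @ [\<sigma>]))"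
    using Quant tr_fm_wf[of "\<Gamma> @ [\<sigma>]" \<phi>] by simp
  moreover have "wf_ctx Sg (cx \<Gamma> @ sort_i S \<sigma>)" using Quant by (simp add: wf_cx wf_sort)
  ultimately show ?case
    using Quant by (simp add: ctx_i_eq ext_iso_eq C_pquant C_pmap_ident del: wf_ctx_append)
qed

lemma big_tensor_classes:
  assumes "wf_ctx Sg \<Gamma>" "\<forall>\<phi>\<in>set \<Phi>. wf_fm L Sg \<Gamma> \<phi>"
  shows "big_tensor (p_tensor L C \<Gamma>) (p_unit L C \<Gamma>) (map (p_class T \<Gamma>) \<Phi>) = p_class T \<Gamma> (tensors L \<Phi>)"
  using assms(2)
  by (induction \<Phi> rule: induct_list012) (auto simp: C_unit C_tensor assms(1) wf_tensors)

lemma satisfies_iff: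
  "wf_assertion L Sg' a \<Longrightarrow> satisfies L C S a \<longleftrightarrow> tr_holds a"
proof (cases a)
  case (Eqn \<Gamma> M N \<tau>)
  assume "wf_assertion L Sg' a"
  then have "wf_ctx Sg' \<Gamma>" "has_sort Sg' \<Gamma> M \<tau>" "has_sort Sg' \<Gamma> N \<tau>" by (simp_all add: Eqn)
  then show ?thesis
    using m_class_eq_iff[OF tr_tm_mor tr_tm_mor] by (simp add: Eqn tm_i_eq[of \<Gamma> _ \<tau>])
next
  case (Seq \<Gamma> \<Phi> \<psi>)
  assume "wf_assertion L Sg' a"
  then have wf: "wf_ctx Sg' \<Gamma>" "\<forall>\<phi>\<in>set \<Phi>. wf_fm L Sg' \<Gamma> \<phi>" "wf_fm L Sg' \<Gamma> \<psi>" by (auto simp: Seq)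
  let ?\<Phi> = "map (\<lambda>\<phi>. tr_fm \<phi> \<Gamma>) \<Phi>"
  have \<Phi>: "\<forall>\<phi>\<in>set ?\<Phi>. wf_fm L Sg (cx \<Gamma>) \<phi>" using wf by (auto intro: tr_fm_wf)
  have "map (\<lambda>\<phi>. fm_i C S \<phi> \<Gamma>) \<Phi> = map (p_class T (cx \<Gamma>)) ?\<Phi>"
    using wf by (simp add: fm_i_eq)
  then have "satisfies L C S a \<longleftrightarrow> Seq (cx \<Gamma>) [tensors L ?\<Phi>] (tr_fm \<psi> \<Gamma>) \<in> T"
    using big_tensor_classes[OF wf_cx[OF wf(1)] \<Phi>] wf \<Phi>
    by (simp add: Seq Let_def ctx_i_eq fm_i_eq C_ple wf_cx tr_fm_wf wf_tensors del: map_map map_eq_conv)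
  \<comment> \<open>The order compares the tensor of the antecedents with the succedent; reflection
    turns that tensor back into the list in the translated sequent.\<close>
  then show ?thesis by (simp add: Seq Seq_tensor_iffs)
qed

section \<open>The translation commutes with substitution\<close>

lemma tr_tm_weaken: "tm_scoped (length \<Delta>) t \<Longrightarrow> tr_tm (\<Delta> @ \<Theta>) t = tr_tm \<Delta> t"
  by (induction t) (auto cong: map_cong)

text \<open>For a variable this is projection after tupling, for a function symbol associativity of
  substitution applied to the fixed representative.\<close>

lemma tr_tm_tsub:
  "has_sort Sg' \<Gamma> t \<tau> \<Longrightarrow> list_all2 (has_sort Sg' \<Delta>) ts \<Gamma> \<Longrightarrow>
   tr_tm \<Delta> (tsub ts t) = map (tsub (concat (map (tr_tm \<Delta>) ts))) (tr_tm \<Gamma> t)"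
proof (induction rule: has_sort.induct)
  case (Var i)
  then show ?case
    using map_tsub_slice[OF length_tr_tms[OF Var.prems], of i] by (simp add: cx_take list_all2_lengthD)
next
  case (Fun f \<sigma>s \<tau> us)
  let ?R = "concat (map (tr_tm \<Delta>) ts)" and ?U = "concat (map (tr_tm \<Gamma>) us)"
  have s: "list_all2 (has_sort Sg' \<Gamma>) us \<sigma>s" using Fun.IH by (auto elim: list_all2_mono)
  have "\<forall>u\<in>set us. tr_tm \<Delta> (tsub ts u) = map (tsub ?R) (tr_tm \<Gamma> u)"
    using Fun.IH Fun.prems by (auto simp: list_all2_conv_all_nth in_set_conv_nth)
  then have "concat (map (tr_tm \<Delta>) (map (tsub ts) us)) = map (tsub ?R) ?U"
    by (simp add: map_concat comp_def cong: map_cong)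
  moreover have "\<forall>t\<in>set (m_rep (fun_i S f)). tm_scoped (length ?U) t"
    using list_all2_lengthD[OF tr_tms_sort[OF s]] fun_i_rep(2)[OF Fun.hyps] list_sort_scoped by metis
  then have "map (tsub (map (tsub ?R) ?U)) (m_rep (fun_i S f)) =
      map (tsub ?R) (map (tsub ?U) (m_rep (fun_i S f)))"
    by (simp add: tsub_tsub del: length_concat)
  ultimately show ?case by (simp del: map_map)
qed

text \<open>At a quantifier, the bound variable added to the substitution is translated to the fresh
  block that \<open>fsub_foldr_Quant\<close> produces, and \<open>tr_tm_weaken\<close> keeps the
  other terms unchanged over the longer context.\<close>

lemma tr_fm_fsub:
  "wf_fm L Sg' \<Gamma> \<phi> \<Longrightarrow> list_all2 (has_sort Sg' \<Delta>) ts \<Gamma> \<Longrightarrow> m = length \<Delta> \<Longrightarrow>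
   tr_fm (fsub m ts \<phi>) \<Delta> = fsub (length (cx \<Delta>)) (concat (map (tr_tm \<Delta>) ts)) (tr_fm \<phi> \<Gamma>)"
proof (induction arbitrary: \<Delta> ts m rule: wf_fm.induct)
  case (Rel r \<sigma>s \<Gamma> us)
  let ?R = "concat (map (tr_tm \<Delta>) ts)" and ?U = "concat (map (tr_tm \<Gamma>) us)"
  have "\<forall>u\<in>set us. tr_tm \<Delta> (tsub ts u) = map (tsub ?R) (tr_tm \<Gamma> u)"
    using Rel.hyps(2) tr_tm_tsub[OF _ Rel.prems(1)] by (metis list_all2_conv_all_nth in_set_conv_nth)
  then have "concat (map (tr_tm \<Delta>) (map (tsub ts) us)) = map (tsub ?R) ?U"
    by (simp add: map_concat comp_def cong: map_cong)
  moreover have "fsub (length (cx \<Delta>)) ?R (fsub (length (cx \<Gamma>)) ?U (p_rep (rel_i S r))) =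
      fsub (length (cx \<Delta>)) (map (tsub ?R) ?U) (p_rep (rel_i S r))"
    using list_all2_lengthD[OF tr_tms_sort[OF Rel.prems(1)]]
    by (intro fsub_comp[OF rel_i_rep(2)[OF Rel.hyps(1)] tr_tms_sort[OF Rel.hyps(2)]]) auto
  ultimately show ?case by (simp del: map_map)
next
  case (Equal \<sigma> \<Gamma> t u)
  then show ?case by (simp add: fsub_tensors map_fsub_eqs tr_tm_tsub)
next
  case (Quant \<sigma> \<Gamma> \<phi> q)
  have "list_all2 (has_sort Sg' (\<Delta> @ [\<sigma>])) (ts @ [Var m]) (\<Gamma> @ [\<sigma>])"
    using Quant.prems by (simp add: list_all2_appendI list_sort_weaken)
  from Quant.IH[OF this] Quant.prems(2)
  have "tr_fm (fsub (Suc m) (ts @ [Var m]) \<phi>) (\<Delta> @ [\<sigma>]) =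
    fsub (length (cx \<Delta>) + length (sort_i S \<sigma>))
      (concat (map (tr_tm (\<Delta> @ [\<sigma>])) ts) @ vars (length (cx \<Delta>)) (length (cx \<Delta>) + length (sort_i S \<sigma>)))
      (tr_fm \<phi> (\<Gamma> @ [\<sigma>]))" by simp
  moreover have "map (tr_tm (\<Delta> @ [\<sigma>])) ts = map (tr_tm \<Delta>) ts"
    using list_sort_scoped[OF Quant.prems(1)] by (auto intro: tr_tm_weaken)
  ultimately show ?case by (simp add: fsub_foldr_Quant)
qed (auto cong: map_cong)

lemma tr_tm_vars:
  assumes "i \<le> j" "j \<le> length \<Gamma>"
  shows "concat (map (tr_tm \<Gamma>) (vars i j)) = vars (length (cx (take i \<Gamma>))) (length (cx (take j \<Gamma>)))"
  using assms
proof (induction j rule: dec_induct)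
  case (step j)
  have "length (cx (take i \<Gamma>)) \<le> length (cx (take j \<Gamma>))"
    using step.hyps by (metis cx_append le_add1 le_add_diff_inverse length_append take_add)
  moreover have "length (cx (take j \<Gamma>)) \<le> length (cx (take (Suc j) \<Gamma>))"
    using step.prems by (simp add: take_Suc_conv_app_nth)
  ultimately show ?case using step by (simp add: vars_Suc vars_append)
qed simp

section \<open>Soundness\<close>

text \<open>Together with \<open>tr_diag\<close>, this brings translated premises and conclusions of
  the adjoint rules into the shape of their versions for lists of variables.\<close>

lemma tr_wk:
  assumes "wf_fm L Sg' \<Gamma> \<phi>" "n = length \<Gamma>"
  shows "tr_fm (wk n \<phi>) (\<Gamma> @ [\<sigma>]) =
    fsub (length (cx \<Gamma>) + length (sort_i S \<sigma>)) (vars 0 (length (cx \<Gamma>))) (tr_fm \<phi> \<Gamma>)"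
proof -
  have "list_all2 (has_sort Sg' (\<Gamma> @ [\<sigma>])) (vars 0 n) \<Gamma>"
    using assms(2) by (simp add: list_sort_weaken)
  from tr_fm_fsub[OF assms(1) this, of "Suc n"] show ?thesis
    using assms(2) tr_tm_vars[of 0 n "\<Gamma> @ [\<sigma>]"] by (simp add: wk_def)
qed

lemma tr_diag:
  assumes "wf_fm L Sg' (\<Gamma> @ [\<sigma>, \<sigma>]) \<psi>" "n = length \<Gamma>" "N = length (cx \<Gamma>)" "k = length (sort_i S \<sigma>)"
  shows "tr_fm (fsub (Suc n) (vars 0 (Suc n) @ [Var n]) \<psi>) (\<Gamma> @ [\<sigma>]) =
    fsub (N + k) (vars 0 (N + k) @ vars N (N + k)) (tr_fm \<psi> (\<Gamma> @ [\<sigma>, \<sigma>]))"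
proof -
  have "list_all2 (has_sort Sg' (\<Gamma> @ [\<sigma>])) (vars 0 (Suc n) @ [Var n]) ((\<Gamma> @ [\<sigma>]) @ [\<sigma>])"
    using assms(2) list_sort_vars_ident[of Sg' "\<Gamma> @ [\<sigma>]"] by (intro list_all2_appendI) simp_all
  then have "list_all2 (has_sort Sg' (\<Gamma> @ [\<sigma>])) (vars 0 (Suc n) @ [Var n]) (\<Gamma> @ [\<sigma>, \<sigma>])" by simp
  from tr_fm_fsub[OF assms(1) this, of "Suc n"] show ?thesis
    using assms(2-4) tr_tm_vars[of 0 "Suc n" "\<Gamma> @ [\<sigma>]"] by simp
qed

text \<open>\<open>Cwk\<close> and \<open>Sub\<close> are both instances of simultaneous
  substitution, with equal lists for \<open>Cwk\<close> and provably equal ones for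
  \<open>Sub\<close>.\<close>

lemma tr_Seq_subst:
  assumes "tr_holds (Seq \<Gamma> \<Phi> \<psi>)" "wf_assertion L Sg' (Seq \<Gamma> \<Phi> \<psi>)" "m = length \<Delta>"
    and "list_all2 (has_sort Sg' \<Delta>) ts \<Gamma>" "list_all2 (has_sort Sg' \<Delta>) us \<Gamma>"
    and "tms_eqv (cx \<Delta>) (cx \<Gamma>) (concat (map (tr_tm \<Delta>) ts)) (concat (map (tr_tm \<Delta>) us))"
  shows "tr_holds (Seq \<Delta> (map (fsub m ts) \<Phi>) (fsub m us \<psi>))"
  using Seq_subst_eqv[OF _ assms(6), of "map (\<lambda>\<phi>. tr_fm \<phi> \<Gamma>) \<Phi>" "tr_fm \<psi> \<Gamma>"] assms(1,2)
    tr_fm_fsub[OF _ assms(4,3)] tr_fm_fsub[OF _ assms(5,3)]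
  by (simp add: comp_def cong: map_cong)

lemma tr_inst_meta: "tr_fm (inst_meta v m) \<Gamma> = inst_meta (\<lambda>i. tr_fm (v i) \<Gamma>) m"
  by (induction m) auto

text \<open>Meta-formulas contain only connectives, which the translation leaves in place, so the
  translated instance is the instance of the same scheme at the translated formulas.\<close>

lemma tr_inst_seq: "tr_holds (inst_seq \<Gamma> v w s) \<longleftrightarrow>
  inst_seq (cx \<Gamma>) (\<lambda>i. tr_fm (v i) \<Gamma>) (\<lambda>i. map (\<lambda>\<phi>. tr_fm \<phi> \<Gamma>) (w i)) s \<in> T"
proof (cases s)
  case (MSeq xs m)
  have "map (\<lambda>\<phi>. tr_fm \<phi> \<Gamma>) (inst_item v w x) =
    inst_item (\<lambda>i. tr_fm (v i) \<Gamma>) (\<lambda>i. map (\<lambda>\<phi>. tr_fm \<phi> \<Gamma>) (w i)) x" for x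
    by (cases x) (simp_all add: tr_inst_meta)
  then show ?thesis by (simp add: MSeq map_concat comp_def tr_inst_meta)
qed

text \<open>Commutation with substitution is available for sorted syntax only; since
  \<open>T'\<close> is a theory, \<open>closure_wf\<close> provides the sorting of every
  premise.\<close>

lemma tr_sound:
  assumes T': "is_theory L Sg' T'" "\<forall>a\<in>T'. tr_holds a"
  shows "a \<in> closure L X Sg' T' \<Longrightarrow> tr_holds a"
proof (induction rule: closure.induct)
  case (Hyp a)
  then show ?case using T'(2) by blast
next
  case (Refl \<Gamma> M \<tau>)
  then show ?case by (simp add: tms_eqv_refl wf_cx tr_tm_sort)
next
  case (Sym \<Gamma> M N \<tau>)
  then show ?case by (simp add: tms_eqv_sym)
next
  case (Trans \<Gamma> M N \<tau> K)
  then show ?case by (auto intro: tms_eqv_trans)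
next
  case (Subst \<Gamma> M N \<tau> \<Delta> ts us)
  have MN: "has_sort Sg' \<Gamma> M \<tau>" "has_sort Sg' \<Gamma> N \<tau>"
    using closure_wf[OF wf_L wf_X T'(1) Subst.hyps(1)] by auto
  have "has_sort Sg' \<Delta> (ts ! i) (\<Gamma> ! i) \<and> has_sort Sg' \<Delta> (us ! i) (\<Gamma> ! i)" if "i < length \<Gamma>" for i
    using closure_wf[OF wf_L wf_X T'(1), of "Eqn \<Delta> (ts ! i) (us ! i) (\<Gamma> ! i)"] Subst.IH that by auto
  then have tu: "list_all2 (has_sort Sg' \<Delta>) ts \<Gamma>" "list_all2 (has_sort Sg' \<Delta>) us \<Gamma>"
    using Subst.hyps by (auto simp: list_all2_conv_all_nth)
  have "tms_eqv (cx \<Delta>) (cx \<Gamma>) (concat (map (tr_tm \<Delta>) ts)) (concat (map (tr_tm \<Delta>) us))"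
    unfolding cx_def[of \<Gamma>] using Subst by (intro tms_eqv_concat) (auto intro: wf_cx)
  with Subst.IH(1) show ?case
    using tr_tm_tsub[OF MN(1) tu(1)] tr_tm_tsub[OF MN(2) tu(2)] by (simp add: tms_eqv_tsub)
next
  case (Ax \<Gamma> \<phi>)
  then show ?case by (simp add: rule_Ax wf_cx tr_fm_wf)
next
  case (Cut \<Gamma> \<Phi> \<phi> \<Psi> \<Psi>' \<psi>)
  then show ?case using rule_Cut by simp
next
  case (Cwk \<Gamma> \<Gamma>' \<Phi> \<psi> \<sigma> n m xs)
  note W = closure_wf[OF wf_L wf_X T'(1) Cwk.hyps(1)]
  have xs: "list_all2 (has_sort Sg' (\<Gamma> @ [\<sigma>] @ \<Gamma>')) xs (\<Gamma> @ \<Gamma>')"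
    using Cwk list_sort_vars[OF refl refl refl, of Sg' "\<Gamma> @ [\<sigma>]" \<Gamma>' "[]"]
      list_sort_vars[OF refl refl refl, of Sg' "[]" \<Gamma> "[\<sigma>] @ \<Gamma>'"]
    by (auto intro!: list_all2_appendI)
  have "wf_ctx Sg' (\<Gamma> @ [\<sigma>] @ \<Gamma>')" using W Cwk.hyps by simp
  then have "tms_eqv (cx (\<Gamma> @ [\<sigma>] @ \<Gamma>')) (cx (\<Gamma> @ \<Gamma>'))
      (concat (map (tr_tm (\<Gamma> @ [\<sigma>] @ \<Gamma>')) xs)) (concat (map (tr_tm (\<Gamma> @ [\<sigma>] @ \<Gamma>')) xs))"
    by (intro tms_eqv_refl tr_tms_sort xs wf_cx)
  from tr_Seq_subst[OF Cwk.IH W Cwk.hyps(4) xs xs this] show ?case .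
next
  case (Sub \<Gamma> \<Gamma>' M M' \<sigma> \<Phi> \<psi> n m)
  let ?\<Delta> = "\<Gamma> @ \<Gamma>'"
  note W = closure_wf[OF wf_L wf_X T'(1) Sub.hyps(2)]
  have M: "has_sort Sg' ?\<Delta> M \<sigma>" "has_sort Sg' ?\<Delta> M' \<sigma>" and ctx: "wf_ctx Sg' ?\<Delta>"
    using closure_wf[OF wf_L wf_X T'(1) Sub.hyps(1)] by auto
  have v: "list_all2 (has_sort Sg' ?\<Delta>) (vars 0 n) \<Gamma>" "list_all2 (has_sort Sg' ?\<Delta>) (vars n m) \<Gamma>'"
    using Sub.hyps list_sort_vars[OF refl refl refl, of Sg' \<Gamma> \<Gamma>' "[]"]
      list_sort_vars[OF refl refl refl, of Sg' "[]" \<Gamma> \<Gamma>'] by simp_all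
  have x: "list_all2 (has_sort Sg' ?\<Delta>) (vars 0 n @ [K] @ vars n m) (\<Gamma> @ [\<sigma>] @ \<Gamma>')"
    if "has_sort Sg' ?\<Delta> K \<sigma>" for K
    using v that by (intro list_all2_appendI) auto
  have vv: "tms_eqv (cx ?\<Delta>) (cx \<Gamma>) (concat (map (tr_tm ?\<Delta>) (vars 0 n))) (concat (map (tr_tm ?\<Delta>) (vars 0 n)))"
    "tms_eqv (cx ?\<Delta>) (cx \<Gamma>') (concat (map (tr_tm ?\<Delta>) (vars n m))) (concat (map (tr_tm ?\<Delta>) (vars n m)))"
    by (rule tms_eqv_refl[OF wf_cx[OF ctx] tr_tms_sort[OF v(1)]]
        tms_eqv_refl[OF wf_cx[OF ctx] tr_tms_sort[OF v(2)]])+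
  have MM: "tms_eqv (cx ?\<Delta>) (sort_i S \<sigma>) (tr_tm ?\<Delta> M) (tr_tm ?\<Delta> M')" using Sub.IH(1) by simp
  \<comment> \<open>The blocks for \<open>\<Gamma>\<close> and \<open>\<Gamma>'\<close> agree on
    both sides; only the middle block changes, by the translated equation.\<close>
  have "tms_eqv (cx ?\<Delta>) (cx \<Gamma> @ sort_i S \<sigma> @ cx \<Gamma>')
      (concat (map (tr_tm ?\<Delta>) (vars 0 n)) @ tr_tm ?\<Delta> M @ concat (map (tr_tm ?\<Delta>) (vars n m)))
      (concat (map (tr_tm ?\<Delta>) (vars 0 n)) @ tr_tm ?\<Delta> M' @ concat (map (tr_tm ?\<Delta>) (vars n m)))"
    using list_all2_lengthD[OF tr_tms_sort[OF v(1)]] list_all2_lengthD[OF tr_tm_sort[OF M(1)]]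
      list_all2_lengthD[OF tr_tm_sort[OF M(2)]] vv MM
    by (simp only: tms_eqv_append)
  then have "tms_eqv (cx ?\<Delta>) (cx (\<Gamma> @ [\<sigma>] @ \<Gamma>'))
      (concat (map (tr_tm ?\<Delta>) (vars 0 n @ [M] @ vars n m)))
      (concat (map (tr_tm ?\<Delta>) (vars 0 n @ [M'] @ vars n m)))" by simp
  from tr_Seq_subst[OF Sub.IH(2) W Sub.hyps(4) x[OF M(1)] x[OF M(2)] this] show ?case .
next
  case (Quant_Con \<Gamma> \<sigma> \<phi> \<psi> q)
  then show ?case
    using fm_eqv_foldr_Quant[of "cx \<Gamma>" "sort_i S \<sigma>" "tr_fm \<phi> (\<Gamma> @ [\<sigma>])" "tr_fm \<psi> (\<Gamma> @ [\<sigma>])" q]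
    by (simp add: fm_eqv_def)
next
  case (Conn_Cong \<Gamma> \<phi>s k \<psi>s)
  then have "list_all2 (fm_eqv (cx \<Gamma>)) (map (\<lambda>\<phi>. tr_fm \<phi> \<Gamma>) \<phi>s) (map (\<lambda>\<phi>. tr_fm \<phi> \<Gamma>) \<psi>s)"
    by (simp add: list_all2_conv_all_nth fm_eqv_def)
  with Conn_Cong show ?case
    using fm_eqv_Conn[OF wf_cx, of \<Gamma> _ _ k] by (simp add: fm_eqv_def)
next
  case (Tensor_Ref1 \<Gamma> \<Phi> \<alpha> \<beta> \<Psi> \<theta>)
  then show ?case by (simp add: Seq_tensor_iff)
next
  case (Tensor_Ref2 \<Gamma> \<Phi> \<alpha> \<beta> \<Psi> \<theta>)
  then show ?case by (simp add: Seq_tensor_iff)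
next
  case (Unit_Ref1 \<Gamma> \<Phi> \<Psi> \<theta>)
  then show ?case by (simp add: Seq_unit_iff)
next
  case (Unit_Ref2 \<Gamma> \<Phi> \<Psi> \<theta>)
  then show ?case by (simp add: Seq_unit_iff)
next
  case (Eq_Adj1 n \<Gamma> \<sigma> \<psi> \<Phi>)
  let ?N = "length (cx \<Gamma>)" and ?k = "length (sort_i S \<sigma>)"
  have W: "wf_ctx Sg' (\<Gamma> @ [\<sigma>])" "\<forall>\<phi>\<in>set \<Phi>. wf_fm L Sg' (\<Gamma> @ [\<sigma>]) \<phi>"
    using closure_wf[OF wf_L wf_X T'(1) Eq_Adj1.hyps(4)] by auto
  have wk: "tr_fm (wk (Suc n) \<phi>) (\<Gamma> @ [\<sigma>, \<sigma>]) =
      fsub (?N + ?k + ?k) (vars 0 (?N + ?k)) (tr_fm \<phi> (\<Gamma> @ [\<sigma>]))" if "\<phi> \<in> set \<Phi>" for \<phi>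
    using tr_wk[of "\<Gamma> @ [\<sigma>]" \<phi> "Suc n" \<sigma>] W(2) that Eq_Adj1.hyps(2) by simp
  have "wf_fm L Sg (cx \<Gamma> @ sort_i S \<sigma> @ sort_i S \<sigma>) (tr_fm \<psi> (\<Gamma> @ [\<sigma>, \<sigma>]))"
    using tr_fm_wf[OF Eq_Adj1.hyps(3)] W(1) by simp
  from Eq_Adj1_list[OF Eq_Adj1.hyps(1) refl refl this, of "map (\<lambda>\<phi>. tr_fm \<phi> (\<Gamma> @ [\<sigma>])) \<Phi>"]
  show ?case
    using Eq_Adj1.IH Eq_Adj1.hyps(2) tr_diag[OF Eq_Adj1.hyps(3,2) refl refl] wk
    by (simp add: comp_def add.assoc cong: map_cong)
next
  case (Eq_Adj2 n \<Gamma> \<Phi> \<sigma> \<psi>)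
  let ?N = "length (cx \<Gamma>)" and ?k = "length (sort_i S \<sigma>)"
  have W: "wf_ctx Sg' (\<Gamma> @ [\<sigma>])" "wf_fm L Sg' (\<Gamma> @ [\<sigma>, \<sigma>]) \<psi>"
    using closure_wf[OF wf_L wf_X T'(1) Eq_Adj2.hyps(4)] by auto
  have wk: "tr_fm (wk (Suc n) \<phi>) (\<Gamma> @ [\<sigma>, \<sigma>]) =
      fsub (?N + ?k + ?k) (vars 0 (?N + ?k)) (tr_fm \<phi> (\<Gamma> @ [\<sigma>]))" if "\<phi> \<in> set \<Phi>" for \<phi>
    using tr_wk[of "\<Gamma> @ [\<sigma>]" \<phi> "Suc n" \<sigma>] Eq_Adj2.hyps(3) that Eq_Adj2.hyps(2) by simp
  have "\<forall>\<phi>\<in>set (map (\<lambda>\<phi>. tr_fm \<phi> (\<Gamma> @ [\<sigma>])) \<Phi>). wf_fm L Sg (cx \<Gamma> @ sort_i S \<sigma>) \<phi>"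
    using tr_fm_wf[of "\<Gamma> @ [\<sigma>]"] Eq_Adj2.hyps(3) W(1) by auto
  from Eq_Adj2_list[OF Eq_Adj2.hyps(1) refl refl this, of "tr_fm \<psi> (\<Gamma> @ [\<sigma>, \<sigma>])"]
  show ?case
    using Eq_Adj2.IH Eq_Adj2.hyps(2) tr_diag[OF W(2) Eq_Adj2.hyps(2) refl refl] wk
    by (simp add: comp_def add.assoc cong: map_cong)
next
  case (All_Adj1 \<Phi> \<Gamma> \<sigma> \<psi>)
  have W: "wf_ctx Sg' \<Gamma>" using closure_wf[OF wf_L wf_X T'(1) All_Adj1.hyps(3)] by simp
  have "\<forall>\<phi>\<in>set (map (\<lambda>\<phi>. tr_fm \<phi> \<Gamma>) \<Phi>). wf_fm L Sg (cx \<Gamma>) \<phi>"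
    using All_Adj1.hyps(2) W by (auto intro: tr_fm_wf)
  from All_Adj1_list[OF All_Adj1.hyps(1) this refl refl] show ?case
    using All_Adj1.IH All_Adj1.hyps(2) tr_wk[OF _ refl] by (simp add: comp_def cong: map_cong)
next
  case (All_Adj2 \<Gamma> \<Phi> \<sigma> \<psi>)
  have W: "\<forall>\<phi>\<in>set \<Phi>. wf_fm L Sg' \<Gamma> \<phi>"
    using closure_wf[OF wf_L wf_X T'(1) All_Adj2.hyps(2)] by simp
  have "Seq (cx \<Gamma>) (map (\<lambda>\<phi>. tr_fm \<phi> \<Gamma>) \<Phi>)
      (foldr (Quant Forall) (sort_i S \<sigma>) (tr_fm \<psi> (\<Gamma> @ [\<sigma>]))) \<in> T"
    using All_Adj2.IH by simp
  from All_Adj2_list[OF All_Adj2.hyps(1) refl refl this] show ?case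
    using W tr_wk[OF _ refl] by (simp add: comp_def cong: map_cong)
next
  case (Ex_Adj1 \<Phi> \<Gamma> \<theta> \<sigma> \<psi>)
  have W: "wf_ctx Sg' \<Gamma>" using closure_wf[OF wf_L wf_X T'(1) Ex_Adj1.hyps(4)] by simp
  have "\<forall>\<phi>\<in>set (map (\<lambda>\<phi>. tr_fm \<phi> \<Gamma>) \<Phi>). wf_fm L Sg (cx \<Gamma>) \<phi>" "wf_fm L Sg (cx \<Gamma>) (tr_fm \<theta> \<Gamma>)"
    using Ex_Adj1.hyps(2,3) W by (auto intro: tr_fm_wf)
  from Ex_Adj1_list[OF Ex_Adj1.hyps(1) this refl refl] show ?case
    using Ex_Adj1.IH Ex_Adj1.hyps(2,3) tr_wk[OF _ refl] by (simp add: comp_def cong: map_cong)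
next
  case (Ex_Adj2 \<Gamma> \<Phi> \<sigma> \<psi> \<theta>)
  have W: "\<forall>\<phi>\<in>set \<Phi>. wf_fm L Sg' \<Gamma> \<phi>" "wf_fm L Sg' \<Gamma> \<theta>"
    using closure_wf[OF wf_L wf_X T'(1) Ex_Adj2.hyps(2)] by simp_all
  have "Seq (cx \<Gamma>) (map (\<lambda>\<phi>. tr_fm \<phi> \<Gamma>) \<Phi> @
      [foldr (Quant Exists) (sort_i S \<sigma>) (tr_fm \<psi> (\<Gamma> @ [\<sigma>]))]) (tr_fm \<theta> \<Gamma>) \<in> T"
    using Ex_Adj2.IH by simp
  from Ex_Adj2_list[OF Ex_Adj2.hyps(1) refl refl this] show ?case
    using W tr_wk[OF _ refl] by (simp add: comp_def cong: map_cong)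
next
  case (Rule r \<Gamma> v w)
  have "inst_seq (cx \<Gamma>) (\<lambda>i. tr_fm (v i) \<Gamma>) (\<lambda>i. map (\<lambda>\<phi>. tr_fm \<phi> \<Gamma>) (w i)) (concl_of r) \<in> T"
    using Rule by (intro rule_Rule) (auto simp: wf_cx tr_fm_wf tr_inst_seq)
  then show ?case by (simp add: tr_inst_seq)
qed

lemma satisfies_closure:
  assumes "is_theory L Sg' T'" "\<forall>a\<in>T'. satisfies L C S a" "a \<in> closure L X Sg' T'"
  shows "satisfies L C S a"
proof -
  have "\<forall>a\<in>T'. tr_holds a"
    using assms(1,2) satisfies_iff by (auto simp: is_theory_def)
  from tr_sound[OF assms(1) this assms(3)] show ?thesis
    using satisfies_iff closure_wf[OF wf_L wf_X assms(1,3)] by blast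
qed

end


section \<open>The generic structure\<close>

locale closed_theory_wf_sig = closed_theory L X Sg T
  for L :: "'k lang" and X :: "'k logic" and Sg :: "('s, 'f, 'r) signat"
    and T :: "('s, 'f, 'r, 'k) assertion set" +
  assumes wf_Sg: "wf_sig Sg"
begin

text \<open>Each symbol is interpreted by itself, applied to the variables of its own context.
  Outside the signature \<open>the\<close> yields arbitrary values, which
  \<open>is_structure\<close> does not constrain.\<close>

definition generic :: "('s, 'f, 'r, 's list, ('s, 'f) ctx_mor, ('s, 'f, 'r, 'k) fm set) interp" where
  "generic = \<lparr>sort_i = (\<lambda>\<sigma>. [\<sigma>]),
     fun_i = (\<lambda>f. case the (funs Sg f) of (\<sigma>s, \<tau>) \<Rightarrow>
       m_class T \<sigma>s [\<tau>] [Fun f (vars 0 (length \<sigma>s))]),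
     rel_i = (\<lambda>r. let \<sigma>s = the (rels Sg r) in p_class T \<sigma>s (Rel r (vars 0 (length \<sigma>s))))\<rparr>"

lemma ctx_generic: "ctx_i C generic \<Gamma> = \<Gamma>"
  by (simp add: ctx_i_def generic_def)

lemma generic_fun_mor:
  assumes "funs Sg f = Some (\<sigma>s, \<tau>)"
  shows "mor \<sigma>s [\<tau>] [Fun f (vars 0 (length \<sigma>s))]"
  using assms wf_Sg by (auto simp: wf_sig_def intro: has_sort.Fun)

lemma generic_structure: "is_structure Sg C generic"
  unfolding is_structure_def ctx_generic
proof (intro conjI allI ballI impI)
  show "\<sigma> \<in> sorts Sg \<Longrightarrow> sort_i generic \<sigma> \<in> obj C" for \<sigma>
    by (simp add: generic_def C_obj)
  show "funs Sg f = Some (\<sigma>s, \<tau>) \<Longrightarrow> fun_i generic f \<in> hom C \<sigma>s (sort_i generic \<tau>)" for f \<sigma>s \<tau>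
    using generic_fun_mor[of f \<sigma>s \<tau>] by (auto simp: generic_def C_hom)
  show "rels Sg r = Some \<sigma>s \<Longrightarrow> rel_i generic r \<in> props C \<sigma>s" for r \<sigma>s
    by (auto simp: generic_def C_props)
qed

sublocale gen: structure_in_classifying L X Sg T Sg generic
  by unfold_locales (rule wf_Sg, rule generic_structure)

lemma gen_sort [simp]: "sort_i generic = (\<lambda>\<sigma>. [\<sigma>])"
  by (simp add: generic_def)

lemma gen_cx [simp]: "gen.cx \<Gamma> = \<Gamma>"
  by (simp add: gen.cx_def)

lemma gen_tms_eqv:
  assumes "list_all2 (\<lambda>t \<tau>. tms_eqv \<Gamma> [\<tau>] (gen.tr_tm \<Gamma> t) [t]) ts \<sigma>s" "wf_ctx Sg \<Gamma>"
  shows "tms_eqv \<Gamma> \<sigma>s (concat (map (gen.tr_tm \<Gamma>) ts)) ts"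
  using assms(1)
proof (induction rule: list_all2_induct)
  case (Cons t ts \<sigma> \<sigma>s)
  then obtain u where "gen.tr_tm \<Gamma> t = [u]" by (auto simp: tms_eqv_def length_Suc_conv)
  with Cons show ?case by (simp add: tms_eqv_Cons)
qed (simp add: assms(2))

text \<open>\<open>m_rep\<close> may return any term provably equal to the symbol applied to its
  variables, so \<open>t\<close> itself is not recovered literally; congruence under substitution
  carries the equality through the arguments.\<close>

lemma gen_tm_eqv:
  "has_sort Sg \<Gamma> t \<tau> \<Longrightarrow> wf_ctx Sg \<Gamma> \<Longrightarrow> tms_eqv \<Gamma> [\<tau>] (gen.tr_tm \<Gamma> t) [t]"
proof (induction rule: has_sort.induct)
  case (Var i)
  then show ?case by (simp add: vars_single tms_eqv_single rule_Refl min_absorb2 Suc_le_eq)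
next
  case (Fun f \<sigma>s \<tau> ts)
  have "list_all2 (\<lambda>t \<tau>. tms_eqv \<Gamma> [\<tau>] (gen.tr_tm \<Gamma> t) [t]) ts \<sigma>s"
    using Fun by (auto elim!: list_all2_mono)
  note ts = gen_tms_eqv[OF this Fun.prems]
  have "fun_i generic f = m_class T \<sigma>s [\<tau>] [Fun f (vars 0 (length \<sigma>s))]"
    using Fun.hyps by (simp add: generic_def)
  then have "tms_eqv \<sigma>s [\<tau>] (m_rep (fun_i generic f)) [Fun f (vars 0 (length \<sigma>s))]"
    using m_rep_eqv[OF generic_fun_mor[OF Fun.hyps]] by (simp add: tms_eqv_sym)
  moreover have "map (tsub ts) (vars 0 (length \<sigma>s)) = ts"
    using ts by (simp add: map_tsub_vars_slice tms_eqv_def)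
  ultimately show ?case using tms_eqv_tsub[OF _ ts] by fastforce
qed

lemma gen_tms_eqv': "list_all2 (has_sort Sg \<Gamma>) ts \<sigma>s \<Longrightarrow> wf_ctx Sg \<Gamma> \<Longrightarrow>
  tms_eqv \<Gamma> \<sigma>s (concat (map (gen.tr_tm \<Gamma>) ts)) ts"
  by (rule gen_tms_eqv) (auto elim!: list_all2_mono intro: gen_tm_eqv)

text \<open>Congruence for atomic formulas comes from substitution: provably equal lists of terms
  are substituted into an atomic formula whose arguments are variables.\<close>

lemma gen_fm_eqv:
  "wf_fm L Sg \<Gamma> \<phi> \<Longrightarrow> wf_ctx Sg \<Gamma> \<Longrightarrow> fm_eqv \<Gamma> (gen.tr_fm \<phi> \<Gamma>) \<phi>"
proof (induction rule: wf_fm.induct)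
  case (Rel r \<sigma>s \<Gamma> ts)
  have "wf_ctx Sg \<sigma>s" using wf_Sg Rel(1) by (auto simp: wf_sig_def)
  then have "fm_eqv \<sigma>s (Rel r (vars 0 (length \<sigma>s))) (p_rep (rel_i generic r))"
    using Rel(1) p_rep_eqv[of \<sigma>s "Rel r (vars 0 (length \<sigma>s))"] by (simp add: generic_def)
  from fm_eqv_fsub[OF fm_eqv_sym[OF this] gen_tms_eqv'[OF Rel(2,3)] refl] show ?case
    using Rel(2) by (simp add: map_tsub_vars_slice list_all2_lengthD)
next
  case (Equal \<sigma> \<Gamma> t u)
  have "fm_eqv [\<sigma>, \<sigma>] (Equal \<sigma> (Var 0) (Var 1)) (Equal \<sigma> (Var 0) (Var 1))"
    using Equal by (intro fm_eqv_refl) auto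
  moreover have "tms_eqv \<Gamma> [\<sigma>, \<sigma>] (gen.tr_tm \<Gamma> t @ gen.tr_tm \<Gamma> u) [t, u]"
    using gen_tms_eqv'[of \<Gamma> "[t, u]" "[\<sigma>, \<sigma>]"] Equal by simp
  moreover obtain t' u' where "gen.tr_tm \<Gamma> t = [t']" "gen.tr_tm \<Gamma> u = [u']"
    using gen_tm_eqv[of \<Gamma> t \<sigma>] gen_tm_eqv[of \<Gamma> u \<sigma>] Equal
    by (auto simp: tms_eqv_def length_Suc_conv)
  ultimately show ?case
    using fm_eqv_fsub[of "[\<sigma>, \<sigma>]" "Equal \<sigma> (Var 0) (Var 1)" "Equal \<sigma> (Var 0) (Var 1)" \<Gamma> _ "[t, u]"] by force
next
  case (Conn \<phi>s k \<Gamma>)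
  then show ?case by (auto intro!: fm_eqv_Conn simp: list_all2_conv_all_nth)
next
  case (Quant \<sigma> \<Gamma> \<phi> q)
  then show ?case by (auto intro: fm_eqv_Quant)
qed

text \<open>Both directions matter for completeness: one makes the generic structure a model, the
  other ensures that it satisfies nothing beyond \<open>T\<close>.\<close>

lemma generic_satisfies_iff:
  assumes "wf_assertion L Sg a"
  shows "satisfies L C generic a \<longleftrightarrow> a \<in> T"
proof (cases a)
  case (Eqn \<Gamma> M N \<tau>)
  then have "tms_eqv \<Gamma> [\<tau>] (gen.tr_tm \<Gamma> M) [M]" "tms_eqv \<Gamma> [\<tau>] (gen.tr_tm \<Gamma> N) [N]"
    using assms gen_tm_eqv by auto
  then have "tms_eqv \<Gamma> [\<tau>] (gen.tr_tm \<Gamma> M) (gen.tr_tm \<Gamma> N) \<longleftrightarrow> tms_eqv \<Gamma> [\<tau>] [M] [N]"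
    by (meson tms_eqv_sym tms_eqv_trans)
  then show ?thesis using gen.satisfies_iff[OF assms] by (simp add: Eqn tms_eqv_single)
next
  case (Seq \<Gamma> \<Phi> \<psi>)
  then have "list_all2 (fm_eqv \<Gamma>) (map (\<lambda>\<phi>. gen.tr_fm \<phi> \<Gamma>) \<Phi>) \<Phi>" "fm_eqv \<Gamma> (gen.tr_fm \<psi> \<Gamma>) \<psi>"
    using assms by (auto simp: list_all2_conv_all_nth gen_fm_eqv)
  from Seq_cong[OF this] show ?thesis using gen.satisfies_iff[OF assms] by (simp add: Seq)
qed

end

section \<open>Soundness and completeness for the class of classifying prop-categories\<close>

lemma classifying_cats_subset_FA:
  assumes "wf_lang L" "\<forall>r\<in>rules X. wf_rule L r"
  shows "classifying_cats L X \<subseteq> FA L"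
  unfolding classifying_cats_def
  using assms by (auto intro!: closed_theory.C_in_FA closed_theory.intro)

lemma entails_imp_models:
  assumes "wf_lang L" "\<forall>r\<in>rules X. wf_rule L r" "wf_sig Sg" "is_theory L Sg T" "entails L X Sg T T'"
  shows "models L Sg (classifying_cats L X) T T'"
  unfolding models_def classifying_cats_def
proof (clarify)
  fix S a Sg0 T0
  assume S: "is_structure Sg (classifying L Sg0 T0) S"
    "\<forall>a\<in>T. satisfies L (classifying L Sg0 T0) S a" and a: "a \<in> T'"
    and T0: "L_theory L X Sg0 T0"
  interpret structure_in_classifying L X Sg0 T0 Sg S
    using assms(1-3) S(1) T0 by unfold_locales
  show "satisfies L (classifying L Sg0 T0) S a"
    using satisfies_closure[OF assms(4) S(2)] a assms(5) by (auto simp: entails_def)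
qed

lemma models_imp_entails:
  fixes Sg :: "('s, 'f, 'r) signat" and T T' :: "('s, 'f, 'r, 'k) assertion set"
  assumes "wf_lang L" "\<forall>r\<in>rules X. wf_rule L r" "wf_sig Sg" "is_theory L Sg T" "is_theory L Sg T'"
    and models: "models L Sg (classifying_cats L X :: ('s, 'f, 'r, 'k) class_cat set) T T'"
  shows "entails L X Sg T T'"
proof -
  let ?T = "closure L X Sg T"
  \<comment> \<open>The class contains classifying prop-categories of L-theories only, so the
    generic structure is formed over the closure; \<open>T\<close> holds in it because
    \<open>T\<close> is contained in its closure.\<close>
  have L_theory: "L_theory L X Sg ?T"
    using closure_wf[OF assms(1,2,4)] by (simp add: L_theory_def is_theory_def closure_idem)
  interpret closed_theory_wf_sig L X Sg ?T
    using assms(1-3) L_theory by unfold_locales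
  have "C \<in> classifying_cats L X"
    using assms(3) L_theory by (auto simp: classifying_cats_def)
  moreover have "\<forall>a\<in>T. satisfies L C generic a"
    using assms(4) generic_satisfies_iff by (auto simp: is_theory_def intro: closure.Hyp)
  ultimately have "\<forall>a\<in>T'. satisfies L C generic a"
    using models generic_structure unfolding models_def by blast
  then show ?thesis
    using assms(5) generic_satisfies_iff by (auto simp: is_theory_def entails_def)
qed

text \<open>Type variables are quantified at the outside only. The equivalence therefore uses the
  universes of the given theories, where completeness already finds its countermodel, and a last
  conjunct with type variables of its own extends soundness to all universes.\<close>

theorem mainTheorem4:
  fixes L :: "'k lang" and X :: "'k logic"
    and Sg :: "('s, 'f, 'r) signat"
    and T T' :: "('s, 'f, 'r, 'k) assertion set"
  assumes "wf_lang L"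
    and "\<forall>r\<in>rules X. wf_rule L r"
    and "wf_sig Sg"
    and "is_theory L Sg T"
    and "is_theory L Sg T'"
  shows "(classifying_cats L X :: ('s, 'f, 'r, 'k) class_cat set) \<subseteq> FA L \<and>
    (entails L X Sg T T' \<longleftrightarrow>
       models L Sg (classifying_cats L X :: ('s, 'f, 'r, 'k) class_cat set) T T') \<and>
    (entails L X Sg T T' \<longrightarrow>
       models L Sg (classifying_cats L X :: ('s1, 'f1, 'r1, 'k) class_cat set) T T')"
proof (intro conjI iffI impI)
  show "classifying_cats L X \<subseteq> FA L" by (rule classifying_cats_subset_FA[OF assms(1,2)])
next
  assume "entails L X Sg T T'"
  then show "models L Sg (classifying_cats L X :: ('s, 'f, 'r, 'k) class_cat set) T T'"
    by (rule entails_imp_models[OF assms(1-4)])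
next
  assume "models L Sg (classifying_cats L X :: ('s, 'f, 'r, 'k) class_cat set) T T'"
  then show "entails L X Sg T T'" by (rule models_imp_entails[OF assms])
next
  assume "entails L X Sg T T'"
  then show "models L Sg (classifying_cats L X :: ('s1, 'f1, 'r1, 'k) class_cat set) T T'"
    by (rule entails_imp_models[OF assms(1-4)])
qed

end
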